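(* Let $n\ge 2$, $p,q>1$, $c_1,c_2\ge 0$, and $b\in L^1(\mathbb{R}_+)$. Let $(\mathbb{R}^n,\mathfrak{g})$ be an asymptotically Euclidean manifold as described in the context, and assume hypothesis (H) holds. Let $0\le u_0,u_1\in C_0^\infty(\mathbb{R}^n)$, not both identically zero, with $\mathrm{supp}(u_0,u_1)\subset\{|x|\le R_0\}$ for some $R_0>0$. Consider $$\partial_t^2u-\Delta_{\mathfrak{g}}u+b(t)u_t=c_1|u_t|^p+c_2|u|^q,\qquad u(0,x)=\varepsilon u_0(x),\ u_t(0,x)=\varepsilon u_1(x),$$ and suppose it has a weak solution $u\in C^2([0,T_\varepsilon);\mathcal{D}'(\mathbb{R}^n))$ with $u_t\in L^p_{loc}([0,T_\varepsilon)\times\mathbb{R}^n)$, $|u|^q\in C([0,T_\varepsilon);\mathcal{D}'(\mathbb{R}^n))$, and $$\mathrm{supp}\,u\subset\Big\{(t,x):\int_0^{|x|}K(\tau)\,d\tau\le t+R_1\Big\}$$ for some $R_1\ge\int_0^{R_0}K(\tau)\,d\tau$. Then there exist constants $\varepsilon_0>0$ and $C_0>0$ such that for every $\varepsilon\in(0,\varepsilon_0)$: (1) if $c_1>0$ and $1<p\le p_G(n)$, then $T_\varepsilon\le C_0\varepsilon^{-\frac{2(p-1)}{2-(n-1)(p-1)}}$ when $1<p<p_G(n)$, and $T_\varepsilon\le\exp(C_0\varepsilon^{-(p-1)})$ when $p=p_G(n)$; (2) if $c_1c_2>0$ and $(q-1)((n-1)p-2)<4$, then $T_\varepsilon\le C_0\varepsilon^{-\frac{2p(q-1)}{2q+2-(n-1)p(q-1)}}$;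 (3) if $c_2>0$ and $1<q<p_S(n)$, then $T_\varepsilon\le C_0\varepsilon^{\frac{2q(q-1)}{(n-1)q^2-(n+1)q-2}}$; (4) if $c_2>0$, $n=2$, $1<q<2$ and $u_1\not\equiv 0$, then $T_\varepsilon\le C_0\varepsilon^{-\frac{q-1}{3-q}}$.
   Context: Asymptotically Euclidean manifold: $(\mathbb{R}^n,\mathfrak{g})$ is a Riemannian manifold with $\mathfrak{g}=\mathfrak{g}_1+\mathfrak{g}_2$, where in polar coordinates $x=r\omega$ one has $\mathfrak{g}_1=K^2(r)dr^2+r^2d\omega^2$ ($d\omega^2$ the standard metric on $\mathbb{S}^{n-1}$) with $|\partial_r^k(K-1)|\lesssim\langle r\rangle^{-k-\rho}$ for $k=0,1,2$ and some $\rho>0$, and $\mathfrak{g}_2=g_{2,jk}(x)dx^jdx^k$ with $\nabla^\beta g_{2,jk}=O(\langle r\rangle^{-\rho-1-|\beta|})$ for $|\beta|\le 2$. Here $\langle x\rangle=\sqrt{1+|x|^2}$, $A\lesssim B$ means $A\le CB$ for a constant $C>0$, and $\Delta_{\mathfrak{g}}$ is the Laplace–Beltrami operator. Hypothesis (H): there exist $\lambda,c>0$ and a nonnegative, not identically zero, entire solution $\phi$ of $\Delta_{\mathfrak{g}}\phi=\lambda^2\phi$ with $0\le\phi(x)\le c\langle\lambda r\rangle^{-\frac{n-1}{2}}e^{\lambda\int_0^rK(\tau)d\tau}$. The Glassey exponent is $p_G(n)=1+\frac{2}{n-1}$; the Strauss exponent $p_S(n)$ is the positive root of $(n-1)q^2-(n+1)q-2=0$.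 $T_\varepsilon$ denotes the lifespan of the solution. *)

theory Defs
  imports "HOL-Analysis.Analysis"
begin

definition jb :: "real \<Rightarrow> real" where
  "jb r = sqrt (1 + r\<^sup>2)"

definition pd :: "'n::finite \<Rightarrow> (real^'n \<Rightarrow> real) \<Rightarrow> real^'n \<Rightarrow> real" where
  "pd i f x = deriv (\<lambda>h. f (x + h *\<^sub>R axis i 1)) 0"

fun pds :: "'n::finite list \<Rightarrow> (real^'n \<Rightarrow> real) \<Rightarrow> real^'n \<Rightarrow> real" where
  "pds [] f = f"
| "pds (i # is) f = pd i (pds is f)"

definition Ck_on :: "nat \<Rightarrow> (real^'n::finite) set \<Rightarrow> (real^'n \<Rightarrow> real) \<Rightarrow> bool" where
  "Ck_on k S f \<longleftrightarrow>
     (\<forall>is. length is \<le> k \<longrightarrow> continuous_on S (pds is f)) \<and>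
     (\<forall>is i x. length is < k \<longrightarrow> x \<in> S \<longrightarrow>
        (\<lambda>h. pds is f (x + h *\<^sub>R axis i 1)) differentiable (at 0))"

definition smooth_fun :: "(real^'n::finite \<Rightarrow> real) \<Rightarrow> bool" where
  "smooth_fun f \<longleftrightarrow> (\<forall>k. Ck_on k UNIV f)"

definition test_fun :: "(real^'n::finite \<Rightarrow> real) \<Rightarrow> bool" where
  "test_fun f \<longleftrightarrow> smooth_fun f \<and> (\<exists>R. \<forall>x. R < norm x \<longrightarrow> f x = 0)"

definition riem_metric :: "(real^'n::finite \<Rightarrow> real^'n^'n) \<Rightarrow> bool" where
  "riem_metric G \<longleftrightarrow> (\<forall>i j. smooth_fun (\<lambda>x. G x $ i $ j)) \<and>
     (\<forall>x. transpose (G x) = G x \<and> (\<forall>v. v \<noteq> 0 \<longrightarrow> 0 < v \<bullet> (G x *v v)))"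

definition vdens :: "(real^'n::finite \<Rightarrow> real^'n^'n) \<Rightarrow> real^'n \<Rightarrow> real" where
  "vdens G x = sqrt (det (G x))"

definition LB :: "(real^'n::finite \<Rightarrow> real^'n^'n) \<Rightarrow> (real^'n \<Rightarrow> real) \<Rightarrow> real^'n \<Rightarrow> real" where
  "LB G f x = (1 / vdens G x) *
     (\<Sum>i\<in>UNIV. \<Sum>j\<in>UNIV. pd i (\<lambda>y. vdens G y * matrix_inv (G y) $ i $ j * pd j f y) x)"

text \<open>g_1 = K(r)^2 dr^2 + r^2 domega^2 written in Cartesian coordinates:
  (g_1)_jk = delta_jk + (K(r)^2 - 1) x_j x_k / r^2   (x \<noteq> 0).\<close>
definition G1 :: "(real \<Rightarrow> real) \<Rightarrow> real^'n::finite \<Rightarrow> real^'n^'n" where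
  "G1 K x = (\<chi> j k. (if j = k then 1 else 0) + ((K (norm x))\<^sup>2 - 1) * (x $ j) * (x $ k) / (norm x)\<^sup>2)"

definition asymp_euclidean :: "(real^'n::finite \<Rightarrow> real^'n^'n) \<Rightarrow> (real \<Rightarrow> real) \<Rightarrow> bool" where
  "asymp_euclidean G K \<longleftrightarrow> riem_metric G \<and>
     (\<exists>\<rho>>0.
       (\<exists>K1 K2 C. \<forall>r\<ge>0.
          (K has_real_derivative K1 r) (at r within {0..}) \<and>
          (K1 has_real_derivative K2 r) (at r within {0..}) \<and>
          \<bar>K r - 1\<bar> \<le> C * jb r powr (-\<rho>) \<and>
          \<bar>K1 r\<bar> \<le> C * jb r powr (-1 - \<rho>) \<and>
          \<bar>K2 r\<bar> \<le> C * jb r powr (-2 - \<rho>)) \<and>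
       (\<forall>j k. Ck_on 2 (-{0}) (\<lambda>x. G x $ j $ k - G1 K x $ j $ k) \<and>
          (\<exists>C. \<forall>\<beta> x. length \<beta> \<le> 2 \<longrightarrow> x \<noteq> 0 \<longrightarrow>
             \<bar>pds \<beta> (\<lambda>y. G y $ j $ k - G1 K y $ j $ k) x\<bar>
               \<le> C * jb (norm x) powr (-\<rho> - 1 - real (length \<beta>)))))"

definition hyp_H :: "(real^'n::finite \<Rightarrow> real^'n^'n) \<Rightarrow> (real \<Rightarrow> real) \<Rightarrow> bool" where
  "hyp_H G K \<longleftrightarrow> (\<exists>lam c \<phi>. 0 < lam \<and> 0 < c \<and> smooth_fun \<phi> \<and>
      (\<forall>x. 0 \<le> \<phi> x) \<and> (\<exists>x. \<phi> x \<noteq> 0) \<and>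
      (\<forall>x. LB G \<phi> x = lam\<^sup>2 * \<phi> x) \<and>
      (\<forall>x. \<phi> x \<le> c * jb (lam * norm x) powr (- (real CARD('n) - 1) / 2)
                     * exp (lam * integral {0..norm x} K)))"

definition p_G :: "real \<Rightarrow> real" where
  "p_G n = 1 + 2 / (n - 1)"

definition p_S :: "real \<Rightarrow> real" where
  "p_S n = ((n + 1) + sqrt ((n + 1)\<^sup>2 + 8 * (n - 1))) / (2 * (n - 1))"

text \<open>Weak solution on [0,T) of
   u_tt - Delta_g u + b(t) u_t = c1 |u_t|^p + c2 |u|^q,  u(0)=eps u0, u_t(0)=eps u1.
  u(t,.) is a locally integrable function for each t; ut is the time derivative
  (in L^p_loc of space-time).  Distributional pairings are taken w.r.t. the
  Riemannian volume dvol_g = sqrt(det g) dx (equivalent to dx-pairing since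
  sqrt(det g) is smooth and positive).  u \<in> C^2([0,T); D') means each pairing
  t \<mapsto> <u(t),psi> is C^2 on [0,T); |u|^q \<in> C([0,T);D') means its pairing is
  continuous; the equation holds in D'((0,T)) for each psi, i.e. for a.e. t.\<close>
definition weak_sol ::
  "(real^'n::finite \<Rightarrow> real^'n^'n) \<Rightarrow> (real \<Rightarrow> real) \<Rightarrow> real \<Rightarrow> real \<Rightarrow> real \<Rightarrow> real \<Rightarrow> real
   \<Rightarrow> (real^'n \<Rightarrow> real) \<Rightarrow> (real^'n \<Rightarrow> real) \<Rightarrow> real
   \<Rightarrow> (real \<Rightarrow> real^'n \<Rightarrow> real) \<Rightarrow> (real \<Rightarrow> real^'n \<Rightarrow> real) \<Rightarrow> bool" where
  "weak_sol G b c1 c2 p q \<epsilon> u0 u1 T u ut \<longleftrightarrow>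
     (\<forall>t\<in>{0..<T}. \<forall>S. compact S \<longrightarrow>
        set_integrable lborel S (u t) \<and> set_integrable lborel S (\<lambda>x. \<bar>u t x\<bar> powr q)) \<and>
     (\<forall>T'\<in>{0..<T}. \<forall>S. compact S \<longrightarrow>
        set_integrable (lborel \<Otimes>\<^sub>M lborel) ({0..T'} \<times> S) (\<lambda>z. \<bar>ut (fst z) (snd z)\<bar> powr p)) \<and>
     (\<forall>\<psi>. test_fun \<psi> \<longrightarrow>
        (\<exists>U1 U2.
           (\<forall>t\<in>{0..<T}.
              ((\<lambda>s. \<integral>x. u s x * \<psi> x * vdens G x \<partial>lborel) has_real_derivative U1 t) (at t within {0..<T}) \<and>
              (U1 has_real_derivative U2 t) (at t within {0..<T})) \<and>
           continuous_on {0..<T} U2 \<and>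
           continuous_on {0..<T} (\<lambda>t. \<integral>x. \<bar>u t x\<bar> powr q * \<psi> x * vdens G x \<partial>lborel) \<and>
           (AE t in lborel. t \<in> {0..<T} \<longrightarrow>
              U1 t = (\<integral>x. ut t x * \<psi> x * vdens G x \<partial>lborel)) \<and>
           (AE t in lborel. t \<in> {0..<T} \<longrightarrow>
              U2 t - (\<integral>x. u t x * LB G \<psi> x * vdens G x \<partial>lborel) + b t * U1 t
                = c1 * (\<integral>x. \<bar>ut t x\<bar> powr p * \<psi> x * vdens G x \<partial>lborel)
                  + c2 * (\<integral>x. \<bar>u t x\<bar> powr q * \<psi> x * vdens G x \<partial>lborel)) \<and>
           (\<integral>x. u 0 x * \<psi> x * vdens G x \<partial>lborel) = \<epsilon> * (\<integral>x. u0 x * \<psi> x * vdens G x \<partial>lborel) \<and>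
           U1 0 = \<epsilon> * (\<integral>x. u1 x * \<psi> x * vdens G x \<partial>lborel)))"

end

theory Submission
  imports Defs
begin

text \<open>
  The solution is averaged against the positive eigenfunction \<open>\<phi>\<close> of hypothesis (H) and against the
  constant 1, which gives \<open>U(t) = \<integral> u \<phi> dvol\<close> and \<open>F(t) = \<integral> u dvol\<close> with
  \<open>U'' + b U' = \<lambda>\<^sup>2 U + N\<^sub>\<phi>\<close> and \<open>F'' + b F' = N\<^sub>1\<close>, where \<open>N\<^sub>\<phi>\<close> and \<open>N\<^sub>1\<close> are the
  averaged nonlinearities. As \<open>b\<close> is integrable, the integrating factor \<open>exp (\<integral> |b|)\<close> is bounded, so
  \<open>exp (-\<lambda>t) (U' + \<lambda>U)\<close> is almost nondecreasing, hence at least of order \<open>\<epsilon>\<close>, and for late times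
  \<open>U'\<close> is at least a quarter of \<open>U' + \<lambda>U\<close>. The data are seen by \<open>U\<close> because \<open>\<phi> > 0\<close> everywhere, by
  the strong maximum principle.

  Hoelder's inequality on the forward cone, where the bound on \<open>\<phi>\<close> gives
  \<open>\<integral> \<phi>\<^sup>s dvol \<lesssim> (1+t)\<^sup>(\<^sup>n\<^sup>-\<^sup>1\<^sup>)\<^sup>(\<^sup>1\<^sup>-\<^sup>s\<^sup>/\<^sup>2\<^sup>) exp (\<lambda>st)\<close>, turns \<open>N\<^sub>\<phi>\<close> into a power of \<open>U'\<close>: this is a
  superlinear first order inequality and yields the Glassey bounds. The same inequality bounds \<open>N\<^sub>1\<close> from
  below by \<open>\<epsilon>\<^sup>p t\<^sup>a\<close> (through \<open>U'\<close>) or \<open>\<epsilon>\<^sup>q t\<^sup>a\<close> (through \<open>U\<close>), so \<open>F\<close> grows like a known power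
  of \<open>t\<close>; together with \<open>N\<^sub>1 \<gtrsim> (1+t)\<^sup>-\<^sup>n\<^sup>(\<^sup>q\<^sup>-\<^sup>1\<^sup>) F\<^sup>q\<close>, Kato's doubling argument gives the other bounds.
\<close>

section \<open>Functions of class C^k and cutoffs\<close>

text \<open>The damping \<open>b\<close> is merely integrable and without sign, and the averaged
  equations hold only for almost every time, so growth is always extracted from integrated
  inequalities. The functions \<phi> and 1 lack compact support; finite speed of propagation lets
  them be cut off beyond the front without changing their pairings with \<open>u\<close>. Every
  constant except the size of the data is fixed in a context that precedes the solution, hence is
  uniform in \<epsilon> and \<open>T\<close>. Origin of the exponents: in the Glassey case the
  weight left for \<open>Y\<close> is (1+t)^(-\<gamma>) with \<gamma> = (n-1)(p-1)/2; its integral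
  grows like a power if \<gamma> < 1 and like a logarithm if \<gamma> = 1, which is
  \<open>p = p_G n\<close>. In the Kato cases a bound F \<ge> A t^\<alpha> forces T^\<theta> to be
  at most of order A^(1-q) for large T, where \<theta> = (q-1) \<alpha> - n(q-1) + 2. A source of
  size t^a, integrated twice, gives \<alpha> = a + 2, with a = -(n-1)(p/2-1) from u_t and a =
  -(n-1)(q/2-1) from \<open>u\<close>; in case (4) linear growth gives \<alpha> = 1.\<close>

lemma pds_append: "pds (is @ js) f = pds is (pds js f)"
  by (induction "is") auto

lemma pd_eqI:
  "((\<lambda>h. f (x + h *\<^sub>R axis i 1)) has_real_derivative D) (at 0) \<Longrightarrow> pd i f x = D"
  unfolding pd_def by (rule DERIV_imp_deriv)

lemma Ck_on_0: "Ck_on 0 S f \<longleftrightarrow> continuous_on S f"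
  by (simp add: Ck_on_def)

lemma Ck_on_imp_continuous_on: "Ck_on k S f \<Longrightarrow> continuous_on S f"
  unfolding Ck_on_def by (metis le0 list.size(3) pds.simps(1))

lemma Ck_on_mono: "Ck_on k S f \<Longrightarrow> j \<le> k \<Longrightarrow> Ck_on j S f"
  unfolding Ck_on_def by (meson order_trans order_less_le_trans)

text \<open>The definition strips the outermost derivative of a list, whereas induction on the order
  needs the innermost one, so lists are split at their last entry by \<open>pds_append\<close>. The
  closure properties below are inductions along this recursion.\<close>

lemma Ck_on_Suc:
  "Ck_on (Suc k) S f \<longleftrightarrow> continuous_on S f \<and>
     (\<forall>i. \<forall>x\<in>S. ((\<lambda>h. f (x + h *\<^sub>R axis i 1)) has_real_derivative pd i f x) (at 0)) \<and>
     (\<forall>i. Ck_on k S (pd i f))" (is "?L \<longleftrightarrow> ?R")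
proof
  assume L: ?L
  have "((\<lambda>h. f (x + h *\<^sub>R axis i 1)) has_real_derivative pd i f x) (at 0)" if "x \<in> S" for i x
  proof -
    have "(\<lambda>h. pds [] f (x + h *\<^sub>R axis i 1)) differentiable (at 0)"
      using L that unfolding Ck_on_def by (metis list.size(3) zero_less_Suc)
    then show ?thesis
      unfolding pd_def by (simp add: DERIV_deriv_iff_real_differentiable)
  qed
  moreover have "Ck_on k S (pd i f)" for i
  proof -
    have *: "pds is (pd i f) = pds (is @ [i]) f" for "is"
      by (simp add: pds_append)
    show ?thesis
      unfolding Ck_on_def *
    proof (intro conjI allI impI)
      fix "is" :: "'a list" assume "length is \<le> k"
      then have "length (is @ [i]) \<le> Suc k" by simp
      then show "continuous_on S (pds (is @ [i]) f)"
        using L unfolding Ck_on_def by blast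
    next
      fix "is" :: "'a list" and j x assume "length is < k" "x \<in> S"
      then have "length (is @ [i]) < Suc k" by simp
      then show "(\<lambda>h. pds (is @ [i]) f (x + h *\<^sub>R axis j 1)) differentiable (at 0)"
        using L \<open>x \<in> S\<close> unfolding Ck_on_def by blast
    qed
  qed
  ultimately show ?R
    using Ck_on_imp_continuous_on[OF L] by blast
next
  assume R: ?R
  show ?L
    unfolding Ck_on_def
  proof (intro conjI allI impI)
    fix "is" :: "'a list" assume "length is \<le> Suc k"
    then show "continuous_on S (pds is f)"
      using R by (cases "is" rule: rev_cases) (auto simp: pds_append Ck_on_def)
  next
    fix "is" :: "'a list" and j x assume "length is < Suc k" "x \<in> S"
    then show "(\<lambda>h. pds is f (x + h *\<^sub>R axis j 1)) differentiable (at 0)"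
      using R by (cases "is" rule: rev_cases)
        (auto simp: pds_append Ck_on_def real_differentiable_def)
  qed
qed

lemma Ck_on_SucI:
  fixes f :: "real^'n::finite \<Rightarrow> real"
  assumes "continuous_on UNIV f"
    and "\<And>i x. ((\<lambda>h. f (x + h *\<^sub>R axis i 1)) has_real_derivative D i x) (at 0)"
    and "\<And>i. Ck_on k UNIV (D i)"
  shows "Ck_on (Suc k) UNIV f"
proof -
  have "pd i f = D i" for i
    using pd_eqI[OF assms(2)] by blast
  then show ?thesis
    using assms by (simp add: Ck_on_Suc)
qed

lemma Ck_on_UNIV_has_pd:
  fixes f :: "real^'n::finite \<Rightarrow> real"
  assumes "Ck_on (Suc k) UNIV f"
  shows "((\<lambda>h. f (x + h *\<^sub>R axis i 1)) has_real_derivative pd i f x) (at 0)"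
  using assms by (simp add: Ck_on_Suc)

lemma Ck_on_const: "Ck_on k UNIV (\<lambda>x::real^'n::finite. c)"
proof (induction k arbitrary: c)
  case (Suc k)
  show ?case
    by (rule Ck_on_SucI[where D = "\<lambda>i x. 0"]) (auto simp: Suc)
qed (simp add: Ck_on_0)

lemma Ck_on_nth: "Ck_on k UNIV (\<lambda>x::real^'n::finite. x $ j)"
proof (cases k)
  case (Suc k)
  show ?thesis
    unfolding Suc
    by (rule Ck_on_SucI[where D = "\<lambda>i x. if i = j then 1 else 0"])
      (auto simp: axis_def Ck_on_const intro!: continuous_intros derivative_eq_intros)
qed (auto simp: Ck_on_0 intro!: continuous_intros)

lemma Ck_on_add:
  fixes f g :: "real^'n::finite \<Rightarrow> real"
  assumes "Ck_on k UNIV f" "Ck_on k UNIV g"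
  shows "Ck_on k UNIV (\<lambda>x. f x + g x)"
  using assms
proof (induction k arbitrary: f g)
  case (Suc k)
  show ?case
    by (rule Ck_on_SucI[where D = "\<lambda>i x. pd i f x + pd i g x"])
      (use Suc in \<open>auto simp: Ck_on_Suc intro!: continuous_intros DERIV_add\<close>)
qed (auto simp: Ck_on_0 intro!: continuous_intros)

lemma Ck_on_mult:
  fixes f g :: "real^'n::finite \<Rightarrow> real"
  assumes "Ck_on k UNIV f" "Ck_on k UNIV g"
  shows "Ck_on k UNIV (\<lambda>x. f x * g x)"
  using assms
proof (induction k arbitrary: f g)
  case (Suc k)
  have le: "Ck_on k UNIV f" "Ck_on k UNIV g"
    using Suc.prems Ck_on_mono by (metis le_SucI le_refl)+
  show ?case
  proof (rule Ck_on_SucI[where D = "\<lambda>i x. pd i f x * g x + pd i g x * f x"])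
    show "continuous_on UNIV (\<lambda>x. f x * g x)"
      using Suc.prems by (auto simp: Ck_on_Suc intro!: continuous_intros)
  next
    fix i x
    show "((\<lambda>h. f (x + h *\<^sub>R axis i 1) * g (x + h *\<^sub>R axis i 1)) has_real_derivative
        pd i f x * g x + pd i g x * f x) (at 0)"
      using DERIV_mult[OF Ck_on_UNIV_has_pd[OF Suc.prems(1), of x i]
          Ck_on_UNIV_has_pd[OF Suc.prems(2), of x i]] by simp
  next
    fix i
    show "Ck_on k UNIV (\<lambda>x. pd i f x * g x + pd i g x * f x)"
      using Suc.prems le by (intro Ck_on_add Suc.IH) (auto simp: Ck_on_Suc)
  qed
qed (auto simp: Ck_on_0 intro!: continuous_intros)

lemma Ck_on_uminus:
  fixes f :: "real^'n::finite \<Rightarrow> real"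
  shows "Ck_on k UNIV f \<Longrightarrow> Ck_on k UNIV (\<lambda>x. - f x)"
  using Ck_on_mult[OF Ck_on_const[of k "-1"]] by simp

lemma Ck_on_diff:
  fixes f g :: "real^'n::finite \<Rightarrow> real"
  shows "Ck_on k UNIV f \<Longrightarrow> Ck_on k UNIV g \<Longrightarrow> Ck_on k UNIV (\<lambda>x. f x - g x)"
  using Ck_on_add[OF _ Ck_on_uminus] by fastforce

lemma Ck_on_sum:
  fixes f :: "'b \<Rightarrow> real^'n::finite \<Rightarrow> real"
  shows "(\<And>a. a \<in> A \<Longrightarrow> Ck_on k UNIV (f a)) \<Longrightarrow> Ck_on k UNIV (\<lambda>x. \<Sum>a\<in>A. f a x)"
  by (induction A rule: infinite_finite_induct) (auto intro!: Ck_on_const Ck_on_add)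

lemma Ck_on_prod:
  fixes f :: "'b \<Rightarrow> real^'n::finite \<Rightarrow> real"
  shows "(\<And>a. a \<in> A \<Longrightarrow> Ck_on k UNIV (f a)) \<Longrightarrow> Ck_on k UNIV (\<lambda>x. \<Prod>a\<in>A. f a x)"
  by (induction A rule: infinite_finite_induct) (auto intro!: Ck_on_const Ck_on_mult)

text \<open>Induction on \<open>k\<close> does not close for a single outer function, but it does
  for a family whose derivatives stay in the family up to a scalar. Powers, \<open>exp\<close> and
  \<open>flat_exp\<close> are such families.\<close>

lemma Ck_on_compose_family:
  fixes f :: "real^'n::finite \<Rightarrow> real" and h :: "'b \<Rightarrow> real \<Rightarrow> real"
  assumes "Ck_on k UNIV f" "\<And>x. f x \<in> S" "open S"
    and h: "\<And>a y. y \<in> S \<Longrightarrow> (h a has_real_derivative c a * h (d a) y) (at y)"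
  shows "Ck_on k UNIV (\<lambda>x. h a (f x))"
  using assms(1)
proof (induction k arbitrary: a)
  case 0
  have "continuous_on S (h a)"
    using h by (meson DERIV_continuous_on has_field_derivative_at_within)
  then show ?case
    using 0 assms(2) by (auto simp: Ck_on_0 intro: continuous_on_compose2)
next
  case (Suc k)
  have le: "Ck_on k UNIV f"
    using Suc.prems Ck_on_mono by (metis le_SucI le_refl)
  have "continuous_on S (h a)"
    using h by (meson DERIV_continuous_on has_field_derivative_at_within)
  then have "continuous_on UNIV (\<lambda>x. h a (f x))"
    using Suc.prems assms(2) by (auto simp: Ck_on_Suc intro: continuous_on_compose2)
  moreover have "((\<lambda>t. h a (f (x + t *\<^sub>R axis i 1))) has_real_derivative
      c a * h (d a) (f x) * pd i f x) (at 0)" for i x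
    using DERIV_chain2[OF _ Ck_on_UNIV_has_pd[OF Suc.prems, of x i]] h[OF assms(2)[of x], of a]
    by simp
  moreover have "Ck_on k UNIV (\<lambda>x. c a * h (d a) (f x) * pd i f x)" for i
    using Suc.prems by (intro Ck_on_mult Ck_on_const Suc.IH[OF le]) (auto simp: Ck_on_Suc)
  ultimately show ?case
    by (rule Ck_on_SucI)
qed

lemma Ck_on_powr:
  fixes f :: "real^'n::finite \<Rightarrow> real"
  assumes "Ck_on k UNIV f" "\<And>x. f x > 0"
  shows "Ck_on k UNIV (\<lambda>x. f x powr a)"
proof (rule Ck_on_compose_family[where h = "\<lambda>a y. y powr a" and S = "{0<..}" and c = "\<lambda>a. a"
      and d = "\<lambda>a. a - 1"])
  fix a y :: real assume "y \<in> {0<..}"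
  then show "((\<lambda>y. y powr a) has_real_derivative a * y powr (a - 1)) (at y)"
    by (auto intro!: derivative_eq_intros simp: powr_diff)
qed (use assms in auto)

lemma Ck_on_exp:
  fixes f :: "real^'n::finite \<Rightarrow> real"
  assumes "Ck_on k UNIV f"
  shows "Ck_on k UNIV (\<lambda>x. exp (f x))"
  by (rule Ck_on_compose_family[where h = "\<lambda>a. exp" and S = UNIV and c = "\<lambda>a. 1" and d = id])
    (use assms in \<open>auto intro!: derivative_eq_intros\<close>)

lemma Ck_on_inverse:
  fixes f :: "real^'n::finite \<Rightarrow> real"
  assumes "Ck_on k UNIV f" "\<And>x. f x > 0"
  shows "Ck_on k UNIV (\<lambda>x. inverse (f x))"
  using Ck_on_powr[OF assms, of "-1"] assms(2) by (simp add: powr_minus less_imp_le)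

lemma Ck_on_sqrt:
  fixes f :: "real^'n::finite \<Rightarrow> real"
  assumes "Ck_on k UNIV f" "\<And>x. f x > 0"
  shows "Ck_on k UNIV (\<lambda>x. sqrt (f x))"
  using Ck_on_powr[OF assms, of "1/2"] assms(2) by (simp add: powr_half_sqrt less_imp_le)

text \<open>The flat function exp(-1/x) times polynomials in y = 1/x. Differentiation sends P to y^2
  (P - P'), so the family fits \<open>Ck_on_compose_family\<close>.\<close>

definition flat_exp :: "real poly \<Rightarrow> real \<Rightarrow> real" where
  "flat_exp P x = (if x > 0 then poly P (1 / x) * exp (- (1 / x)) else 0)"

lemma flat_exp_tendsto: "(flat_exp P \<longlongrightarrow> 0) (at_right 0)"
proof -
  have "((\<lambda>y. poly P y * exp (- y)) \<longlongrightarrow> 0) at_top"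
  proof -
    have "((\<lambda>y. \<Sum>i\<le>degree P. coeff P i * (y ^ i / exp y)) \<longlongrightarrow> (\<Sum>i\<le>degree P. coeff P i * 0)) at_top"
      by (intro tendsto_intros tendsto_power_div_exp_0)
    then show ?thesis
      by (simp add: poly_altdef sum_distrib_right exp_minus divide_inverse mult.assoc)
  qed
  then have "((\<lambda>x. poly P (inverse x) * exp (- inverse x)) \<longlongrightarrow> 0) (at_right 0)"
    by (rule filterlim_compose) (rule filterlim_inverse_at_top_right)
  then show ?thesis
    by (rule Lim_transform_eventually)
      (auto simp: eventually_at_filter flat_exp_def inverse_eq_divide)
qed

lemma flat_exp_has_real_derivative:
  "(flat_exp P has_real_derivative flat_exp (monom 1 2 * (P - pderiv P)) x) (at x)"
proof -
  consider "x < 0" | "x > 0" | "x = 0" by linarith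
  then show ?thesis
  proof cases
    case 1
    have "((\<lambda>_. 0) has_real_derivative 0) (at x)" by simp
    then have "(flat_exp P has_real_derivative 0) (at x)"
      by (rule has_field_derivative_transform_within_open[where S = "{..<0}"])
        (use 1 in \<open>auto simp: flat_exp_def\<close>)
    then show ?thesis using 1 by (simp add: flat_exp_def)
  next
    case 2
    have "((\<lambda>x. poly P (1 / x) * exp (- (1 / x))) has_real_derivative
        poly (monom 1 2 * (P - pderiv P)) (1 / x) * exp (- (1 / x))) (at x)"
      using 2 by (auto intro!: derivative_eq_intros DERIV_chain2[OF poly_DERIV]
          simp: poly_monom field_simps power2_eq_square)
    then have "(flat_exp P has_real_derivative
        poly (monom 1 2 * (P - pderiv P)) (1 / x) * exp (- (1 / x))) (at x)"
      by (rule has_field_derivative_transform_within_open[where S = "{0<..}"])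
        (use 2 in \<open>auto simp: flat_exp_def\<close>)
    then show ?thesis using 2 by (simp add: flat_exp_def)
  next
    case 3
    have "((\<lambda>h. (flat_exp P (0 + h) - flat_exp P 0) / h) \<longlongrightarrow> 0) (at 0)"
    proof (rule filterlim_split_at)
      show "((\<lambda>h. (flat_exp P (0 + h) - flat_exp P 0) / h) \<longlongrightarrow> 0) (at_left 0)"
        by (rule tendsto_eventually) (auto simp: eventually_at_filter flat_exp_def)
      \<comment> \<open>Division by \<open>h\<close> multiplies the polynomial by y, so the quotient
        is again a \<open>flat_exp\<close> and tends to 0.\<close>
      show "((\<lambda>h. (flat_exp P (0 + h) - flat_exp P 0) / h) \<longlongrightarrow> 0) (at_right 0)"
        by (rule Lim_transform_eventually[OF flat_exp_tendsto[of "monom 1 1 * P"]])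
          (auto simp: eventually_at_filter flat_exp_def poly_monom)
    qed
    then show ?thesis
      using 3 by (simp add: DERIV_def flat_exp_def)
  qed
qed

lemma Ck_on_flat_exp:
  fixes f :: "real^'n::finite \<Rightarrow> real"
  assumes "Ck_on k UNIV f"
  shows "Ck_on k UNIV (\<lambda>x. flat_exp P (f x))"
  by (rule Ck_on_compose_family[where h = flat_exp and S = UNIV and c = "\<lambda>a. 1"
        and d = "\<lambda>P. monom 1 2 * (P - pderiv P)"])
    (use assms flat_exp_has_real_derivative in auto)

text \<open>A vanishes for |x|^2 \<ge> \<rho>^2 + 2 and B for |x|^2 \<le> \<rho>^2 + 1, so never
  both. Writing it in \<open>x \<bullet> x\<close> instead of the norm keeps it smooth at the
  origin.\<close>

definition cutoff :: "real \<Rightarrow> real^'n::finite \<Rightarrow> real" where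
  "cutoff \<rho> x = (let A = flat_exp 1 (\<rho>\<^sup>2 + 2 - x \<bullet> x); B = flat_exp 1 (x \<bullet> x - (\<rho>\<^sup>2 + 1))
     in A * inverse (A + B))"

lemma cutoff_denominator_pos:
  "flat_exp 1 (\<rho>\<^sup>2 + 2 - s) + flat_exp 1 (s - (\<rho>\<^sup>2 + 1)) > 0"
  by (auto simp: flat_exp_def add_pos_pos)

lemma smooth_fun_cutoff: "smooth_fun (cutoff \<rho> :: real^'n::finite \<Rightarrow> real)"
  unfolding smooth_fun_def cutoff_def Let_def
proof
  fix k
  have *: "Ck_on k UNIV (\<lambda>x::real^'n. x \<bullet> x)"
    unfolding inner_vec_def by (auto intro!: Ck_on_sum Ck_on_mult Ck_on_nth)
  show "Ck_on k UNIV (\<lambda>x::real^'n. flat_exp 1 (\<rho>\<^sup>2 + 2 - x \<bullet> x) *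
       inverse (flat_exp 1 (\<rho>\<^sup>2 + 2 - x \<bullet> x) + flat_exp 1 (x \<bullet> x - (\<rho>\<^sup>2 + 1))))"
    by (intro Ck_on_mult Ck_on_inverse Ck_on_add Ck_on_flat_exp Ck_on_diff Ck_on_const *
        cutoff_denominator_pos)
qed

lemma cutoff_nonneg: "0 \<le> cutoff \<rho> x"
  and cutoff_le_1: "cutoff \<rho> x \<le> 1"
proof -
  show "0 \<le> cutoff \<rho> x"
    by (auto simp: cutoff_def Let_def flat_exp_def)
  have "flat_exp 1 (x \<bullet> x - (\<rho>\<^sup>2 + 1)) \<ge> 0"
    by (auto simp: flat_exp_def)
  then show "cutoff \<rho> x \<le> 1"
    using cutoff_denominator_pos[of \<rho> "x \<bullet> x"] by (simp add: cutoff_def Let_def field_simps)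
qed

lemma cutoff_eq_1:
  assumes "0 \<le> \<rho>" "norm x \<le> \<rho>" shows "cutoff \<rho> x = 1"
proof -
  have "x \<bullet> x \<le> \<rho>\<^sup>2"
    using assms by (simp add: dot_square_norm power_mono)
  then show ?thesis
    using cutoff_denominator_pos[of \<rho> "x \<bullet> x"] by (auto simp: cutoff_def Let_def flat_exp_def)
qed

lemma cutoff_eq_0:
  assumes "0 \<le> \<rho>" "norm x \<ge> \<rho> + 2" shows "cutoff \<rho> x = 0"
proof -
  have "(\<rho> + 2)\<^sup>2 \<le> x \<bullet> x"
    using assms by (simp add: dot_square_norm power_mono)
  then have "\<rho>\<^sup>2 + 2 - x \<bullet> x \<le> 0"
    using assms by (simp add: power2_eq_square algebra_simps)
  then show ?thesis
    by (simp add: cutoff_def Let_def flat_exp_def)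
qed

lemma test_fun_mult_cutoff:
  fixes f :: "real^'n::finite \<Rightarrow> real"
  assumes "smooth_fun f" "0 \<le> \<rho>"
  shows "test_fun (\<lambda>x. f x * cutoff \<rho> x)"
  unfolding test_fun_def
proof
  show "smooth_fun (\<lambda>x. f x * cutoff \<rho> x)"
    using assms(1) smooth_fun_cutoff[of \<rho>, where ?'n = 'n] Ck_on_mult
    unfolding smooth_fun_def by blast
  show "\<exists>R. \<forall>x. R < norm x \<longrightarrow> f x * cutoff \<rho> x = 0"
    by (intro exI[of _ "\<rho> + 2"]) (auto simp: cutoff_eq_0[OF assms(2)])
qed

section \<open>Second order conditions at a minimum\<close>

text \<open>Continuity upgrades partial derivatives to a total one: the increment is telescoped over
  coordinates switched on one at a time, and each step is controlled by the mean value
  inequality.\<close>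

lemma Ck_on_1_has_derivative:
  fixes f :: "real^'n::finite \<Rightarrow> real"
  assumes f: "Ck_on (Suc k) UNIV f"
  shows "(f has_derivative (\<lambda>h. \<Sum>i\<in>UNIV. h $ i * pd i f x)) (at x)"
  unfolding has_derivative_at_alt
proof (intro conjI allI impI)
  show "bounded_linear (\<lambda>h. \<Sum>i\<in>UNIV. h $ i * pd i f x)"
    by (intro bounded_linear_sum bounded_linear_mult_const bounded_linear_vec_nth)
  fix e :: real assume "0 < e"
  define e' where "e' = e / CARD('n)"
  have e': "e' > 0" using \<open>0 < e\<close> by (simp add: e'_def)
  have cont: "continuous (at x) (pd i f)" for i
    using f Ck_on_imp_continuous_on[of k UNIV "pd i f"]
    by (auto simp: Ck_on_Suc continuous_on_eq_continuous_at)
  have "\<forall>\<^sub>F y in at x. \<forall>i\<in>UNIV. dist (pd i f y) (pd i f x) < e'"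
    by (intro eventually_ball_finite ballI finite) (use cont e' in \<open>auto simp: continuous_at tendsto_iff\<close>)
  then obtain d where d: "d > 0"
    and dd: "\<And>y i. y \<noteq> x \<Longrightarrow> dist y x < d \<Longrightarrow> dist (pd i f y) (pd i f x) < e'"
    unfolding eventually_at by auto
  have close: "\<bar>pd i f y - pd i f x\<bar> \<le> e'" if "dist y x < d" for y i
    using dd[of y i] that e' by (cases "y = x") (auto simp: dist_real_def)
  show "\<exists>d>0. \<forall>y. norm (y - x) < d \<longrightarrow>
        norm (f y - f x - (\<Sum>i\<in>UNIV. (y - x) $ i * pd i f x)) \<le> e * norm (y - x)"
  proof (intro exI[of _ d] conjI allI impI d)
    fix y assume y: "norm (y - x) < d"
    define h where "h = y - x"
    define hI where "hI I = (\<chi> i. if i \<in> I then h $ i else 0)" for I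
    have "\<bar>f (x + hI I) - f x - (\<Sum>i\<in>I. h $ i * pd i f x)\<bar> \<le> e' * (\<Sum>i\<in>I. \<bar>h $ i\<bar>)" if "finite I" for I
      using that
    proof (induction I rule: finite_induct)
      case empty
      have "hI {} = 0" by (simp add: hI_def vec_eq_iff)
      then show ?case by simp
    next
      case (insert j I)
      \<comment> \<open>With the linear part subtracted, the derivative of \<open>g\<close> is a
        difference of two values of \<open>pd j f\<close>, hence at most \<open>e'\<close> near
        \<open>x\<close>.\<close>
      define g where "g s = f (x + hI I + s *\<^sub>R axis j 1) - s * pd j f x" for s
      have "norm (g (h $ j) - g 0) \<le> e' * norm (h $ j - 0)"
      proof (rule field_differentiable_bound[where S = "cball (0::real) \<bar>h $ j\<bar>"
            and f' = "\<lambda>s. pd j f (x + hI I + s *\<^sub>R axis j 1) - pd j f x"])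
        fix s :: real assume s: "s \<in> cball 0 \<bar>h $ j\<bar>"
        have "((\<lambda>r. f ((x + hI I + s *\<^sub>R axis j 1) + r *\<^sub>R axis j 1)) has_real_derivative
            pd j f (x + hI I + s *\<^sub>R axis j 1)) (at 0)"
          by (rule Ck_on_UNIV_has_pd[OF f])
        then have "((\<lambda>r. f (x + hI I + (s + r) *\<^sub>R axis j 1)) has_real_derivative
            pd j f (x + hI I + s *\<^sub>R axis j 1)) (at 0)"
          by (simp add: scaleR_left_distrib add.assoc)
        then have "((\<lambda>r. f (x + hI I + r *\<^sub>R axis j 1)) has_real_derivative
            pd j f (x + hI I + s *\<^sub>R axis j 1)) (at s)"
          using DERIV_shift[of "\<lambda>r. f (x + hI I + r *\<^sub>R axis j 1)" _ 0 s]
          by (simp add: add.commute)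
        then have "(g has_real_derivative pd j f (x + hI I + s *\<^sub>R axis j 1) - pd j f x) (at s)"
          unfolding g_def by (auto intro!: derivative_eq_intros)
        then show "(g has_real_derivative pd j f (x + hI I + s *\<^sub>R axis j 1) - pd j f x)
            (at s within cball 0 \<bar>h $ j\<bar>)"
          by (rule has_field_derivative_at_within)
        have "norm (hI I + s *\<^sub>R axis j 1) \<le> norm h"
          by (rule norm_le_componentwise_cart)
            (use s insert in \<open>auto simp: hI_def axis_def\<close>)
        then have "dist (x + hI I + s *\<^sub>R axis j 1) x < d"
          using y by (simp add: h_def dist_norm add.assoc)
        from close[OF this]
        show "norm (pd j f (x + hI I + s *\<^sub>R axis j 1) - pd j f x) \<le> e'"
          by simp
      qed auto
      moreover have "hI (insert j I) = hI I + h $ j *\<^sub>R axis j 1"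
        using insert by (auto simp: hI_def vec_eq_iff axis_def)
      ultimately have "\<bar>f (x + hI (insert j I)) - f (x + hI I) - h $ j * pd j f x\<bar> \<le> e' * \<bar>h $ j\<bar>"
        by (simp add: g_def add.assoc)
      then show ?case
        using insert by (simp add: algebra_simps)
    qed
    from this[of UNIV] have "\<bar>f (x + h) - f x - (\<Sum>i\<in>UNIV. h $ i * pd i f x)\<bar> \<le> e' * (\<Sum>i\<in>UNIV. \<bar>h $ i\<bar>)"
      by (simp add: hI_def)
    also have "(\<Sum>i\<in>UNIV. \<bar>h $ i\<bar>) \<le> (\<Sum>i\<in>(UNIV::'n set). norm h)"
      by (intro sum_mono component_le_norm_cart)
    also have "e' * \<dots> = e * norm h"
      by (simp add: e'_def)
    finally show "norm (f y - f x - (\<Sum>i\<in>UNIV. (y - x) $ i * pd i f x)) \<le> e * norm (y - x)"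
      using e' by (simp add: h_def mult_left_mono)
  qed
qed

lemma Ck_on_1_directional:
  fixes f :: "real^'n::finite \<Rightarrow> real"
  assumes f: "Ck_on (Suc k) UNIV f"
  shows "((\<lambda>s. f (x + s *\<^sub>R v)) has_real_derivative (\<Sum>i\<in>UNIV. v $ i * pd i f (x + s *\<^sub>R v))) (at s)"
proof -
  have "((\<lambda>s. x + s *\<^sub>R v) has_derivative (\<lambda>s. s *\<^sub>R v)) (at s)"
    by (auto intro!: derivative_eq_intros)
  from has_derivative_compose[OF this Ck_on_1_has_derivative[OF f]]
  show ?thesis
    unfolding has_field_derivative_def
    by (rule has_derivative_eq_rhs) (simp add: fun_eq_iff sum_distrib_left mult_ac)
qed

text \<open>Restriction to lines through \<open>x\<close> replaces Taylor expansion. A negative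
  second derivative along \<open>v\<close> would make the first derivative, which is 0 at
  \<open>x\<close>, negative just afterwards, and the mean value theorem would produce a smaller
  value of \<open>f\<close> nearby.\<close>

lemma local_min_first_second_order:
  fixes f :: "real^'n::finite \<Rightarrow> real"
  assumes f: "Ck_on (Suc (Suc k)) UNIV f" and d: "d > 0" "\<And>y. dist x y < d \<Longrightarrow> f x \<le> f y"
  shows "pd i f x = 0" and "0 \<le> (\<Sum>i\<in>UNIV. \<Sum>j\<in>UNIV. v $ i * v $ j * pd i (pd j f) x)"
proof -
  have f1: "Ck_on (Suc k) UNIV f"
    using f Ck_on_mono by (metis le_SucI le_refl)
  have min: "(\<Sum>i\<in>UNIV. w $ i * pd i f x) = 0" for w
  proof (cases "w = 0")
    case False
    have "((\<lambda>s. f (x + s *\<^sub>R w)) has_real_derivative (\<Sum>i\<in>UNIV. w $ i * pd i f (x + 0 *\<^sub>R w))) (at 0)"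
      by (rule Ck_on_1_directional[OF f1])
    then have "(\<Sum>i\<in>UNIV. w $ i * pd i f (x + 0 *\<^sub>R w)) = 0"
    proof (rule DERIV_local_min)
      show "0 < d / norm w" using False d by simp
      show "\<forall>y. \<bar>0 - y\<bar> < d / norm w \<longrightarrow> f (x + 0 *\<^sub>R w) \<le> f (x + y *\<^sub>R w)"
        using False by (auto intro!: d(2) simp: dist_norm field_simps)
    qed
    then show ?thesis by simp
  qed simp
  from min[of "axis i 1"] show "pd i f x = 0"
    by (simp add: axis_def if_distrib[of "\<lambda>a. a * _"] cong: if_cong)
  define g' where "g' s = (\<Sum>i\<in>UNIV. v $ i * pd i f (x + s *\<^sub>R v))" for s
  define Q where "Q = (\<Sum>i\<in>UNIV. \<Sum>j\<in>UNIV. v $ i * v $ j * pd i (pd j f) x)"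
  have g': "(g' has_real_derivative Q) (at 0)"
  proof -
    have *: "((\<lambda>s. pd j f (x + s *\<^sub>R v)) has_real_derivative
       (\<Sum>i\<in>UNIV. v $ i * pd i (pd j f) (x + 0 *\<^sub>R v))) (at 0)" for j
      using f by (intro Ck_on_1_directional[where k = k]) (simp add: Ck_on_Suc)
    have "((\<lambda>s. \<Sum>j\<in>UNIV. v $ j * pd j f (x + s *\<^sub>R v)) has_real_derivative
        (\<Sum>j\<in>UNIV. v $ j * (\<Sum>i\<in>UNIV. v $ i * pd i (pd j f) (x + 0 *\<^sub>R v)))) (at 0)"
      by (intro DERIV_sum DERIV_cmult *)
    also have "(\<Sum>j\<in>UNIV. v $ j * (\<Sum>i\<in>UNIV. v $ i * pd i (pd j f) (x + 0 *\<^sub>R v))) = Q"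
      unfolding Q_def sum_distrib_left by (subst sum.swap) (simp add: mult_ac)
    finally show ?thesis by (simp add: g'_def[abs_def])
  qed
  show "0 \<le> (\<Sum>i\<in>UNIV. \<Sum>j\<in>UNIV. v $ i * v $ j * pd i (pd j f) x)"
  proof (rule ccontr)
    assume "\<not> ?thesis"
    then have "Q < 0" by (simp add: Q_def)
    from DERIV_neg_dec_right[OF g' this] obtain e where e: "e > 0" "\<And>h. 0 < h \<Longrightarrow> h < e \<Longrightarrow> g' h < g' 0"
      by auto
    have g0: "g' 0 = 0" by (simp add: g'_def min)
    \<comment> \<open>\<open>e / 2\<close> keeps \<open>h\<close> where \<open>g'\<close> is
      negative; the other bound keeps the point in the ball, with \<open>norm v + 1\<close> avoiding
      division by 0.\<close>
    define h where "h = min (e / 2) (d / (2 * (norm v + 1)))"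
    have nv: "norm v + 1 > 0" using norm_ge_zero[of v] by linarith
    have h: "0 < h" "h < e" "h * norm v < d"
    proof -
      show "0 < h" "h < e" using e d nv by (auto simp: h_def)
      have "h * norm v \<le> d / (2 * (norm v + 1)) * norm v"
        by (intro mult_right_mono) (auto simp: h_def)
      also have "\<dots> < d"
        using d(1) nv by (simp add: field_simps) (smt (verit) mult_nonneg_nonneg norm_ge_zero)
      finally show "h * norm v < d" .
    qed
    have der: "((\<lambda>s. f (x + s *\<^sub>R v)) has_real_derivative g' s) (at s)" for s
      unfolding g'_def by (rule Ck_on_1_directional[OF f1])
    obtain z where z: "0 < z" "z < h" "f (x + h *\<^sub>R v) - f (x + 0 *\<^sub>R v) = (h - 0) * g' z"
      using MVT2[of 0 h "\<lambda>s. f (x + s *\<^sub>R v)" g'] h der by blast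
    have "g' z < 0" using e(2)[of z] z h g0 by auto
    then have "f (x + h *\<^sub>R v) < f x"
      using z mult_pos_neg[OF h(1), of "g' z"] by simp
    moreover have "f x \<le> f (x + h *\<^sub>R v)"
      using h by (intro d(2)) (simp add: dist_norm)
    ultimately show False by simp
  qed
qed

text \<open>The rank-one reduction \<open>A \<mapsto> A - A e\<^sub>k e\<^sub>k\<^sup>T A / A\<^sub>k\<^sub>k\<close> (Cholesky) keeps positive
  semidefiniteness and shrinks the support, so no spectral theorem is needed.\<close>

lemma psd_contraction_nonneg:
  fixes A :: "real^'n^'n::finite" and H :: "'n \<Rightarrow> 'n \<Rightarrow> real"
  assumes "finite I" and "transpose A = A" and "\<And>v. 0 \<le> v \<bullet> (A *v v)"
    and "\<And>i j. i \<notin> I \<Longrightarrow> A $ i $ j = 0"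
    and H: "\<And>v. 0 \<le> (\<Sum>i\<in>UNIV. \<Sum>j\<in>UNIV. v $ i * v $ j * H i j)"
  shows "0 \<le> (\<Sum>i\<in>UNIV. \<Sum>j\<in>UNIV. A $ i $ j * H i j)"
  using assms(1-4)
proof (induction I arbitrary: A rule: finite_induct)
  case empty
  then show ?case by simp
next
  case (insert k I)
  have sym: "A $ i $ j = A $ j $ i" for i j
    using insert.prems(1) by (metis transpose_def vec_lambda_beta)
  have sw: "v \<bullet> (A *v w) = w \<bullet> (A *v v)" for v w
    using insert.prems(1) by (metis dot_lmul_matrix inner_commute transpose_matrix_vector)
  define e where "e = (axis k 1 :: real^'n)"
  have Ae: "(A *v e) $ i = A $ k $ i" for i
    using sym[of i k] by (simp add: e_def matrix_vector_mult_basis column_def)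
  have ei: "e \<bullet> w = w $ k" for w
    by (simp add: e_def inner_axis')
  show ?case
  proof (cases "A $ k $ k = 0")
    case True
    have "A $ k $ j = 0" for j
    proof (rule ccontr)
      assume nz: "A $ k $ j \<noteq> 0"
      define w where "w = (axis j 1 :: real^'n)"
      \<comment> \<open>Since \<open>A $ k $ k = 0\<close>, the form at \<open>t e + w\<close> is
        affine in \<open>t\<close>; this \<open>t\<close> gives it the value -1.\<close>
      define t where "t = - (A $ j $ j + 1) / (2 * A $ k $ j)"
      have "(t *\<^sub>R e + w) \<bullet> (A *v (t *\<^sub>R e + w)) = t\<^sup>2 * A $ k $ k + 2 * t * A $ k $ j + A $ j $ j"
      proof -
        have "w \<bullet> (A *v w) = A $ j $ j"
          by (simp add: w_def matrix_vector_mult_basis column_def inner_axis')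
        moreover have "w \<bullet> (A *v e) = A $ k $ j"
          by (simp add: w_def inner_axis' Ae)
        ultimately show ?thesis
          using sw[of e w] by (simp add: matrix_vector_right_distrib matrix_vector_mult_scaleR
              inner_add_left inner_add_right ei Ae power2_eq_square algebra_simps)
      qed
      also have "\<dots> < 0"
        using nz True by (simp add: t_def field_simps)
      finally show False
        using insert.prems(2)[of "t *\<^sub>R e + w"] by simp
    qed
    then have "A $ i $ j = 0" if "i \<notin> I" for i j
      using insert.prems(3)[of i j] that by (cases "i = k") auto
    then show ?thesis
      using insert.IH[of A] insert.prems by blast
  next
    case False
    then have pos: "A $ k $ k > 0"
      using insert.prems(2)[of e] by (simp add: ei Ae)
    define A' where "A' = (\<chi> i j. A $ i $ j - A $ k $ i * A $ k $ j / A $ k $ k)"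
    have "0 \<le> (\<Sum>i\<in>UNIV. \<Sum>j\<in>UNIV. A' $ i $ j * H i j)"
    proof (rule insert.IH)
      show "transpose A' = A'"
        using sym by (simp add: A'_def transpose_def vec_eq_iff mult.commute)
      show "A' $ i $ j = 0" if "i \<notin> I" for i j
        using that insert.prems(3)[of i] insert.prems(3)[of i k] sym[of i k] pos
        by (cases "i = k") (auto simp: A'_def)
      fix v
      define c where "c = (v \<bullet> (A *v e)) / A $ k $ k"
      have "A' *v v = A *v v - c *\<^sub>R (A *v e)"
      proof (simp add: vec_eq_iff Ae, intro allI)
        fix i
        have "(A' *v v) $ i = (A *v v) $ i - (\<Sum>j\<in>UNIV. A $ k $ i * A $ k $ j / A $ k $ k * v $ j)"
          by (simp add: A'_def matrix_vector_mult_def left_diff_distrib sum_subtractf)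
        also have "(\<Sum>j\<in>UNIV. A $ k $ i * A $ k $ j / A $ k $ k * v $ j) = c * A $ k $ i"
          by (simp add: c_def inner_vec_def Ae sum_distrib_left sum_divide_distrib mult_ac)
        finally show "(A' *v v) $ i = (A *v v) $ i - c * A $ k $ i" .
      qed
      then have "v \<bullet> (A' *v v) = v \<bullet> (A *v v) - c * c * A $ k $ k"
        using pos by (simp add: inner_diff_right c_def)
      \<comment> \<open>Completing the square: the reduced form at \<open>v\<close> is the original
        form at \<open>v\<close> minus its projection to \<open>e\<close> with respect to the form
        of \<open>A\<close>.\<close>
      also have "\<dots> = (v - c *\<^sub>R e) \<bullet> (A *v (v - c *\<^sub>R e))"
        using pos sw[of e v]
        by (simp add: matrix_vector_mult_diff_distrib matrix_vector_mult_scaleR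
            inner_diff_left inner_diff_right ei Ae c_def)
      finally show "0 \<le> v \<bullet> (A' *v v)"
        using insert.prems(2) by simp
    qed
    moreover have "(\<Sum>i\<in>UNIV. \<Sum>j\<in>UNIV. A $ i $ j * H i j) = (\<Sum>i\<in>UNIV. \<Sum>j\<in>UNIV. A' $ i $ j * H i j)
        + (\<Sum>i\<in>UNIV. \<Sum>j\<in>UNIV. (A *v e) $ i * (A *v e) $ j * H i j) / A $ k $ k"
      by (simp add: A'_def Ae sum_divide_distrib flip: sum.distrib)
        (simp add: field_simps)
    ultimately show ?thesis
      using H[of "A *v e"] pos by simp
  qed
qed

section \<open>The strong maximum principle for the Laplace-Beltrami operator\<close>

text \<open>The segment from the identity to \<open>A\<close> consists of matrices with trivial
  kernel, so the determinant cannot vanish along it and keeps its sign.\<close>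

lemma posdef_det_pos:
  fixes A :: "real^'n^'n::finite"
  assumes "\<And>v. v \<noteq> 0 \<Longrightarrow> 0 < v \<bullet> (A *v v)"
  shows "0 < det A"
proof (rule ccontr)
  assume "\<not> 0 < det A"
  define M where "M t = (\<chi> i j. t * A $ i $ j + (1 - t) * (mat 1 :: real^'n^'n) $ i $ j)" for t
  have M: "M t *v v = t *\<^sub>R (A *v v) + (1 - t) *\<^sub>R v" for t v
  proof -
    have "M t = t *\<^sub>R A + (1 - t) *\<^sub>R mat 1"
      by (simp add: M_def vec_eq_iff)
    then show ?thesis
      by (simp add: matrix_vector_mult_add_rdistrib scaleR_matrix_vector_assoc[symmetric])
  qed
  have "continuous_on {0..1} (\<lambda>t. det (M t))"
    unfolding det_def M_def by (auto intro!: continuous_intros)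
  moreover have "det (M 1) \<le> 0" "0 \<le> det (M 0)"
  proof -
    have "M 1 = A" by (simp add: M_def vec_eq_iff)
    then show "det (M 1) \<le> 0" using \<open>\<not> 0 < det A\<close> by simp
    have "M 0 = mat 1" by (simp add: M_def vec_eq_iff)
    then show "0 \<le> det (M 0)" by simp
  qed
  ultimately obtain t where t: "0 \<le> t" "t \<le> 1" "det (M t) = 0"
    using IVT2'[of "\<lambda>t. det (M t)" 1 0 0] by auto
  then have "\<not> (\<exists>B. B ** M t = mat 1)"
    by (metis invertible_det_nz invertible_left_inverse)
  then obtain v where v: "M t *v v = 0" "v \<noteq> 0"
    unfolding matrix_left_invertible_ker by blast
  have "0 = t * (v \<bullet> (A *v v)) + (1 - t) * (v \<bullet> v)"
    using v(1) unfolding M by (metis inner_add_right inner_scaleR_right inner_zero_right)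
  moreover have "0 < v \<bullet> (A *v v)" "0 < v \<bullet> v"
    using assms v by auto
  ultimately show False
    using t by (smt (verit) mult_nonneg_nonneg mult_pos_pos)
qed

lemma matrix_inv_both:
  fixes A :: "real^'n^'n::finite"
  assumes "det A \<noteq> 0"
  shows "A ** matrix_inv A = mat 1" "matrix_inv A ** A = mat 1"
proof -
  have "\<exists>B. A ** B = mat 1 \<and> B ** A = mat 1"
    using assms unfolding invertible_det_nz[symmetric] invertible_def .
  then have "A ** matrix_inv A = mat 1 \<and> matrix_inv A ** A = mat 1"
    unfolding matrix_inv_def by (rule someI_ex)
  then show "A ** matrix_inv A = mat 1" "matrix_inv A ** A = mat 1" by auto
qed

text \<open>Cramer's rule presents the inverse as a quotient of polynomials in the entries;
  smoothness of the inverse metric follows from it.\<close>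

lemma matrix_inv_component:
  fixes A :: "real^'n^'n::finite"
  assumes "det A \<noteq> 0"
  shows "matrix_inv A $ i $ j = det (\<chi> k l. if l = i then (if k = j then 1 else 0) else A $ k $ l) / det A"
proof -
  have "A *v (matrix_inv A *v axis j 1) = axis j 1"
    using matrix_inv_both[OF assms] by (simp add: matrix_vector_mul_assoc)
  then have "matrix_inv A *v axis j 1 =
      (\<chi> i. det (\<chi> k l. if l = i then axis j 1 $ k else A $ k $ l) / det A)"
    using cramer[OF assms] by blast
  then have "(matrix_inv A *v axis j 1) $ i =
      det (\<chi> k l. if l = i then axis j 1 $ k else A $ k $ l) / det A"
    by simp
  moreover have "(matrix_inv A *v axis j 1) $ i = matrix_inv A $ i $ j"
    by (simp add: matrix_vector_mult_basis column_def)
  ultimately have "matrix_inv A $ i $ j = det (\<chi> k l. if l = i then axis j 1 $ k else A $ k $ l) / det A"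
    by metis
  then show ?thesis
    unfolding axis_def vec_lambda_beta .
qed

context
  fixes G :: "real^'n::finite \<Rightarrow> real^'n^'n"
  assumes G: "riem_metric G"
begin

lemma riem_det_pos: "0 < det (G x)"
  using G unfolding riem_metric_def by (intro posdef_det_pos) blast

lemma vdens_pos: "0 < vdens G x"
  using riem_det_pos by (simp add: vdens_def)

lemma Ck_on_metric: "Ck_on k UNIV (\<lambda>x. G x $ i $ j)"
  using G unfolding riem_metric_def smooth_fun_def by blast

lemma Ck_on_det:
  fixes M :: "real^'n \<Rightarrow> real^'n^'n"
  assumes "\<And>i j. Ck_on k UNIV (\<lambda>x. M x $ i $ j)"
  shows "Ck_on k UNIV (\<lambda>x. det (M x))"
  unfolding det_def by (intro Ck_on_sum Ck_on_mult Ck_on_const Ck_on_prod assms)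

lemma Ck_on_vdens: "Ck_on k UNIV (vdens G)"
  unfolding vdens_def[abs_def] by (intro Ck_on_sqrt Ck_on_det Ck_on_metric riem_det_pos)

lemma Ck_on_matrix_inv: "Ck_on k UNIV (\<lambda>x. matrix_inv (G x) $ i $ j)"
proof -
  have *: "matrix_inv (G x) $ i $ j = det (\<chi> k l. if l = i then (if k = j then 1 else 0) else G x $ k $ l)
      * inverse (det (G x))" for x
    using matrix_inv_component[of "G x" i j] riem_det_pos[of x] by (simp add: divide_inverse)
  have "Ck_on k UNIV (\<lambda>x. (\<chi> k l. if l = i then (if k = j then 1 else 0) else G x $ k $ l) $ a $ b)" for a b
    by (cases "b = i") (auto intro!: Ck_on_const Ck_on_metric)
  then show ?thesis
    unfolding * by (intro Ck_on_mult Ck_on_det Ck_on_inverse Ck_on_metric riem_det_pos)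
qed

text \<open>The coefficients sqrt(det g) g^(ij) of the operator in divergence form.\<close>

definition lb_coeff :: "'n \<Rightarrow> 'n \<Rightarrow> real^'n \<Rightarrow> real" where
  "lb_coeff i j y = vdens G y * matrix_inv (G y) $ i $ j"

lemma Ck_on_lb_coeff: "Ck_on k UNIV (lb_coeff i j)"
  unfolding lb_coeff_def[abs_def] by (intro Ck_on_mult Ck_on_vdens Ck_on_matrix_inv)

lemma transpose_matrix_inv: "transpose (matrix_inv (G x)) = matrix_inv (G x)"
proof -
  let ?B = "matrix_inv (G x)"
  have sym: "transpose (G x) = G x" using G by (simp add: riem_metric_def)
  have B: "G x ** ?B = mat 1" "?B ** G x = mat 1"
    using matrix_inv_both[of "G x"] riem_det_pos[of x] by auto
  have "transpose ?B ** G x = mat 1"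
    using B(1) sym by (metis matrix_transpose_mul transpose_mat)
  then show ?thesis
    using B(1) by (metis matrix_mul_assoc matrix_mul_lid matrix_mul_rid)
qed

lemma matrix_inv_posdef: "v \<noteq> 0 \<Longrightarrow> 0 < v \<bullet> (matrix_inv (G x) *v v)"
proof -
  assume "v \<noteq> 0"
  define w where "w = matrix_inv (G x) *v v"
  have v: "v = G x *v w"
    using matrix_inv_both(1)[of "G x"] riem_det_pos[of x]
    by (simp add: w_def matrix_vector_mul_assoc)
  with \<open>v \<noteq> 0\<close> have "w \<noteq> 0" by (metis matrix_vector_mult_0_right)
  then have "0 < w \<bullet> (G x *v w)" using G by (simp add: riem_metric_def)
  then show ?thesis using v w_def by (metis inner_commute)
qed

lemma LB_nondivergence:
  assumes f: "Ck_on (Suc (Suc k)) UNIV f"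
  shows "vdens G x * LB G f x =
    (\<Sum>i\<in>UNIV. \<Sum>j\<in>UNIV. pd i (lb_coeff i j) x * pd j f x + lb_coeff i j x * pd i (pd j f) x)"
proof -
  have "pd i (\<lambda>y. lb_coeff i j y * pd j f y) x =
      pd i (lb_coeff i j) x * pd j f x + lb_coeff i j x * pd i (pd j f) x" for i j
  proof (rule pd_eqI)
    have "Ck_on (Suc k) UNIV (pd j f)" using f by (simp add: Ck_on_Suc)
    from DERIV_mult[OF Ck_on_UNIV_has_pd[OF Ck_on_lb_coeff[of "Suc 0" i j], of x i]
        Ck_on_UNIV_has_pd[OF this, of x i]]
    show "((\<lambda>h. lb_coeff i j (x + h *\<^sub>R axis i 1) * pd j f (x + h *\<^sub>R axis i 1)) has_real_derivative
        pd i (lb_coeff i j) x * pd j f x + lb_coeff i j x * pd i (pd j f) x) (at 0)"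
      by (simp add: mult.commute)
  qed
  then show ?thesis
    using vdens_pos[of x] unfolding LB_def lb_coeff_def[symmetric] by simp
qed

text \<open>Locality of the operator: a truncated function still satisfies the eigenvalue equation
  where the cutoff is 1.\<close>

lemma LB_cong_open:
  assumes "open S" "x \<in> S" "\<And>y. y \<in> S \<Longrightarrow> f y = g y"
  shows "LB G f x = LB G g x"
proof -
  have pd_cong: "pd i f' y = pd i g' y" if "y \<in> S" "\<And>z. z \<in> S \<Longrightarrow> f' z = g' z" for i f' g' and y :: "real^'n"
  proof -
    have "(\<lambda>h. y + h *\<^sub>R axis i 1) \<midarrow>0\<rightarrow> y + 0 *\<^sub>R axis i 1"
      by (intro tendsto_intros)
    then have "\<forall>\<^sub>F h in at 0. y + h *\<^sub>R axis i 1 \<in> S"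
      using assms(1) that(1) by (auto dest: topological_tendstoD)
    then have "\<forall>\<^sub>F h in nhds 0. f' (y + h *\<^sub>R axis i 1) = g' (y + h *\<^sub>R axis i 1)"
      using that by (auto simp: eventually_at_filter elim!: eventually_mono)
    then show ?thesis
      unfolding pd_def by (rule deriv_cong_ev) simp
  qed
  have "pd j f y = pd j g y" if "y \<in> S" for y j
    using pd_cong that assms by blast
  then have "pd i (\<lambda>y. vdens G y * matrix_inv (G y) $ i $ j * pd j f y) x =
    pd i (\<lambda>y. vdens G y * matrix_inv (G y) $ i $ j * pd j g y) x" for i j
    by (intro pd_cong) (use assms in auto)
  then show ?thesis by (simp add: LB_def)
qed

text \<open>Derivatives of Hopf's barrier. The \<alpha>^2 part of the Hessian is the rank-one matrix
  of \<open>y - z\<close>, so ellipticity makes it dominant and positive for large \<alpha>.\<close>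

lemma gaussian_pd:
  fixes z :: "real^'n"
  defines "w \<equiv> \<lambda>\<alpha> y. exp (- \<alpha> * ((y - z) \<bullet> (y - z)))"
  shows "pd j (w \<alpha>) = (\<lambda>y. - 2 * \<alpha> * (y - z) $ j * w \<alpha> y)"
    and "pd i (pd j (w \<alpha>)) y =
      (4 * \<alpha>\<^sup>2 * (y - z) $ i * (y - z) $ j - (if i = j then 2 * \<alpha> else 0)) * w \<alpha> y"
    and "Ck_on k UNIV (w \<alpha>)"
proof -
  have d: "((\<lambda>h. w \<alpha> (y + h *\<^sub>R axis j 1)) has_real_derivative - 2 * \<alpha> * (y - z) $ j * w \<alpha> y) (at 0)" for j y
    unfolding w_def
    by (auto intro!: derivative_eq_intros simp: inner_axis inner_axis' algebra_simps)
  have 1: "pd j (w \<alpha>) = (\<lambda>y. - 2 * \<alpha> * (y - z) $ j * w \<alpha> y)" for j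
    using pd_eqI[OF d] by (auto simp: fun_eq_iff)
  then show "pd j (w \<alpha>) = (\<lambda>y. - 2 * \<alpha> * (y - z) $ j * w \<alpha> y)" .
  show "pd i (pd j (w \<alpha>)) y =
      (4 * \<alpha>\<^sup>2 * (y - z) $ i * (y - z) $ j - (if i = j then 2 * \<alpha> else 0)) * w \<alpha> y"
    unfolding 1
  proof (rule pd_eqI)
    have l: "((\<lambda>h. - 2 * \<alpha> * (y + h *\<^sub>R axis i 1 - z) $ j) has_real_derivative
        (if i = j then - 2 * \<alpha> else 0)) (at 0)"
      by (auto intro!: derivative_eq_intros simp: axis_def)
    show "((\<lambda>h. - 2 * \<alpha> * (y + h *\<^sub>R axis i 1 - z) $ j * w \<alpha> (y + h *\<^sub>R axis i 1))
        has_real_derivative (4 * \<alpha>\<^sup>2 * (y - z) $ i * (y - z) $ j - (if i = j then 2 * \<alpha> else 0)) * w \<alpha> y) (at 0)"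
      by (rule DERIV_cong[OF DERIV_mult[OF l d]]) (simp add: power2_eq_square algebra_simps)
  qed
  show "Ck_on k UNIV (w \<alpha>)"
    unfolding w_def inner_vec_def vector_minus_component inner_real_def
    by (intro Ck_on_exp Ck_on_mult Ck_on_const Ck_on_sum Ck_on_diff Ck_on_nth)
qed

text \<open>Hopf's boundary point argument at a zero nearest to a point of positivity.\<close>

theorem strong_maximum_principle:
  assumes phi: "smooth_fun \<phi>" "\<And>x. 0 \<le> \<phi> x" "\<phi> y0 \<noteq> 0"
    and eq: "\<And>x. LB G \<phi> x = \<mu> * \<phi> x" and mu: "0 \<le> \<mu>"
  shows "0 < \<phi> x"
proof (rule ccontr)
  assume "\<not> 0 < \<phi> x"
  define Z where "Z = {x. \<phi> x = 0}"
  have Ck: "Ck_on k UNIV \<phi>" for k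
    using phi(1) by (simp add: smooth_fun_def)
  have cont: "continuous_on UNIV \<phi>"
    using Ck_on_imp_continuous_on[OF Ck[of 0]] .
  have "closed Z"
    unfolding Z_def using cont by (intro closed_Collect_eq continuous_on_const)
  moreover have "Z \<noteq> {}"
    using \<open>\<not> 0 < \<phi> x\<close> phi(2)[of x] by (auto simp: Z_def intro!: exI[of _ x])
  ultimately obtain z where z: "z \<in> Z" "\<And>y. y \<in> Z \<Longrightarrow> dist y0 z \<le> dist y0 y"
    using distance_attains_inf by blast
  define R where "R = dist y0 z"
  have R: "R > 0" using z phi(3) by (auto simp: R_def Z_def)
  have pos: "0 < \<phi> y" if "dist y0 y < R" for y
    using that z(2)[of y] phi(2)[of y] by (force simp: R_def Z_def)
  \<comment> \<open>The annulus avoids the centre, where \<open>m\<close> vanishes; compactness then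
    bounds \<open>m\<close> away from 0.\<close>
  define S where "S = {y. R / 2 \<le> norm (y - y0) \<and> norm (y - y0) \<le> R}"
  have "S = cball y0 R - ball y0 (R / 2)"
    by (auto simp: S_def dist_norm norm_minus_commute)
  then have cS: "compact S"
    by (simp add: compact_diff)
  have contpd: "continuous_on UNIV (pd i (lb_coeff i j))" "continuous_on UNIV (lb_coeff i j)" for i j
    using Ck_on_lb_coeff[of "Suc 0" i j] by (auto simp: Ck_on_Suc Ck_on_0)
  \<comment> \<open>For the barrier \<open>w\<close> below, \<open>vdens G\<close> times
    (\<open>LB G w\<close> - \<mu> w) equals w (4 \<alpha>^2 m - 2 \<alpha> N - D): principal part,
    trace and drift terms, zeroth order term.\<close>
  define m where "m y = (\<Sum>i\<in>UNIV. \<Sum>j\<in>UNIV. lb_coeff i j y * (y - y0) $ i * (y - y0) $ j)" for y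
  define N where "N y = (\<Sum>i\<in>UNIV. lb_coeff i i y) + (\<Sum>i\<in>UNIV. \<Sum>j\<in>UNIV. pd i (lb_coeff i j) y * (y - y0) $ j)" for y
  define D where "D y = vdens G y * \<mu>" for y
  have m_eq: "m y = vdens G y * ((y - y0) \<bullet> (matrix_inv (G y) *v (y - y0)))" for y
    by (simp add: m_def lb_coeff_def inner_vec_def matrix_vector_mult_def sum_distrib_left mult_ac)
  have m_pos: "0 < m y" if "y \<in> S" for y
  proof -
    have "y - y0 \<noteq> 0" using that R by (auto simp: S_def)
    then show ?thesis
      unfolding m_eq using matrix_inv_posdef vdens_pos by simp
  qed
  have contm: "continuous_on S m" "continuous_on S N" "continuous_on S D"
    unfolding m_def[abs_def] N_def[abs_def] D_def[abs_def]
    by (auto intro!: continuous_intros continuous_on_subset[OF contpd(1)] continuous_on_subset[OF contpd(2)]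
        continuous_on_subset[OF Ck_on_imp_continuous_on[OF Ck_on_vdens[of 0]]])
  have zS: "z \<in> S" using R by (simp add: S_def R_def dist_norm norm_minus_commute)
  then have ne: "S \<noteq> {}" by auto
  obtain m0 where m0: "m0 > 0" "\<And>y. y \<in> S \<Longrightarrow> m0 \<le> m y"
    using continuous_attains_inf[OF cS ne contm(1)] m_pos by blast
  obtain N0 where N0: "\<And>y. y \<in> S \<Longrightarrow> N y \<le> N0"
    using continuous_attains_sup[OF cS ne contm(2)] by blast
  obtain D0 where D0: "\<And>y. y \<in> S \<Longrightarrow> D y \<le> D0"
    using continuous_attains_sup[OF cS ne contm(3)] by blast
  \<comment> \<open>Makes \<alpha> m0 equal to m0 + |N0| + |D0|, so that the quadratic term beats
    the other two and the barrier is a strict subsolution on \<open>S\<close>.\<close>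
  define \<alpha> where "\<alpha> = 1 + (\<bar>N0\<bar> + \<bar>D0\<bar>) / m0"
  have \<alpha>1: "\<alpha> \<ge> 1" using m0 by (simp add: \<alpha>_def)
  have key: "D y - 4 * \<alpha>\<^sup>2 * m y + 2 * \<alpha> * N y < 0" if "y \<in> S" for y
  proof -
    have "\<alpha> * m0 = m0 + \<bar>N0\<bar> + \<bar>D0\<bar>" using m0 by (simp add: \<alpha>_def field_simps)
    then have "4 * \<alpha>\<^sup>2 * m0 = 4 * \<alpha> * (m0 + \<bar>N0\<bar> + \<bar>D0\<bar>)"
      by (simp add: power2_eq_square)
    moreover have "\<alpha>\<^sup>2 * m0 \<le> \<alpha>\<^sup>2 * m y" "\<alpha> * N y \<le> \<alpha> * \<bar>N0\<bar>"
      using m0(2)[OF that] N0[OF that] \<alpha>1 by (auto intro!: mult_left_mono)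
    moreover have "D y \<le> \<alpha> * \<bar>D0\<bar>"
      using D0[OF that] mult_right_mono[OF \<alpha>1, of "\<bar>D0\<bar>"] by simp
    moreover have "0 < \<alpha> * m0" "0 \<le> \<alpha> * \<bar>N0\<bar>" "0 \<le> \<alpha> * \<bar>D0\<bar>"
      using \<alpha>1 m0 by auto
    ultimately show ?thesis
      by (simp add: algebra_simps)
  qed
  define w where "w y = exp (- \<alpha> * ((y - y0) \<bullet> (y - y0)))" for y :: "real^'n"
  define c0 where "c0 = exp (- \<alpha> * R\<^sup>2)"
  have w_norm: "w y = exp (- \<alpha> * (norm (y - y0))\<^sup>2)" for y
    by (simp add: w_def dot_square_norm)
  have "compact (cball y0 (R / 2))" "cball y0 (R / 2) \<noteq> {}"
    using R by auto
  from continuous_attains_inf[OF this continuous_on_subset[OF cont]]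
  obtain y1 where y1: "y1 \<in> cball y0 (R / 2)" "\<And>y. y \<in> cball y0 (R / 2) \<Longrightarrow> \<phi> y1 \<le> \<phi> y"
    by blast
  define \<delta> where "\<delta> = \<phi> y1"
  have \<delta>: "\<delta> > 0" using pos[of y1] y1(1) R by (simp add: \<delta>_def)
  \<comment> \<open>On the outer sphere w = c0, so f = \<phi> \<ge> 0; on the inner one \<phi> \<ge>
    \<delta> and w \<le> 1. A negative minimum over \<open>S\<close> can only be interior.\<close>
  define f where "f y = \<phi> y - \<delta> * w y + \<delta> * c0" for y
  have w_eq: "w = (\<lambda>y. exp (- \<alpha> * ((y - y0) \<bullet> (y - y0))))"
    by (simp add: w_def[abs_def])
  have gp1: "pd j w = (\<lambda>y. - 2 * \<alpha> * (y - y0) $ j * w y)" for j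
    unfolding w_eq by (rule gaussian_pd(1))
  have gp2: "pd i (pd j w) y =
      (4 * \<alpha>\<^sup>2 * (y - y0) $ i * (y - y0) $ j - (if i = j then 2 * \<alpha> else 0)) * w y" for i j y
    unfolding w_eq by (rule gaussian_pd(2))
  have Ckw: "Ck_on k UNIV w" for k
    unfolding w_eq by (rule gaussian_pd(3))
  have Ckf: "Ck_on k UNIV f" for k
    unfolding f_def[abs_def] by (intro Ck_on_add Ck_on_diff Ck_on_mult Ck_on_const Ck Ckw)
  have pdf: "pd j f = (\<lambda>y. pd j \<phi> y - \<delta> * pd j w y)" for j
  proof
    fix y show "pd j f y = pd j \<phi> y - \<delta> * pd j w y"
      unfolding f_def[abs_def]
      by (rule pd_eqI) (auto intro!: derivative_eq_intros Ck_on_UNIV_has_pd[OF Ck] Ck_on_UNIV_has_pd[OF Ckw])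
  qed
  have Ckpd: "Ck_on k UNIV (pd j \<phi>)" "Ck_on k UNIV (pd j w)" for k j
    using Ck[of "Suc k"] Ckw[of "Suc k"] by (auto simp: Ck_on_Suc)
  have pdpdf: "pd i (pd j f) y = pd i (pd j \<phi>) y - \<delta> * pd i (pd j w) y" for i j y
    unfolding pdf
    by (rule pd_eqI) (auto intro!: derivative_eq_intros Ck_on_UNIV_has_pd[OF Ckpd(1)] Ck_on_UNIV_has_pd[OF Ckpd(2)])
  have f_nonneg: "0 \<le> f y" if "y \<in> S" for y
  proof -
    obtain xm where xm: "xm \<in> S" "\<And>y. y \<in> S \<Longrightarrow> f xm \<le> f y"
      using continuous_attains_inf[OF cS ne continuous_on_subset[OF Ck_on_imp_continuous_on[OF Ckf[of 0]]]]
      by blast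
    have "0 \<le> f xm"
    proof (rule ccontr)
      assume neg: "\<not> 0 \<le> f xm"
      have "norm (xm - y0) \<noteq> R"
      proof
        assume "norm (xm - y0) = R"
        then have "f xm = \<phi> xm" by (simp add: f_def w_norm c0_def)
        then show False using neg phi(2) by simp
      qed
      moreover have "norm (xm - y0) \<noteq> R / 2"
      proof
        assume *: "norm (xm - y0) = R / 2"
        then have "\<delta> \<le> \<phi> xm"
          unfolding \<delta>_def by (intro y1) (simp add: dist_norm norm_minus_commute)
        moreover have "w xm \<le> 1" using \<alpha>1 by (simp add: w_norm)
        then have "\<delta> * w xm \<le> \<delta>" using \<delta> by simp
        moreover have "\<delta> * c0 \<ge> 0" using \<delta> by (simp add: c0_def)
        ultimately show False using neg by (simp add: f_def)
      qed
      ultimately have int: "R / 2 < norm (xm - y0)" "norm (xm - y0) < R"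
        using xm by (auto simp: S_def)
      define d where "d = min (norm (xm - y0) - R / 2) (R - norm (xm - y0))"
      have d: "d > 0" using int by (simp add: d_def)
      have min: "f xm \<le> f y" if "dist xm y < d" for y
      proof (rule xm(2))
        have "\<bar>norm (xm - y0) - norm (y - y0)\<bar> \<le> norm ((xm - y0) - (y - y0))"
          by (rule norm_triangle_ineq3)
        then show "y \<in> S" using that by (auto simp: S_def d_def dist_norm)
      qed
      note m1 = local_min_first_second_order[where k = 0, OF Ckf d min]
      \<comment> \<open>At an interior minimum the gradient vanishes and the second order part, a
        contraction of two positive semidefinite forms, is nonnegative. The strict inequality
        \<open>key\<close> contradicts this.\<close>
      have "0 \<le> (\<Sum>i\<in>UNIV. \<Sum>j\<in>UNIV. matrix_inv (G xm) $ i $ j * pd i (pd j f) xm)"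
      proof (rule psd_contraction_nonneg[OF finite[of UNIV]])
        show "0 \<le> v \<bullet> (matrix_inv (G xm) *v v)" for v
          using matrix_inv_posdef[of v xm] by (cases "v = 0") auto
      qed (use transpose_matrix_inv m1(2) in auto)
      then have "0 \<le> vdens G xm * (\<Sum>i\<in>UNIV. \<Sum>j\<in>UNIV. matrix_inv (G xm) $ i $ j * pd i (pd j f) xm)"
        using vdens_pos[of xm] by simp
      also have "\<dots> = (\<Sum>i\<in>UNIV. \<Sum>j\<in>UNIV. pd i (lb_coeff i j) xm * pd j f xm + lb_coeff i j xm * pd i (pd j f) xm)"
        by (simp add: m1(1) lb_coeff_def sum_distrib_left mult.assoc)
      also have "\<dots> = (\<Sum>i\<in>UNIV. \<Sum>j\<in>UNIV. pd i (lb_coeff i j) xm * pd j \<phi> xm + lb_coeff i j xm * pd i (pd j \<phi>) xm)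
          - \<delta> * (\<Sum>i\<in>UNIV. \<Sum>j\<in>UNIV. pd i (lb_coeff i j) xm * pd j w xm + lb_coeff i j xm * pd i (pd j w) xm)"
        unfolding pdpdf unfolding pdf sum_distrib_left sum_subtractf[symmetric]
        by (intro sum.cong refl) (simp add: algebra_simps)
      also have "(\<Sum>i\<in>UNIV. \<Sum>j\<in>UNIV. pd i (lb_coeff i j) xm * pd j \<phi> xm + lb_coeff i j xm * pd i (pd j \<phi>) xm)
          = D xm * \<phi> xm"
        using LB_nondivergence[OF Ck, of xm] by (simp add: eq D_def mult_ac)
      also have "(\<Sum>i\<in>UNIV. \<Sum>j\<in>UNIV. pd i (lb_coeff i j) xm * pd j w xm + lb_coeff i j xm * pd i (pd j w) xm)
          = w xm * (4 * \<alpha>\<^sup>2 * m xm - 2 * \<alpha> * N xm)"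
      proof -
        have "(\<Sum>i\<in>UNIV. \<Sum>j\<in>UNIV. pd i (lb_coeff i j) xm * pd j w xm + lb_coeff i j xm * pd i (pd j w) xm)
          = (\<Sum>i\<in>UNIV. \<Sum>j\<in>UNIV. w xm * (4 * \<alpha>\<^sup>2 * (lb_coeff i j xm * (xm - y0) $ i * (xm - y0) $ j)
             - 2 * \<alpha> * (pd i (lb_coeff i j) xm * (xm - y0) $ j) - 2 * \<alpha> * (if i = j then lb_coeff i j xm else 0)))"
          unfolding gp2 unfolding gp1
          by (intro sum.cong refl) (auto simp: algebra_simps)
        also have "\<dots> = w xm * (4 * \<alpha>\<^sup>2 * m xm - 2 * \<alpha> * N xm)"
        proof -
          have "(\<Sum>i\<in>UNIV. \<Sum>j\<in>UNIV. if i = j then lb_coeff i j xm else 0) = (\<Sum>i\<in>UNIV. lb_coeff i i xm)"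
            by simp
          then show ?thesis
            unfolding m_def N_def sum_distrib_left[symmetric] sum_subtractf
            by (simp only: algebra_simps)
        qed
        finally show ?thesis .
      qed
      finally have "0 \<le> D xm * \<phi> xm - \<delta> * (w xm * (4 * \<alpha>\<^sup>2 * m xm - 2 * \<alpha> * N xm))" .
      moreover have "D xm * \<phi> xm \<le> D xm * (\<delta> * w xm - \<delta> * c0)"
        using neg mu vdens_pos[of xm] by (intro mult_left_mono) (auto simp: f_def D_def)
      moreover have "0 \<le> D xm * (\<delta> * c0)"
        using mu vdens_pos[of xm] \<delta> by (simp add: D_def c0_def)
      moreover have "\<delta> * w xm * (D xm - 4 * \<alpha>\<^sup>2 * m xm + 2 * \<alpha> * N xm) < 0"
        using key[OF xm(1)] \<delta> by (intro mult_pos_neg) (auto simp: w_def)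
      ultimately show False by (simp add: algebra_simps)
    qed
    then show ?thesis using xm(2)[OF that] by simp
  qed
  \<comment> \<open>The gradient of \<phi> vanishes at its minimum \<open>z\<close>, so the slope of
    \<open>f\<close> from \<open>z\<close> towards \<open>y0\<close> stems from the barrier alone
    and is negative. As \<open>f z = 0\<close>, \<open>f\<close> would be negative somewhere in
    \<open>S\<close>.\<close>
  have "((\<lambda>s. f (z + s *\<^sub>R (y0 - z))) has_real_derivative
      (\<Sum>i\<in>UNIV. (y0 - z) $ i * pd i f (z + 0 *\<^sub>R (y0 - z)))) (at 0)"
    by (rule Ck_on_1_directional[OF Ckf])
  then have df: "((\<lambda>s. f (z + s *\<^sub>R (y0 - z))) has_real_derivative
      (\<Sum>i\<in>UNIV. (y0 - z) $ i * pd i f z)) (at 0)" by simp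
  have phiz: "\<phi> z = 0" using z by (simp add: Z_def)
  then have "pd i \<phi> z = 0" for i
    using local_min_first_second_order(1)[where k = 0 and d = 1, OF Ck] phi(2) by simp
  then have "(\<Sum>i\<in>UNIV. (y0 - z) $ i * pd i f z) = (\<Sum>i\<in>UNIV. (y0 - z) $ i * (2 * \<alpha> * \<delta> * w z * (z - y0) $ i))"
    unfolding pdf gp1 by (simp add: mult_ac)
  also have "\<dots> = - 2 * \<alpha> * \<delta> * w z * ((z - y0) \<bullet> (z - y0))"
    unfolding inner_vec_def sum_distrib_left by (intro sum.cong refl) (simp add: algebra_simps)
  also have "\<dots> < 0"
    using \<alpha>1 \<delta> R by (simp add: w_def R_def)
  finally have "(\<Sum>i\<in>UNIV. (y0 - z) $ i * pd i f z) < 0" .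
  from DERIV_neg_dec_right[OF df this] obtain e where e: "e > 0"
    "\<And>h. 0 < h \<Longrightarrow> h < e \<Longrightarrow> f (z + h *\<^sub>R (y0 - z)) < f z" by auto
  define h where "h = min (e / 2) (1 / 2)"
  have h: "0 < h" "h < e" "h \<le> 1 / 2" using e by (auto simp: h_def)
  have "f z = 0"
    using phiz by (simp add: f_def w_norm c0_def R_def dist_norm norm_minus_commute)
  moreover have "z + h *\<^sub>R (y0 - z) \<in> S"
  proof -
    have "z + h *\<^sub>R (y0 - z) - y0 = (1 - h) *\<^sub>R (z - y0)"
      by (simp add: algebra_simps)
    then have "norm (z + h *\<^sub>R (y0 - z) - y0) = (1 - h) * R"
      using h by (simp add: R_def dist_norm norm_minus_commute)
    then show ?thesis
      using h R by (simp add: S_def mult_left_le_one_le mult_right_mono[of "1/2" "1-h" R, simplified])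
  qed
  ultimately show False
    using f_nonneg[of "z + h *\<^sub>R (y0 - z)"] e(2)[OF h(1,2)] by simp
qed

end

section \<open>Integrating factors for damped ordinary differential inequalities\<close>

text \<open>The gauge integral does not see negligible sets, so \<open>g\<close> may be replaced by
  \<open>f\<close> on the exceptional set.\<close>

lemma integral_mono_AE:
  fixes f g :: "real \<Rightarrow> real"
  assumes "f integrable_on S" "g integrable_on S" "AE x in lborel. x \<in> S \<longrightarrow> f x \<le> g x"
  shows "integral S f \<le> integral S g"
proof -
  obtain N where N: "{x \<in> space lborel. \<not> (x \<in> S \<longrightarrow> f x \<le> g x)} \<subseteq> N" "N \<in> null_sets lborel"
    using assms(3) by (auto elim!: AE_E simp: null_sets_def)
  have "negligible N"
    using N(2) by (simp add: negligible_iff_null_sets null_sets_completionI)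
  define g' where "g' x = (if x \<in> N then f x else g x)" for x
  have *: "g' integrable_on S" "integral S g = integral S g'"
    using integrable_spike[OF assms(2) \<open>negligible N\<close>, of g'] integral_spike[OF \<open>negligible N\<close>, of S g' g]
    by (auto simp: g'_def)
  show ?thesis
    unfolding *(2) by (rule integral_le) (use assms(1) * N(1) in \<open>auto simp: g'_def\<close>)
qed

text \<open>An exact increment formula for \<open>exp (- B)\<close> that does not differentiate
  \<open>B\<close>: the slope \<open>e\<close> is the value at an intermediate point, hence close to
  the end value.\<close>

lemma exp_minus_secant:
  "\<exists>e. exp (- b) - exp (- a) = - e * (b - a) \<and> \<bar>exp (- b) - e\<bar> \<le> \<bar>exp (- b) - exp (- a)\<bar>" for a b :: real
proof -
  have d: "((\<lambda>x::real. exp (- x)) has_real_derivative - exp (- x)) (at x)" for x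
    by (auto intro!: derivative_eq_intros)
  consider "a < b" | "b < a" | "a = b" by linarith
  then show ?thesis
  proof cases
    case 1
    obtain z where z: "a < z" "z < b" "exp (- b) - exp (- a) = (b - a) * (- exp (- z))"
      using MVT2[OF 1 d] by blast
    have "exp (- b) < exp (- z)" "exp (- z) < exp (- a)" using z by auto
    then have "\<bar>exp (- b) - exp (- z)\<bar> \<le> \<bar>exp (- b) - exp (- a)\<bar>" by linarith
    then show ?thesis using z(3) by (intro exI[of _ "exp (- z)"]) (auto simp: algebra_simps)
  next
    case 2
    obtain z where z: "b < z" "z < a" "exp (- a) - exp (- b) = (a - b) * (- exp (- z))"
      using MVT2[OF 2 d] by blast
    have "exp (- a) < exp (- z)" "exp (- z) < exp (- b)" using z by auto
    then have "\<bar>exp (- b) - exp (- z)\<bar> \<le> \<bar>exp (- b) - exp (- a)\<bar>" by linarith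
    then show ?thesis using z(3) by (intro exI[of _ "exp (- z)"]) (auto simp: algebra_simps)
  next
    case 3
    then show ?thesis by (intro exI[of _ "exp (- b)"]) auto
  qed
qed

text \<open>The integrating factor \<open>exp (- B)\<close> is only absolutely continuous, so the product rule is
  replaced by a local estimate on small intervals, summed up by bisection.\<close>

lemma integrating_factor_ineq:
  fixes f f1 h \<beta> B :: "real \<Rightarrow> real"
  assumes st: "s \<le> t"
    and der: "\<And>r. r \<in> {s..t} \<Longrightarrow> (f has_real_derivative f1 r) (at r within {s..t})"
    and h: "h absolutely_integrable_on {s..t}" and \<beta>: "\<beta> absolutely_integrable_on {s..t}"
    and B: "\<And>r. r \<in> {s..t} \<Longrightarrow> B r = B s + integral {s..r} \<beta>"
    and ineq: "AE r in lborel. r \<in> {s..t} \<longrightarrow> \<beta> r * f r + h r \<le> f1 r"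
  shows "integral {s..t} (\<lambda>r. h r * exp (- B r)) \<le> f t * exp (- B t) - f s * exp (- B s)"
proof -
  define E where "E r = exp (- B r)" for r
  have f: "continuous_on {s..t} f"
    using der by (meson DERIV_continuous_on)
  have \<beta>i: "\<beta> integrable_on {s..t}" "(\<lambda>r. \<bar>\<beta> r\<bar>) integrable_on {s..t}"
    and hi: "h integrable_on {s..t}" "(\<lambda>r. \<bar>h r\<bar>) integrable_on {s..t}"
    using \<beta> h by (auto dest: absolutely_integrable_on_def[THEN iffD1])
  have "continuous_on {s..t} (\<lambda>r. B s + integral {s..r} \<beta>)"
    by (intro continuous_intros indefinite_integral_continuous_1 \<beta>i)
  then have Bc: "continuous_on {s..t} B"
    by (rule continuous_on_eq) (rule B[symmetric])
  then have E: "continuous_on {s..t} E"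
    unfolding E_def[abs_def] by (intro continuous_intros)
  have Bdiff: "B v - B u = integral {u..v} \<beta>" if "s \<le> u" "u \<le> v" "v \<le> t" for u v
  proof -
    have "integral {s..u} \<beta> + integral {u..v} \<beta> = integral {s..v} \<beta>"
      using that by (intro Henstock_Kurzweil_Integration.integral_combine integrable_on_subinterval[OF \<beta>i(1)]) auto
    then show ?thesis using B[of u] B[of v] that by simp
  qed
  have bfint: "(\<lambda>r. \<gamma> r * g r) integrable_on {s..t}"
    if "continuous_on {s..t} g" "\<gamma> absolutely_integrable_on {s..t}" for g \<gamma> :: "real \<Rightarrow> real"
  proof -
    have "(\<lambda>r. g r * \<gamma> r) absolutely_integrable_on {s..t}"
      using that by (intro absolutely_integrable_bounded_measurable_product_real
          continuous_imp_measurable_on_sets_lebesgue compact_imp_bounded compact_continuous_image) auto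
    then show ?thesis
      by (simp add: absolutely_integrable_on_def mult.commute)
  qed
  have hE: "(\<lambda>r. h r * E r) integrable_on {s..t}"
    by (rule bfint[OF E h])
  have one: "(\<lambda>r. \<bar>h r\<bar> + \<bar>\<beta> r\<bar>) integrable_on {s..t}"
    by (intro integrable_add \<beta>i hi)
  obtain M where M: "M \<ge> 1" "\<And>r. r \<in> {s..t} \<Longrightarrow> \<bar>f r\<bar> \<le> M" 
      "\<And>r. r \<in> {s..t} \<Longrightarrow> \<bar>E r\<bar> \<le> M"
  proof -
    have "bounded (f ` {s..t})" "bounded (E ` {s..t})"
      using f E by (auto intro!: compact_imp_bounded compact_continuous_image)
    then obtain a c where "\<forall>r\<in>{s..t}. \<bar>f r\<bar> \<le> a" "\<forall>r\<in>{s..t}. \<bar>E r\<bar> \<le> c"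
      unfolding bounded_iff by auto
    then show ?thesis by (intro that[of "max 1 (max a c)"]) (auto simp: le_max_iff_disj)
  qed
  have main: "integral {s..t} (\<lambda>r. h r * E r) - \<delta> * integral {s..t} (\<lambda>r. \<bar>h r\<bar> + \<bar>\<beta> r\<bar>) \<le> f t * E t - f s * E s"
    if \<delta>: "\<delta> > 0" for \<delta>
  proof -
    \<comment> \<open>The error is itself an integral, hence additive, so it does not accumulate
      when intervals are joined.\<close>
    define P where "P u v \<longleftrightarrow> (s \<le> u \<longrightarrow> u \<le> v \<longrightarrow> v \<le> t \<longrightarrow>
      integral {u..v} (\<lambda>r. h r * E r) - \<delta> * integral {u..v} (\<lambda>r. \<bar>h r\<bar> + \<bar>\<beta> r\<bar>) \<le> f v * E v - f u * E u)" for u v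
    have "P s t"
      using st
    proof (induction rule: Bolzano)
      case (trans a b c)
      show ?case
        unfolding P_def
      proof (intro impI)
        assume "s \<le> a" "c \<le> t"
        have "integral {a..b} (\<lambda>r. h r * E r) + integral {b..c} (\<lambda>r. h r * E r) = integral {a..c} (\<lambda>r. h r * E r)"
          "integral {a..b} (\<lambda>r. \<bar>h r\<bar> + \<bar>\<beta> r\<bar>) + integral {b..c} (\<lambda>r. \<bar>h r\<bar> + \<bar>\<beta> r\<bar>) = integral {a..c} (\<lambda>r. \<bar>h r\<bar> + \<bar>\<beta> r\<bar>)"
          using trans \<open>s \<le> a\<close> \<open>c \<le> t\<close>
          by (auto intro!: Henstock_Kurzweil_Integration.integral_combine integrable_on_subinterval[OF hE] integrable_on_subinterval[OF one])
        then show "integral {a..c} (\<lambda>r. h r * E r) - \<delta> * integral {a..c} (\<lambda>r. \<bar>h r\<bar> + \<bar>\<beta> r\<bar>) \<le> f c * E c - f a * E a"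
          using trans \<open>s \<le> a\<close> \<open>c \<le> t\<close> unfolding P_def by (smt (verit) distrib_left)
      qed
    next
      case (local x)
      then have x: "x \<in> {s..t}" by simp
      \<comment> \<open>Two errors of size M (2 \<eta>) then add up to at most \<delta>.\<close>
      define \<eta> where "\<eta> = \<delta> / (4 * M)"
      have \<eta>: "\<eta> > 0" using \<delta> M by (simp add: \<eta>_def)
      obtain d1 where d1: "d1 > 0" "\<And>r. r \<in> {s..t} \<Longrightarrow> dist r x < d1 \<Longrightarrow> dist (f r) (f x) < \<eta>"
        using f x \<eta> unfolding continuous_on_iff by meson
      obtain d2 where d2: "d2 > 0" "\<And>r. r \<in> {s..t} \<Longrightarrow> dist r x < d2 \<Longrightarrow> dist (E r) (E x) < \<eta>"
        using E x \<eta> unfolding continuous_on_iff by meson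
      show ?case
      proof (intro exI[of _ "min d1 d2"] conjI allI impI)
        show "0 < min d1 d2" using d1 d2 by simp
        fix u v assume uv: "u \<le> x \<and> x \<le> v \<and> v - u < min d1 d2"
        show "P u v"
          unfolding P_def
        proof (intro impI)
          assume su: "s \<le> u" "u \<le> v" "v \<le> t"
          have sub: "{u..v} \<subseteq> {s..t}" using su by auto
          have cl: "\<bar>f r - f x\<bar> < \<eta>" "\<bar>E r - E x\<bar> < \<eta>" if "r \<in> {u..v}" for r
            using d1(2)[of r] d2(2)[of r] that uv su by (auto simp: dist_real_def)
          obtain e where e: "E v - E u = - e * (B v - B u)" "\<bar>E v - e\<bar> \<le> \<bar>E v - E u\<bar>"
            using exp_minus_secant[of "B v" "B u"] unfolding E_def by blast
          have uin: "u \<in> {u..v}" "v \<in> {u..v}" "u \<in> {s..t}" "v \<in> {s..t}" using su by auto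
          have M4: "M * (2 * \<eta>) \<le> \<delta> / 2" using M by (simp add: \<eta>_def)
          have i: "g integrable_on {u..v}" if "g integrable_on {s..t}" for g :: "real \<Rightarrow> real"
            using integrable_on_subinterval[OF that sub] .
          have "(f1 has_integral f v - f u) {u..v}"
            using su has_field_derivative_subset[OF der sub] sub
            by (intro fundamental_theorem_of_calculus)
              (auto simp flip: has_real_derivative_iff_has_vector_derivative)
          then have ftc: "f1 integrable_on {u..v}" "integral {u..v} f1 = f v - f u"
            by (auto simp: has_integral_integrable_integral)
          note ints = i[OF bfint[OF f \<beta>]] i[OF hi(1)] i[OF hE] i[OF one] i[OF \<beta>i(1)]
          have "integral {u..v} (\<lambda>r. \<beta> r * f r + h r) \<le> integral {u..v} f1"
            by (rule integral_mono_AE) (use ineq sub ints ftc in \<open>auto intro!: integrable_add elim!: eventually_mono\<close>)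
          \<comment> \<open>The increment of the product is E v (f v - f u) + f u (E v - E u). The
            first difference is bounded by the differential inequality, the second is the secant
            formula.\<close>
          then have "E v * integral {u..v} (\<lambda>r. \<beta> r * f r + h r) \<le> E v * (f v - f u)"
            unfolding ftc by (intro mult_left_mono) (auto simp: E_def)
          moreover have "f u * (E v - E u) = - (f u * e) * integral {u..v} \<beta>"
            unfolding e(1) Bdiff[OF su] by simp
          ultimately have "E v * integral {u..v} (\<lambda>r. \<beta> r * f r + h r) - (f u * e) * integral {u..v} \<beta>
              - integral {u..v} (\<lambda>r. h r * E r) \<le> f v * E v - f u * E u - integral {u..v} (\<lambda>r. h r * E r)"
            by (simp add: algebra_simps)
          moreover have "E v * integral {u..v} (\<lambda>r. \<beta> r * f r + h r) - (f u * e) * integral {u..v} \<beta>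
              - integral {u..v} (\<lambda>r. h r * E r)
            = integral {u..v} (\<lambda>r. E v * (\<beta> r * f r + h r) - (f u * e) * \<beta> r - h r * E r)"
          proof -
            have "((\<lambda>r. E v * (\<beta> r * f r + h r) - (f u * e) * \<beta> r - h r * E r) has_integral
              E v * integral {u..v} (\<lambda>r. \<beta> r * f r + h r) - (f u * e) * integral {u..v} \<beta>
              - integral {u..v} (\<lambda>r. h r * E r)) {u..v}"
              by (intro has_integral_diff has_integral_mult_right integrable_integral integrable_add ints)
            then show ?thesis by (simp add: integral_unique)
          qed
          moreover have "integral {u..v} (\<lambda>r. - \<delta> * (\<bar>h r\<bar> + \<bar>\<beta> r\<bar>))
             \<le> integral {u..v} (\<lambda>r. E v * (\<beta> r * f r + h r) - (f u * e) * \<beta> r - h r * E r)"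
          proof (rule integral_le)
            show "(\<lambda>r. - \<delta> * (\<bar>h r\<bar> + \<bar>\<beta> r\<bar>)) integrable_on {u..v}"
              by (intro integrable_on_mult_right ints)
            show "(\<lambda>r. E v * (\<beta> r * f r + h r) - (f u * e) * \<beta> r - h r * E r) integrable_on {u..v}"
              by (intro integrable_diff integrable_on_mult_right integrable_add ints)
            fix r assume r: "r \<in> {u..v}"
            have "\<bar>E v * f r - f u * e\<bar> = \<bar>E v * (f r - f u) + f u * (E v - e)\<bar>"
              by (simp add: algebra_simps)
            also have "\<dots> \<le> \<bar>E v\<bar> * \<bar>f r - f u\<bar> + \<bar>f u\<bar> * \<bar>E v - e\<bar>"
              by (metis abs_mult abs_triangle_ineq)
            moreover have "\<bar>f r - f u\<bar> \<le> 2 * \<eta>"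
              using cl(1)[OF r] cl(1)[OF uin(1)] by linarith
            moreover have "\<bar>E v - e\<bar> \<le> 2 * \<eta>"
              using cl(2)[OF uin(1)] cl(2)[OF uin(2)] e(2) by linarith
            moreover have "\<bar>E v\<bar> * (2 * \<eta>) + \<bar>f u\<bar> * (2 * \<eta>) \<le> M * (2 * \<eta>) + M * (2 * \<eta>)"
              using \<eta> M(2)[OF uin(3)] M(3)[OF uin(4)] M(1)
              by (intro add_mono mult_mono) auto
            ultimately have a: "\<bar>E v * f r - f u * e\<bar> \<le> \<delta>"
              using M4 mult_left_mono[of "\<bar>f r - f u\<bar>" "2 * \<eta>" "\<bar>E v\<bar>"]
                mult_left_mono[of "\<bar>E v - e\<bar>" "2 * \<eta>" "\<bar>f u\<bar>"] by simp
            have "2 * \<eta> \<le> \<delta>" using M4 mult_right_mono[OF M(1), of "2 * \<eta>"] \<eta> \<delta> by linarith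
            then have b: "\<bar>h r * (E v - E r)\<bar> \<le> \<bar>h r\<bar> * \<delta>"
              unfolding abs_mult using cl[OF r] cl[OF uin(2)] by (intro mult_left_mono) auto
            have "\<bar>\<beta> r * (E v * f r - f u * e)\<bar> \<le> \<bar>\<beta> r\<bar> * \<delta>"
              unfolding abs_mult using a by (intro mult_left_mono) auto
            then show "- \<delta> * (\<bar>h r\<bar> + \<bar>\<beta> r\<bar>) \<le> E v * (\<beta> r * f r + h r) - (f u * e) * \<beta> r - h r * E r"
              using b by (simp add: algebra_simps)
          qed
          ultimately show "integral {u..v} (\<lambda>r. h r * E r) - \<delta> * integral {u..v} (\<lambda>r. \<bar>h r\<bar> + \<bar>\<beta> r\<bar>) \<le> f v * E v - f u * E u"
            by simp
        qed
      qed
    qed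
    then show ?thesis using st by (simp add: P_def)
  qed
  have I: "integral {s..t} (\<lambda>r. \<bar>h r\<bar> + \<bar>\<beta> r\<bar>) \<ge> 0"
    by (rule integral_nonneg[OF one]) auto
  have "integral {s..t} (\<lambda>r. h r * E r) \<le> f t * E t - f s * E s"
  proof (rule field_le_epsilon)
    fix e :: real assume "e > 0"
    define \<delta> where "\<delta> = e / (integral {s..t} (\<lambda>r. \<bar>h r\<bar> + \<bar>\<beta> r\<bar>) + 1)"
    have "\<delta> > 0" using \<open>e > 0\<close> I by (simp add: \<delta>_def)
    moreover have "\<delta> * integral {s..t} (\<lambda>r. \<bar>h r\<bar> + \<bar>\<beta> r\<bar>) \<le> e"
      using \<open>e > 0\<close> I by (simp add: \<delta>_def field_simps)
    ultimately show "integral {s..t} (\<lambda>r. h r * E r) \<le> f t * E t - f s * E s + e"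
      using main[of \<delta>] by linarith
  qed
  then show ?thesis by (simp add: E_def)
qed

lemma set_integrable_lborel_imp_absolutely_integrable:
  fixes f :: "real \<Rightarrow> real"
  assumes "set_integrable lborel S f"
  shows "f absolutely_integrable_on S"
  using assms integrable_completion[of "\<lambda>x. indicator S x *\<^sub>R f x" lborel]
  unfolding set_integrable_def by (auto dest: borel_measurable_integrable)

text \<open>No integrability is needed, since a non-integrable function has integral 0.\<close>

lemma integral_nonneg_pointwise:
  fixes f :: "real \<Rightarrow> real"
  shows "(\<And>x. x \<in> S \<Longrightarrow> 0 \<le> f x) \<Longrightarrow> 0 \<le> integral S f"
  by (cases "f integrable_on S") (auto simp: integral_nonneg not_integrable_integral)

section \<open>Accumulated damping and late times\<close>

locale L1_damping =
  fixes b :: "real \<Rightarrow> real"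
  assumes b_integrable: "set_integrable lborel {0..} b"
begin

text \<open>With the absolute value, \<open>exp (damp t)\<close> is nondecreasing for t \<ge> 0 and
  lies between 1 and \<open>exp damp_total\<close>, whatever the sign of \<open>b\<close>.\<close>

definition damp :: "real \<Rightarrow> real" where
  "damp t = integral {0..t} (\<lambda>r. \<bar>b r\<bar>)"

definition damp_total :: real where
  "damp_total = integral {0..} (\<lambda>r. \<bar>b r\<bar>)"

lemma abs_b_integrable: "set_integrable lborel {0..} (\<lambda>r. \<bar>b r\<bar>)"
  using b_integrable by (rule set_integrable_abs)

lemma b_abs_int:
  assumes "0 \<le> s"
  shows "b absolutely_integrable_on {s..t}" "(\<lambda>r. \<bar>b r\<bar>) absolutely_integrable_on {s..t}"
  using set_integrable_lborel_imp_absolutely_integrable[OF b_integrable]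
    set_integrable_lborel_imp_absolutely_integrable[OF abs_b_integrable] assms
  by (auto intro!: set_integrable_subset[where A = "{0..}"])

lemma abs_b_integrable_on: "0 \<le> s \<Longrightarrow> (\<lambda>r. \<bar>b r\<bar>) integrable_on {s..t}"
  using b_abs_int by (simp add: set_lebesgue_integral_eq_integral)

lemma damp_diff: "0 \<le> s \<Longrightarrow> s \<le> t \<Longrightarrow> damp t - damp s = integral {s..t} (\<lambda>r. \<bar>b r\<bar>)"
  unfolding damp_def
  using Henstock_Kurzweil_Integration.integral_combine[of 0 s t "\<lambda>r. \<bar>b r\<bar>"] abs_b_integrable_on[of 0 t] by simp

lemma damp_mono: "0 \<le> s \<Longrightarrow> s \<le> t \<Longrightarrow> damp s \<le> damp t"
  using damp_diff[of s t] integral_nonneg[OF abs_b_integrable_on, of s t] by simp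

lemma damp_nonneg: "0 \<le> damp t"
  unfolding damp_def by (intro integral_nonneg abs_b_integrable_on) auto

lemma damp_le_total: "damp t \<le> damp_total"
  unfolding damp_def damp_total_def
  using set_borel_integral_eq_integral(1)[OF abs_b_integrable]
  by (intro integral_subset_le abs_b_integrable_on) auto

lemma damp_tendsto: "(damp \<longlongrightarrow> damp_total) at_top"
proof -
  have "((\<lambda>t. set_lebesgue_integral lborel {0..t} (\<lambda>r. \<bar>b r\<bar>)) \<longlongrightarrow>
      set_lebesgue_integral lborel {0..} (\<lambda>r. \<bar>b r\<bar>)) at_top"
    by (rule tendsto_set_lebesgue_integral_at_top[OF _ abs_b_integrable]) auto
  moreover have "set_lebesgue_integral lborel {0..t} (\<lambda>r. \<bar>b r\<bar>) = damp t" for t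
    unfolding damp_def
    by (rule set_borel_integral_eq_integral(2), rule set_integrable_subset[OF abs_b_integrable]) auto
  ultimately show ?thesis
    unfolding damp_total_def using set_borel_integral_eq_integral(2)[OF abs_b_integrable] by simp
qed

text \<open>The relative error in \<open>late_U1\<close>: its three terms come from the initial
  data, from damping on the first half of [0, t] and from damping on the second half. An error of at
  most 1/2 produces the factor 4 there.\<close>

definition late :: "real \<Rightarrow> real \<Rightarrow> bool" where
  "late lam t \<longleftrightarrow> 0 \<le> t \<and> exp damp_total *
     (exp (- 2 * lam * t) + damp_total * exp (- lam * t) + (damp_total - damp (t / 2))) \<le> 1 / 2"

lemma eventually_late:
  assumes "0 < lam" shows "\<exists>t0\<ge>0. \<forall>t\<ge>t0. late lam t"
proof -
  have e: "((\<lambda>t. exp (- c * t)) \<longlongrightarrow> 0) at_top" if "c > 0" for c :: real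
  proof -
    have "filterlim (\<lambda>t. c * t) at_top at_top"
      by (rule filterlim_tendsto_pos_mult_at_top[OF tendsto_const that filterlim_ident])
    then show ?thesis
      by (intro filterlim_compose[OF exp_at_bot])
        (simp add: filterlim_uminus_at_top[symmetric] flip: filterlim_uminus_at_bot)
  qed
  have "filterlim (\<lambda>t::real. t * (1 / 2)) at_top at_top"
    by (rule filterlim_at_top_mult_tendsto_pos[OF tendsto_const _ filterlim_ident]) simp
  then have h: "((\<lambda>t. damp (t / 2)) \<longlongrightarrow> damp_total) at_top"
    using filterlim_compose[OF damp_tendsto] by simp
  have "((\<lambda>t. exp damp_total * (exp (- (2 * lam) * t) + damp_total * exp (- lam * t) + (damp_total - damp (t / 2))))
      \<longlongrightarrow> exp damp_total * (0 + damp_total * 0 + (damp_total - damp_total))) at_top"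
    using assms by (intro tendsto_intros e h) auto
  then have "\<forall>\<^sub>F t in at_top. exp damp_total * (exp (- (2 * lam) * t) + damp_total * exp (- lam * t) + (damp_total - damp (t / 2))) < 1 / 2"
    by (rule order_tendstoD) simp
  then obtain t0 where "\<And>t. t \<ge> t0 \<Longrightarrow> exp damp_total * (exp (- (2 * lam) * t) + damp_total * exp (- lam * t) + (damp_total - damp (t / 2))) < 1 / 2"
    by (auto simp: eventually_at_top_linorder)
  then show ?thesis
    by (intro exI[of _ "max 0 t0"]) (auto simp: late_def less_imp_le)
qed

end

text \<open>Serves both averages: \<open>lam > 0\<close> for the eigenfunction and
  \<open>lam = 0\<close> for the constant 1. Only the sign of the nonlinear terms is recorded here;
  their size enters lemma by lemma.\<close>

locale damped_ode = L1_damping b for b +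
  fixes lam T :: real and U U1 U2 :: "real \<Rightarrow> real"
  assumes lam: "0 \<le> lam" and T: "0 < T"
    and dU: "\<And>t. t \<in> {0..<T} \<Longrightarrow> (U has_real_derivative U1 t) (at t within {0..<T})"
    and dU1: "\<And>t. t \<in> {0..<T} \<Longrightarrow> (U1 has_real_derivative U2 t) (at t within {0..<T})"
    and cU2: "continuous_on {0..<T} U2"
    and init: "0 \<le> U 0" "0 \<le> U1 0" "0 < U 0 \<or> 0 < U1 0"
    and ineq: "AE t in lborel. t \<in> {0..<T} \<longrightarrow> lam\<^sup>2 * U t \<le> U2 t + b t * U1 t"
begin

lemma cU: "continuous_on {0..<T} U" and cU1: "continuous_on {0..<T} U1"
  using dU dU1 by (meson DERIV_continuous_on)+

lemma sub: "0 \<le> s \<Longrightarrow> t < T \<Longrightarrow> {s..t} \<subseteq> {0..<T}"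
  by auto

lemma dU_sub: "0 \<le> s \<Longrightarrow> t < T \<Longrightarrow> r \<in> {s..t} \<Longrightarrow> (U has_real_derivative U1 r) (at r within {s..t})"
  and dU1_sub: "0 \<le> s \<Longrightarrow> t < T \<Longrightarrow> r \<in> {s..t} \<Longrightarrow> (U1 has_real_derivative U2 r) (at r within {s..t})"
  using has_field_derivative_subset[OF dU sub] has_field_derivative_subset[OF dU1 sub] by auto

lemma ftcU: "0 \<le> s \<Longrightarrow> s \<le> t \<Longrightarrow> t < T \<Longrightarrow> (U1 has_integral U t - U s) {s..t}"
  by (intro fundamental_theorem_of_calculus)
    (auto simp flip: has_real_derivative_iff_has_vector_derivative intro!: dU_sub)

text \<open>As long as the sign of \<open>U1\<close> is unknown, \<open>b * U1\<close> cannot be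
  bounded by \<open>\<bar>b\<bar> * U1\<close>, so the exact integrating factor is used.\<close>

definition signed_damp :: "real \<Rightarrow> real" where
  "signed_damp t = integral {0..t} b"

lemma signed_damp_diff:
  assumes "0 \<le> s" "s \<le> t" shows "signed_damp t = signed_damp s + integral {s..t} b"
  unfolding signed_damp_def
  using Henstock_Kurzweil_Integration.integral_combine[of 0 s t b] b_abs_int(1)[of 0 t] assms
  by (simp add: set_lebesgue_integral_eq_integral)

lemma U1_factor:
  assumes "0 \<le> s" "s \<le> t" "t < T"
  shows "integral {s..t} (\<lambda>r. lam\<^sup>2 * U r * exp (signed_damp r)) \<le>
    U1 t * exp (signed_damp t) - U1 s * exp (signed_damp s)"
proof -
  have "integral {s..t} (\<lambda>r. lam\<^sup>2 * U r * exp (- (- signed_damp r))) \<le>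
    U1 t * exp (- (- signed_damp t)) - U1 s * exp (- (- signed_damp s))"
  proof (rule integrating_factor_ineq[where \<beta> = "\<lambda>r. - b r"])
    show "(\<lambda>r. lam\<^sup>2 * U r) absolutely_integrable_on {s..t}"
      by (intro absolutely_integrable_continuous_real continuous_intros continuous_on_subset[OF cU] sub assms)
    show "(\<lambda>r. - b r) absolutely_integrable_on {s..t}"
      using set_integrable_mult_right[of "-1" lebesgue "{s..t}" b] b_abs_int(1)[OF assms(1)] by simp
    show "- signed_damp r = - signed_damp s + integral {s..r} (\<lambda>r. - b r)" if "r \<in> {s..t}" for r
      using signed_damp_diff[of s r] that assms by simp
    show "AE r in lborel. r \<in> {s..t} \<longrightarrow> - b r * U1 r + lam\<^sup>2 * U r \<le> U2 r"
      using ineq by eventually_elim (use assms in auto)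
  qed (use assms dU1_sub in auto)
  then show ?thesis by simp
qed

text \<open>A continuity argument at the infimum \<open>ts\<close> of the times with
  \<open>U1 < 0\<close>. Up to \<open>ts\<close> the function \<open>U\<close> is nondecreasing, so
  \<open>U1_factor\<close> carries the sign of \<open>U1 0\<close> to \<open>ts\<close>. If
  \<open>U1 ts\<close> is positive, no negative times can accumulate at \<open>ts\<close>; otherwise
  \<open>U1 0 = 0\<close>, hence \<open>U 0 > 0\<close>, and \<open>U\<close> stays positive
  slightly beyond \<open>ts\<close>, which again keeps \<open>U1\<close> nonnegative.\<close>

lemma U1_nonneg: assumes "t \<in> {0..<T}" shows "0 \<le> U1 t"
proof (rule ccontr)
  assume "\<not> 0 \<le> U1 t"
  define S where "S = {r \<in> {0..t}. U1 r < 0}"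
  have S: "S \<noteq> {}" "bdd_below S"
    using assms \<open>\<not> 0 \<le> U1 t\<close> by (auto simp: S_def intro!: exI[of _ t])
  define ts where "ts = Inf S"
  have ts: "0 \<le> ts" "ts \<le> t"
    using S by (auto simp: ts_def S_def intro!: cInf_greatest cInf_lower2)
  have tsT: "ts < T" using ts assms by auto
  have before: "0 \<le> U1 r" if "0 \<le> r" "r < ts" for r
    using that ts cInf_lower[of r S] S unfolding ts_def S_def by force
  have Umono: "U s \<le> U r" if "0 \<le> s" "s \<le> r" "r < T" "\<And>x. s \<le> x \<Longrightarrow> x < r \<Longrightarrow> 0 \<le> U1 x" for s r
  proof -
    have "0 \<le> U r - U s"
    proof (rule has_integral_nonneg)
      \<comment> \<open>Nonnegativity is known only before \<open>r\<close>; the value at that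
        single point is changed.\<close>
      show "((\<lambda>x. if x = r then 0 else U1 x) has_integral U r - U s) {s..r}"
        by (rule has_integral_spike[of "{r}", OF _ _ ftcU]) (use that in auto)
    qed (use that in auto)
    then show ?thesis by simp
  qed
  have Ugr: "U 0 \<le> U r" if "0 \<le> r" "r \<le> ts" for r
    using Umono[of 0 r] that tsT before by auto
  have ge: "U1 0 * exp (signed_damp 0) \<le> U1 ts * exp (signed_damp ts)"
  proof -
    have "0 \<le> integral {0..ts} (\<lambda>r. lam\<^sup>2 * U r * exp (signed_damp r))"
      using Ugr init(1) by (intro integral_nonneg_pointwise mult_nonneg_nonneg) force+
    then show ?thesis using U1_factor[of 0 ts] ts tsT by simp
  qed
  have near: "\<exists>r\<in>S. ts \<le> r \<and> r < ts + d" if d: "d > 0" for d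
  proof -
    obtain r where "r \<in> S" "r < ts + d"
      using cInf_lessD[of S "ts + d"] S d unfolding ts_def by force
    moreover have "ts \<le> r" using \<open>r \<in> S\<close> S unfolding ts_def by (intro cInf_lower)
    ultimately show ?thesis by blast
  qed
  have tsin: "ts \<in> {0..<T}" using ts tsT by simp
  have pos_near: "\<exists>d>0. \<forall>r\<in>{0..<T}. ts \<le> r \<and> r < ts + d \<longrightarrow> 0 < g r"
    if g: "continuous_on {0..<T} g" "0 < g ts" for g :: "real \<Rightarrow> real"
  proof -
    obtain d where "d > 0" "\<And>r. r \<in> {0..<T} \<Longrightarrow> dist r ts < d \<Longrightarrow> dist (g r) (g ts) < g ts"
      using g tsin unfolding continuous_on_iff by meson
    then show ?thesis
      by (intro exI[of _ d]) (force simp: dist_real_def)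
  qed
  show False
  proof (cases "0 < U1 ts")
    case True
    from pos_near[OF cU1 True] near show False
      using assms unfolding S_def by force
  next
    case False
    then have "U1 ts * exp (signed_damp ts) \<le> 0"
      by (simp add: mult_nonpos_nonneg)
    with ge have "U1 0 * exp (signed_damp 0) \<le> 0" by linarith
    then have "U1 0 = 0" using init(2) by (simp add: mult_le_0_iff)
    with ge have "U1 ts \<ge> 0" by (simp add: zero_le_mult_iff)
    have "0 < U ts"
      using init(3) \<open>U1 0 = 0\<close> Ugr[of ts] ts by auto
    then obtain d where d: "d > 0" "\<And>r. r \<in> {0..<T} \<Longrightarrow> ts \<le> r \<Longrightarrow> r < ts + d \<Longrightarrow> 0 < U r"
      using pos_near[OF cU] by blast
    obtain r where r: "r \<in> S" "ts \<le> r" "r < ts + d" using near[OF d(1)] by blast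
    have rT: "r < T" using r assms by (simp add: S_def)
    have "0 \<le> U x" if "x \<in> {ts..r}" for x
      using d(2)[of x] that ts rT r by (simp add: less_imp_le)
    then have "0 \<le> integral {ts..r} (\<lambda>r. lam\<^sup>2 * U r * exp (signed_damp r))"
      by (intro integral_nonneg_pointwise mult_nonneg_nonneg) auto
    then have "U1 ts * exp (signed_damp ts) \<le> U1 r * exp (signed_damp r)"
      using U1_factor[of ts r] ts r rT by simp
    then have "0 \<le> U1 r"
      using \<open>U1 ts \<ge> 0\<close> by (smt (verit) exp_gt_zero mult_neg_pos mult_nonneg_nonneg)
    then show False using r by (simp add: S_def)
  qed
qed

lemma U_mono: assumes "0 \<le> s" "s \<le> t" "t < T" shows "U s \<le> U t"
proof -
  have "0 \<le> U t - U s"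
    by (rule has_integral_nonneg[OF ftcU]) (use assms U1_nonneg in auto)
  then show ?thesis by simp
qed

lemma U_nonneg: "t \<in> {0..<T} \<Longrightarrow> 0 \<le> U t"
  using U_mono[of 0 t] init by auto

text \<open>The second order operator factors as (d/dt - lam)(d/dt + lam). The weight removes the
  growth exp(lam t) and compensates the damping.\<close>

definition Y :: "real \<Rightarrow> real" where
  "Y t = (U1 t + lam * U t) * exp (damp t - lam * t)"

text \<open>Since \<open>U1\<close> and \<open>U\<close> are nonnegative, \<open>b * U1\<close> is
  at most \<open>\<bar>b\<bar> * (U1 + lam * U)\<close>. So \<open>U1 + lam * U\<close> obeys a
  first order inequality with rate \<open>lam - \<bar>b\<bar>\<close>, whose integrating factor is
  the weight in \<open>Y\<close>.\<close>

lemma Y_growth: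
  assumes st: "0 \<le> s" "s \<le> t" "t < T" and h: "continuous_on {s..t} h"
    and N: "AE r in lborel. r \<in> {s..t} \<longrightarrow> lam\<^sup>2 * U r + h r \<le> U2 r + b r * U1 r"
  shows "integral {s..t} (\<lambda>r. h r * exp (damp r - lam * r)) \<le> Y t - Y s"
proof -
  have "integral {s..t} (\<lambda>r. h r * exp (- (lam * r - damp r))) \<le>
      (U1 t + lam * U t) * exp (- (lam * t - damp t)) - (U1 s + lam * U s) * exp (- (lam * s - damp s))"
  proof (rule integrating_factor_ineq[where \<beta> = "\<lambda>r. lam - \<bar>b r\<bar>" and f = "\<lambda>r. U1 r + lam * U r"
        and ?f1.0 = "\<lambda>r. U2 r + lam * U1 r"])
    show "((\<lambda>r. U1 r + lam * U r) has_real_derivative U2 r + lam * U1 r) (at r within {s..t})" if "r \<in> {s..t}" for r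
      using that st by (auto intro!: derivative_eq_intros dU_sub dU1_sub)
    show "h absolutely_integrable_on {s..t}"
      by (rule absolutely_integrable_continuous_real[OF h])
    show "(\<lambda>r. lam - \<bar>b r\<bar>) absolutely_integrable_on {s..t}"
      by (intro set_integral_diff(1) b_abs_int st) simp
    show "lam * r - damp r = lam * s - damp s + integral {s..r} (\<lambda>r. lam - \<bar>b r\<bar>)" if "r \<in> {s..t}" for r
    proof -
      have "integral {s..r} (\<lambda>r. lam - \<bar>b r\<bar>) = integral {s..r} (\<lambda>r. lam) - integral {s..r} (\<lambda>r. \<bar>b r\<bar>)"
        by (intro Henstock_Kurzweil_Integration.integral_diff abs_b_integrable_on integrable_const_ivl st)
      then show ?thesis using damp_diff[of s r] that st by (simp add: algebra_simps)
    qed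
    show "AE r in lborel. r \<in> {s..t} \<longrightarrow> (lam - \<bar>b r\<bar>) * (U1 r + lam * U r) + h r \<le> U2 r + lam * U1 r"
      using N
    proof eventually_elim
      case (elim r)
      show ?case
      proof
        assume r: "r \<in> {s..t}"
        then have rT: "r \<in> {0..<T}" using st by auto
        have "b r * U1 r \<le> \<bar>b r\<bar> * U1 r"
          using U1_nonneg[OF rT] by (intro mult_right_mono) auto
        also have "\<dots> \<le> \<bar>b r\<bar> * (U1 r + lam * U r)"
          using U_nonneg[OF rT] lam by (intro mult_left_mono) auto
        finally show "(lam - \<bar>b r\<bar>) * (U1 r + lam * U r) + h r \<le> U2 r + lam * U1 r"
          using elim r by (simp add: algebra_simps power2_eq_square)
      qed
    qed
  qed (use st in auto)
  then show ?thesis by (simp add: Y_def)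
qed

lemma Y_mono: assumes "0 \<le> s" "s \<le> t" "t < T" shows "Y s \<le> Y t"
proof -
  have "integral {s..t} (\<lambda>r. 0 * exp (damp r - lam * r)) \<le> Y t - Y s"
    by (rule Y_growth) (use assms ineq in \<open>auto elim!: eventually_mono\<close>)
  then show ?thesis by simp
qed

lemma Y_ge: "t \<in> {0..<T} \<Longrightarrow> U1 0 + lam * U 0 \<le> Y t"
  using Y_mono[of 0 t] by (auto simp: Y_def damp_def)

lemma Y_bounds:
  assumes "t \<in> {0..<T}"
  shows "U1 t + lam * U t \<le> exp (lam * t) * Y t"
    and "Y t \<le> exp damp_total * exp (- lam * t) * (U1 t + lam * U t)"
proof -
  have nn: "0 \<le> U1 t + lam * U t"
    using U1_nonneg[OF assms] U_nonneg[OF assms] lam by simp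
  have "(U1 t + lam * U t) * 1 \<le> (U1 t + lam * U t) * exp (damp t)"
    using nn damp_nonneg[of t] by (intro mult_left_mono) auto
  also have "\<dots> = exp (lam * t) * Y t"
    by (simp add: Y_def exp_diff)
  finally show "U1 t + lam * U t \<le> exp (lam * t) * Y t" by simp
  have "(U1 t + lam * U t) * exp (damp t - lam * t) \<le> (U1 t + lam * U t) * exp (damp_total - lam * t)"
    using nn damp_le_total[of t] by (intro mult_left_mono) auto
  then show "Y t \<le> exp damp_total * exp (- lam * t) * (U1 t + lam * U t)"
    by (simp add: Y_def exp_diff exp_minus field_simps)
qed

text \<open>The other factor \<open>U1 - lam * U\<close> relaxes at rate \<open>lam\<close>, so its
  negative part comes only from the data and from the damping term. Through \<open>Y_mono\<close>
  both are bounded by the final value of \<open>U1 + lam * U\<close>, with coefficients that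
  \<open>late\<close> keeps below 1/2.\<close>

lemma late_U1:
  assumes t: "t \<in> {0..<T}" and l: "late lam t"
  shows "U1 t + lam * U t \<le> 4 * U1 t"
proof -
  define Q where "Q = exp damp_total * (U1 t + lam * U t) * exp (- lam * t)"
  have f_le: "U1 r + lam * U r \<le> exp (lam * r) * Q" if "r \<in> {0..t}" for r
  proof -
    have "U1 r + lam * U r \<le> exp (lam * r) * Y r" using Y_bounds(1) that t by auto
    also have "Y r \<le> Y t" using Y_mono that t by auto
    also have "Y t \<le> Q" using Y_bounds(2)[OF t] by (simp add: Q_def mult_ac)
    finally show ?thesis by simp
  qed
  have Q: "0 \<le> Q"
    using U1_nonneg[OF t] U_nonneg[OF t] lam by (simp add: Q_def)
  define h where "h r = - (\<bar>b r\<bar> * (exp (lam * r) * Q))" for r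
  have habs: "(\<lambda>r. \<bar>b r\<bar> * g r) absolutely_integrable_on {s..t}" if "0 \<le> s" "continuous_on {s..t} g" for g and s t :: real
  proof -
    have "(\<lambda>r. g r * \<bar>b r\<bar>) absolutely_integrable_on {s..t}"
      using that b_abs_int by (intro absolutely_integrable_bounded_measurable_product_real
          continuous_imp_measurable_on_sets_lebesgue compact_imp_bounded compact_continuous_image) auto
    then show ?thesis by (simp add: mult.commute)
  qed
  have "integral {0..t} (\<lambda>r. h r * exp (- (- lam * r))) \<le>
      (U1 t - lam * U t) * exp (- (- lam * t)) - (U1 0 - lam * U 0) * exp (- (- lam * 0))"
  proof (rule integrating_factor_ineq[where \<beta> = "\<lambda>r. - lam" and f = "\<lambda>r. U1 r - lam * U r"
        and ?f1.0 = "\<lambda>r. U2 r - lam * U1 r"])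
    show "((\<lambda>r. U1 r - lam * U r) has_real_derivative U2 r - lam * U1 r) (at r within {0..t})" if "r \<in> {0..t}" for r
      using that t by (auto intro!: derivative_eq_intros dU_sub dU1_sub)
    show "h absolutely_integrable_on {0..t}"
      using set_integrable_mult_right[of "-1" lebesgue "{0..t}", OF habs[of 0 t "\<lambda>r. exp (lam * r) * Q"]]
      by (simp add: h_def[abs_def] continuous_intros)
    show "- lam * r = - lam * 0 + integral {0..r} (\<lambda>r. - lam)" if "r \<in> {0..t}" for r
      using that by simp
    show "AE r in lborel. r \<in> {0..t} \<longrightarrow> - lam * (U1 r - lam * U r) + h r \<le> U2 r - lam * U1 r"
      using ineq
    proof eventually_elim
      case (elim r)
      show ?case
      proof
        assume r: "r \<in> {0..t}"
        then have rT: "r \<in> {0..<T}" using t by auto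
        have "b r * U1 r \<le> \<bar>b r\<bar> * U1 r"
          using U1_nonneg[OF rT] by (intro mult_right_mono) auto
        also have "\<dots> \<le> \<bar>b r\<bar> * (exp (lam * r) * Q)"
          using order_trans[OF _ f_le[OF r], of "U1 r"] mult_nonneg_nonneg[OF lam U_nonneg[OF rT]]
          by (intro mult_left_mono) linarith+
        finally show "- lam * (U1 r - lam * U r) + h r \<le> U2 r - lam * U1 r"
          using elim rT by (simp add: h_def algebra_simps power2_eq_square)
      qed
    qed
  qed (use t in auto)
  moreover have "- (Q * (exp (lam * t) * damp_total + exp (2 * lam * t) * (damp_total - damp (t / 2))))
      \<le> integral {0..t} (\<lambda>r. h r * exp (- (- lam * r)))"
  proof -
    have c2: "continuous_on {s..t} (\<lambda>r. exp (2 * lam * r))" for s t by (intro continuous_intros)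
    have int: "(\<lambda>r. \<bar>b r\<bar> * exp (2 * lam * r)) integrable_on {s..t}" if "0 \<le> s" for s t
      using habs[OF that c2] by (rule set_lebesgue_integral_eq_integral)
    have part: "integral {s..t} (\<lambda>r. \<bar>b r\<bar> * exp (2 * lam * r)) \<le> exp (2 * lam * t) * (damp t - damp s)"
      if "0 \<le> s" "s \<le> t" for s t
    proof -
      have "integral {s..t} (\<lambda>r. \<bar>b r\<bar> * exp (2 * lam * r)) \<le> integral {s..t} (\<lambda>r. exp (2 * lam * t) * \<bar>b r\<bar>)"
        using that lam
        by (intro integral_le int integrable_on_mult_right abs_b_integrable_on)
          (auto simp: mult.commute intro!: mult_right_mono mult_left_mono)
      then show ?thesis using damp_diff[OF that] by simp
    qed
    have t0: "0 \<le> t" using t by simp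
    \<comment> \<open>On the first half the weight is at most exp(lam t); on the second half the
      full weight meets the small tail of the damping.\<close>
    have "integral {0..t} (\<lambda>r. \<bar>b r\<bar> * exp (2 * lam * r)) =
        integral {0..t/2} (\<lambda>r. \<bar>b r\<bar> * exp (2 * lam * r)) + integral {t/2..t} (\<lambda>r. \<bar>b r\<bar> * exp (2 * lam * r))"
      using t0 int[of 0 t] by (intro Henstock_Kurzweil_Integration.integral_combine[symmetric]) auto
    also have "\<dots> \<le> exp (2 * lam * (t / 2)) * (damp (t / 2) - damp 0) + exp (2 * lam * t) * (damp t - damp (t / 2))"
      using t0 by (intro add_mono part) auto
    also have "\<dots> \<le> exp (lam * t) * damp_total + exp (2 * lam * t) * (damp_total - damp (t / 2))"
      using damp_le_total damp_mono[of "t / 2" t] t0 by (intro add_mono mult_mono) (auto simp: damp_def[of 0] damp_nonneg)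
    finally have le: "integral {0..t} (\<lambda>r. \<bar>b r\<bar> * exp (2 * lam * r)) \<le>
        exp (lam * t) * damp_total + exp (2 * lam * t) * (damp_total - damp (t / 2))" .
    have "(\<lambda>r. h r * exp (- (- lam * r))) = (\<lambda>r. - Q * (\<bar>b r\<bar> * exp (2 * lam * r)))"
      by (simp add: fun_eq_iff h_def mult_ac flip: exp_add)
    then have "integral {0..t} (\<lambda>r. h r * exp (- (- lam * r))) = - Q * integral {0..t} (\<lambda>r. \<bar>b r\<bar> * exp (2 * lam * r))"
      by simp
    then show ?thesis using mult_left_mono[OF le Q] by simp
  qed
  moreover have "- Q \<le> U1 0 - lam * U 0"
    using f_le[of 0] t init(2) by simp
  ultimately have "- (Q * (1 + exp (lam * t) * damp_total + exp (2 * lam * t) * (damp_total - damp (t / 2))))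
      \<le> (U1 t - lam * U t) * exp (lam * t)"
    by (simp add: algebra_simps)
  then have "- (Q * (1 + exp (lam * t) * damp_total + exp (2 * lam * t) * (damp_total - damp (t / 2)))) * exp (- lam * t)
      \<le> (U1 t - lam * U t) * exp (lam * t) * exp (- lam * t)"
    by (intro mult_right_mono) auto
  also have "\<dots> = U1 t - lam * U t" by (simp add: exp_minus)
  also have "- (Q * (1 + exp (lam * t) * damp_total + exp (2 * lam * t) * (damp_total - damp (t / 2)))) * exp (- lam * t)
    = - ((U1 t + lam * U t) * (exp damp_total *
     (exp (- 2 * lam * t) + damp_total * exp (- lam * t) + (damp_total - damp (t / 2)))))"
  proof -
    have "exp (- 2 * lam * t) = exp (- lam * t) * exp (- lam * t)" "exp (2 * lam * t) = exp (lam * t) * exp (lam * t)"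
      "exp (lam * t) * exp (- lam * t) = 1"
      by (simp_all flip: exp_add)
    then show ?thesis unfolding Q_def by algebra
  qed
  finally have "- ((U1 t + lam * U t) * (exp damp_total *
     (exp (- 2 * lam * t) + damp_total * exp (- lam * t) + (damp_total - damp (t / 2))))) \<le> U1 t - lam * U t" .
  moreover have "(U1 t + lam * U t) * (exp damp_total *
     (exp (- 2 * lam * t) + damp_total * exp (- lam * t) + (damp_total - damp (t / 2)))) \<le> (U1 t + lam * U t) * (1 / 2)"
    using l U1_nonneg[OF t] U_nonneg[OF t] lam unfolding late_def by (intro mult_left_mono) auto
  ultimately show ?thesis by simp
qed

end

section \<open>Blow-up of the averaged quantities\<close>

text \<open>Comparison with z' = w z^p, carried out for the left side \<open>z\<close> of
  \<open>ge\<close>, which is differentiable while \<open>y\<close> is only continuous: z^(1-p) plus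
  p - 1 times the integral of \<open>w\<close> does not increase, and z^(1-p) is
  nonnegative.\<close>

lemma superlinear_integral_bound:
  fixes y w :: "real \<Rightarrow> real"
  assumes st: "s \<le> t" and p: "1 < p" and A: "0 < A"
    and y: "continuous_on {s..t} y" and w: "continuous_on {s..t} w" "\<And>r. r \<in> {s..t} \<Longrightarrow> 0 \<le> w r"
    and ge: "\<And>r. r \<in> {s..t} \<Longrightarrow> A + integral {s..r} (\<lambda>x. w x * y x powr p) \<le> y r"
  shows "(p - 1) * integral {s..t} w \<le> A powr (1 - p)"
proof -
  define z where "z r = A + integral {s..r} (\<lambda>x. w x * y x powr p)" for r
  have zA: "A \<le> z r" if "r \<in> {s..t}" for r
    unfolding z_def using that by (auto intro!: integral_nonneg_pointwise mult_nonneg_nonneg w(2))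
  have zy: "z r \<le> y r" if "r \<in> {s..t}" for r
    using ge[OF that] by (simp add: z_def)
  have ypos: "0 < y r" if "r \<in> {s..t}" for r
    using zA[OF that] zy[OF that] A by simp
  have cont: "continuous_on {s..t} (\<lambda>x. w x * y x powr p)"
    using ypos by (intro continuous_intros y w) force
  have dz: "(z has_real_derivative w r * y r powr p) (at r within {s..t})" if "r \<in> {s..t}" for r
    unfolding z_def using integral_has_real_derivative[OF cont that] by (auto intro!: derivative_eq_intros)
  define g where "g r = z r powr (1 - p) + (p - 1) * integral {s..r} w" for r
  define g' where "g' r = (1 - p) * z r powr (1 - p - 1) * (w r * y r powr p) + (p - 1) * w r" for r
  have dg: "(g has_real_derivative g' r) (at r within {s..t})" if "r \<in> {s..t}" for r
    unfolding g_def g'_def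
    by (intro DERIV_add DERIV_cmult integral_has_real_derivative[OF w(1) that]
        DERIV_chain2[OF has_real_derivative_powr dz[OF that]]) (use zA[OF that] A in simp)
  have "(g' has_integral g t - g s) {s..t}"
    using st dg by (intro fundamental_theorem_of_calculus)
      (auto simp flip: has_real_derivative_iff_has_vector_derivative)
  then have "((\<lambda>r. - g' r) has_integral - (g t - g s)) {s..t}"
    by (rule has_integral_neg)
  then have "0 \<le> - (g t - g s)"
  proof (rule has_integral_nonneg)
    fix r assume r: "r \<in> {s..t}"
    have zr: "0 < z r" using zA[OF r] A by simp
    have "w r * z r powr p \<le> w r * y r powr p"
      using zy[OF r] zr p w(2)[OF r] by (intro mult_left_mono powr_mono2) auto
    then have "z r powr (- p) * (w r * z r powr p) \<le> z r powr (- p) * (w r * y r powr p)"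
      by (rule mult_left_mono) simp
    moreover have "z r powr (- p) * (w r * z r powr p) = w r"
      using zr by (simp add: powr_minus field_simps)
    ultimately have "(p - 1) * w r \<le> (p - 1) * (z r powr (- p) * (w r * y r powr p))"
      using p by (intro mult_left_mono) auto
    then show "0 \<le> - g' r" by (simp add: g'_def algebra_simps)
  qed
  moreover have "g s = A powr (1 - p)" by (simp add: g_def z_def)
  moreover have "(p - 1) * integral {s..t} w \<le> g t" by (simp add: g_def)
  ultimately show ?thesis by simp
qed

section \<open>The superlinear inequality of Glassey type\<close>

context damped_ode
begin

lemma U_diff_lower:
  assumes st: "0 \<le> s" "s \<le> t" "t < T" and c: "\<And>r. r \<in> {s..t} \<Longrightarrow> c \<le> U1 r"
  shows "c * (t - s) \<le> U t - U s"
proof -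
  have "((\<lambda>r. c) has_integral c * (t - s)) {s..t}"
    using has_integral_const_real[of c s t] st by (simp add: mult.commute)
  then show ?thesis
    by (rule has_integral_le[OF _ ftcU[OF st]]) (use c in auto)
qed

lemma continuous_Y: assumes "0 \<le> s" "t < T" shows "continuous_on {s..t} Y"
proof -
  have "continuous_on {0..t} damp"
    unfolding damp_def[abs_def] by (intro indefinite_integral_continuous_1 abs_b_integrable_on) simp
  then have "continuous_on {s..t} damp"
    by (rule continuous_on_subset) (use assms in auto)
  then show ?thesis
    unfolding Y_def[abs_def] using assms
    by (intro continuous_intros continuous_on_subset[OF cU sub] continuous_on_subset[OF cU1 sub])
qed

text \<open>The weight of \<open>Y\<close> turns exp(-lam (p-1) t) U1^p into (exp(-lam t) U1)^p, so
  all exponentials cancel and \<open>Y\<close> satisfies a superlinear integral inequality. The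
  factor \<open>4 * exp damp_total\<close> is the price of passing from \<open>Y\<close> to
  \<open>U1\<close> by \<open>Y_bounds\<close> and \<open>late_U1\<close>.\<close>

lemma glassey_bound:
  assumes p: "1 < p" and k: "0 < k" and t0: "0 \<le> t0" "\<And>t. t0 \<le> t \<Longrightarrow> late lam t"
    and A: "0 < A" "A \<le> U1 0 + lam * U 0"
    and N: "AE t in lborel. t \<in> {0..<T} \<longrightarrow>
      lam\<^sup>2 * U t + k * (1 + t) powr (- \<gamma>) * exp (- lam * (p - 1) * t) * U1 t powr p \<le> U2 t + b t * U1 t"
    and t: "t0 \<le> t" "t < T"
  shows "(p - 1) * (k * (4 * exp damp_total) powr (- p) * integral {t0..t} (\<lambda>r. (1 + r) powr (- \<gamma>))) \<le> A powr (1 - p)"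
proof -
  define k' where "k' = k * (4 * exp damp_total) powr (- p)"
  define w where "w r = k' * (1 + r) powr (- \<gamma>)" for r
  have "(p - 1) * integral {t0..t} w \<le> A powr (1 - p)"
  proof (rule superlinear_integral_bound[where y = Y])
    show "continuous_on {t0..t} Y" using t0 t by (intro continuous_Y)
    show "continuous_on {t0..t} w"
      unfolding w_def[abs_def] using t0 by (intro continuous_intros) auto
    show "0 \<le> w r" for r using k by (simp add: w_def k'_def)
    fix r assume r: "r \<in> {t0..t}"
    define h where "h r = k * (1 + r) powr (- \<gamma>) * exp (- lam * (p - 1) * r) * U1 r powr p" for r
    have f4: "U1 x + lam * U x \<le> 4 * U1 x" if "x \<in> {t0..r}" for x
      using late_U1[of x] t0 t r that by auto
    have posf: "0 < Y x" if "x \<in> {0..<T}" for x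
      using Y_ge[OF that] A by simp
    have U1pos: "0 < U1 x" if x: "x \<in> {t0..r}" for x
    proof -
      have xT: "x \<in> {0..<T}" using x t0 t r by auto
      have "0 < U1 x + lam * U x"
        using Y_bounds(2)[OF xT] posf[OF xT] by (smt (verit) exp_gt_zero mult_nonneg_nonpos2 mult_pos_pos mult_nonneg_nonpos)
      then show ?thesis using f4[OF x] by simp
    qed
    have hc: "continuous_on {t0..r} h"
      unfolding h_def[abs_def] using t0 t r U1pos
      by (intro continuous_intros continuous_on_subset[OF cU1 sub]) force+
    have Yc: "continuous_on {t0..r} (\<lambda>x. w x * Y x powr p)"
    proof -
      have "Y x \<noteq> 0" if "x \<in> {t0..r}" for x
        using posf[of x] that t0 t r by auto
      then show ?thesis
        unfolding w_def using t0 t r by (intro continuous_intros continuous_Y) auto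
    qed
    have dc: "continuous_on {t0..r} (\<lambda>x. exp (damp x - lam * x))"
    proof -
      have "continuous_on {0..r} damp"
        unfolding damp_def[abs_def] by (intro indefinite_integral_continuous_1 abs_b_integrable_on) simp
      then have "continuous_on {t0..r} damp"
        by (rule continuous_on_subset) (use t0 in auto)
      then show ?thesis by (intro continuous_intros)
    qed
    have "integral {t0..r} (\<lambda>x. w x * Y x powr p) \<le> integral {t0..r} (\<lambda>x. h x * exp (damp x - lam * x))"
    proof (rule integral_le)
      show "(\<lambda>x. w x * Y x powr p) integrable_on {t0..r}"
        by (rule integrable_continuous_interval[OF Yc])
      show "(\<lambda>x. h x * exp (damp x - lam * x)) integrable_on {t0..r}"
        by (intro integrable_continuous_interval continuous_intros hc dc)
      fix x assume x: "x \<in> {t0..r}"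
      then have xT: "x \<in> {0..<T}" using t0 t r by auto
      have "Y x \<le> exp damp_total * exp (- lam * x) * (4 * U1 x)"
        using order_trans[OF Y_bounds(2)[OF xT] mult_left_mono[OF f4[OF x]]] by simp
      then have "Y x powr p \<le> ((4 * exp damp_total) * (exp (- lam * x) * U1 x)) powr p"
        using posf[OF xT] p by (intro powr_mono2) (auto simp: mult_ac)
      also have "\<dots> = (4 * exp damp_total) powr p * (exp (- lam * x * p) * U1 x powr p)"
        by (simp add: powr_mult exp_powr_real mult_ac)
      finally have "w x * Y x powr p \<le> w x * ((4 * exp damp_total) powr p * (exp (- lam * x * p) * U1 x powr p))"
        using k by (intro mult_left_mono) (auto simp: w_def k'_def)
      also have "\<dots> = k * (1 + x) powr (- \<gamma>) * exp (- lam * x * p) * U1 x powr p"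
        by (simp add: w_def k'_def powr_minus field_simps)
      also have "\<dots> = h x * exp (- lam * x)"
        by (simp add: h_def algebra_simps flip: exp_add)
      also have "\<dots> \<le> h x * exp (damp x - lam * x)"
        using k damp_nonneg[of x] by (intro mult_left_mono) (auto simp: h_def)
      finally show "w x * Y x powr p \<le> h x * exp (damp x - lam * x)" .
    qed
    also have "\<dots> \<le> Y r - Y t0"
      by (rule Y_growth[OF t0(1)]) (use N r t t0 hc in \<open>auto simp: h_def elim!: eventually_mono\<close>)
    finally show "A + integral {t0..r} (\<lambda>x. w x * Y x powr p) \<le> Y r"
      using Y_ge[of t0] A t0 t by simp
  qed (use t p A in auto)
  then show ?thesis by (simp add: w_def[abs_def] k'_def)
qed

end

section \<open>Polynomial growth and Kato's argument for the average against 1\<close>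

locale damped_ode0 = damped_ode b 0 T U U1 U2 for b T U U1 U2
begin

text \<open>For \<open>lam = 0\<close> the quantity \<open>Y\<close> is \<open>U1\<close> times
  \<open>exp (damp t)\<close>, so \<open>Y_growth\<close> loses only the factor
  \<open>exp damp_total\<close>.\<close>

lemma U1_lower:
  assumes st: "0 \<le> s" "s \<le> t" "t < T" and h: "continuous_on {s..t} h" "\<And>r. r \<in> {s..t} \<Longrightarrow> 0 \<le> h r"
    and N: "AE r in lborel. r \<in> {s..t} \<longrightarrow> h r \<le> U2 r + b r * U1 r"
  shows "exp (- damp_total) * integral {s..t} h \<le> U1 t"
proof -
  have dc: "continuous_on {s..t} damp"
  proof -
    have "continuous_on {0..t} damp"
      unfolding damp_def[abs_def] by (intro indefinite_integral_continuous_1 abs_b_integrable_on) simp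
    then show ?thesis by (rule continuous_on_subset) (use st in auto)
  qed
  have "integral {s..t} h \<le> integral {s..t} (\<lambda>r. h r * exp (damp r - 0 * r))"
  proof (intro integral_le integrable_continuous_interval continuous_intros h dc)
    fix r assume "r \<in> {s..t}"
    then show "h r \<le> h r * exp (damp r - 0 * r)"
      using h(2)[of r] damp_nonneg[of r] mult_left_mono[of 1 "exp (damp r)" "h r"] by simp
  qed
  also have "\<dots> \<le> Y t - Y s"
    by (rule Y_growth[OF st h(1)]) (use N in auto)
  also have "\<dots> \<le> Y t"
    using U1_nonneg[of s] st by (simp add: Y_def)
  also have "\<dots> \<le> exp damp_total * U1 t"
    using Y_bounds(2)[of t] st by simp
  finally show ?thesis
    by (simp add: exp_minus field_simps)
qed

lemma U_linear_lower:
  assumes "t \<in> {0..<T}" shows "exp (- damp_total) * U1 0 * t \<le> U t"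
proof -
  have "exp (- damp_total) * U1 0 \<le> U1 r" if "r \<in> {0..t}" for r
  proof -
    have "U1 0 \<le> exp damp_total * U1 r"
      using order_trans[OF Y_ge[of r] Y_bounds(2)[of r]] that assms by auto
    then show ?thesis by (simp add: exp_minus field_simps)
  qed
  from U_diff_lower[of 0 t, OF _ _ _ this] show ?thesis
    using assms init(1) by auto
qed

text \<open>Lets a power be treated as a constant on the upper half of [0, t], for either sign of
  the exponent.\<close>

lemma powr_halving:
  fixes t r a :: real
  assumes "0 < t" "t / 2 \<le> r" "r \<le> t"
  shows "2 powr (- \<bar>a\<bar>) * t powr a \<le> r powr a"
proof (cases "0 \<le> a")
  case True
  have "2 powr (- \<bar>a\<bar>) * t powr a = (t / 2) powr a"
    using True assms by (simp add: powr_divide powr_minus field_simps)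
  also have "\<dots> \<le> r powr a"
    using True assms by (intro powr_mono2) auto
  finally show ?thesis .
next
  case False
  have "2 powr (- \<bar>a\<bar>) * t powr a \<le> 1 * t powr a"
    using powr_mono[of "- \<bar>a\<bar>" 0 "2::real"] by (intro mult_right_mono) auto
  also have "\<dots> \<le> r powr a"
    using False assms by (simp add: powr_mono2')
  finally show ?thesis .
qed

text \<open>Two integrations, each over the upper half of the time interval only. Each costs a
  factor 1/2 and a halving constant and doubles the starting time, whence
  \<open>4 * t0\<close>.\<close>

lemma U_power_lower:
  assumes t0: "0 < t0" and A: "0 \<le> A"
    and N: "AE t in lborel. t \<in> {0..<T} \<and> t0 \<le> t \<longrightarrow> A * t powr a \<le> U2 t + b t * U1 t"
    and t: "4 * t0 \<le> t" "t < T"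
  shows "exp (- damp_total) * 2 powr (- \<bar>a\<bar>) * 2 powr (- \<bar>a + 1\<bar>) / 4 * A * t powr (a + 2) \<le> U t"
proof -
  define c where "c = exp (- damp_total) * 2 powr (- \<bar>a\<bar>) / 2"
  have c: "0 < c" by (simp add: c_def)
  have U1r: "c * A * r powr (a + 1) \<le> U1 r" if r: "2 * t0 \<le> r" "r < T" for r
  proof -
    have "exp (- damp_total) * integral {r/2..r} (\<lambda>x. A * (2 powr (- \<bar>a\<bar>) * r powr a)) \<le> U1 r"
    proof (rule U1_lower)
      show "AE x in lborel. x \<in> {r / 2..r} \<longrightarrow> A * (2 powr - \<bar>a\<bar> * r powr a) \<le> U2 x + b x * U1 x"
        using N
      proof eventually_elim
        case (elim x)
        show ?case
        proof
          assume x: "x \<in> {r / 2..r}"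
          have "A * (2 powr - \<bar>a\<bar> * r powr a) \<le> A * x powr a"
            using x r t0 A by (intro mult_left_mono powr_halving) auto
          also have "\<dots> \<le> U2 x + b x * U1 x" using elim x r t0 by auto
          finally show "A * (2 powr - \<bar>a\<bar> * r powr a) \<le> U2 x + b x * U1 x" .
        qed
      qed
    qed (use r t0 A in auto)
    moreover have "integral {r/2..r} (\<lambda>x. A * (2 powr (- \<bar>a\<bar>) * r powr a)) = A * (2 powr (- \<bar>a\<bar>) * r powr a) * (r / 2)"
      using r t0 by simp
    moreover have "exp (- damp_total) * (A * (2 powr (- \<bar>a\<bar>) * r powr a) * (r / 2)) = c * A * r powr (a + 1)"
      using r t0 by (simp add: c_def powr_add)
    ultimately show ?thesis by metis
  qed
  have "c * A * (2 powr (- \<bar>a + 1\<bar>) * t powr (a + 1)) * (t - t / 2) \<le> U t - U (t / 2)"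
  proof (rule U_diff_lower)
    fix r assume r: "r \<in> {t / 2..t}"
    have "c * A * (2 powr (- \<bar>a + 1\<bar>) * t powr (a + 1)) \<le> c * A * r powr (a + 1)"
      using r t t0 A c by (intro mult_left_mono powr_halving) auto
    also have "\<dots> \<le> U1 r" using U1r r t by auto
    finally show "c * A * (2 powr (- \<bar>a + 1\<bar>) * t powr (a + 1)) \<le> U1 r" .
  qed (use t t0 in auto)
  moreover have "0 \<le> U (t / 2)" using U_nonneg t t0 by auto
  moreover have "t powr (a + 2) = t powr (a + 1) * t"
    using t t0 powr_add[of t "a + 1" 1] by (simp add: add.assoc)
  ultimately show ?thesis by (simp add: c_def field_simps)
qed

text \<open>Each doubling of \<open>U\<close> takes at most a fixed factor \<open>2 powr ((1 - q) / 2) < 1\<close> of the time of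
  the previous one.\<close>

lemma doubling_time:
  assumes q: "1 < q" and \<kappa>: "0 < \<kappa>" and D: "0 < D" "D \<le> U s" and s: "0 \<le> s" "0 \<le> L" "s + L < T"
    and N: "AE t in lborel. t \<in> {s..s+L} \<longrightarrow> \<kappa> * U t powr q \<le> U2 t + b t * U1 t"
  shows "L \<le> sqrt (2 * exp damp_total / \<kappa>) * D powr ((1 - q) / 2) / (1 - 2 powr ((1 - q) / 2))"
proof (rule ccontr)
  \<comment> \<open>An upper bound for the time in which \<open>U\<close> doubles from
    \<open>D\<close>: it solves D = exp(-damp_total) \<kappa> D^q a^2 / 2.\<close>
  define a where "a = sqrt (2 * exp damp_total / \<kappa>) * D powr ((1 - q) / 2)"
  define \<rho> where "\<rho> = (2::real) powr ((1 - q) / 2)"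
  have \<rho>: "0 < \<rho>" "\<rho> < 1" using q by (auto simp: \<rho>_def powr_less_one)
  have a: "0 < a" using \<kappa> D by (simp add: a_def)
  assume "\<not> ?thesis"
  then have L: "a / (1 - \<rho>) < L" by (simp add: a_def \<rho>_def)
  \<comment> \<open>The steps sum to at most \<open>a / (1 - \<rho>) < L\<close>, so infinitely many
    doublings would fit before \<open>s + L\<close>, where \<open>U\<close> is finite.\<close>
  define \<tau> where "\<tau> j = s + a * (\<Sum>i<j. \<rho> ^ i)" for j :: nat
  have geo: "a * (\<Sum>i<j. \<rho> ^ i) \<le> a / (1 - \<rho>)" for j
  proof -
    have "(\<Sum>i<j. \<rho> ^ i) = (1 - \<rho> ^ j) / (1 - \<rho>)"
      using \<rho> by (simp add: sum_gp_strict)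
    also have "\<dots> \<le> 1 / (1 - \<rho>)"
      using \<rho> by (intro divide_right_mono) auto
    finally show ?thesis using a by (simp add: mult_left_mono[of _ "1 / (1 - \<rho>)" a, simplified])
  qed
  have \<tau>: "s \<le> \<tau> j" "\<tau> j < s + L" for j
    using geo[of j] L a \<rho> by (auto simp: \<tau>_def sum_nonneg)
  have step: "D * 2 ^ j \<le> U (\<tau> j)" for j
  proof (induction j)
    case 0
    then show ?case using D by (simp add: \<tau>_def)
  next
    case (Suc j)
    define V where "V = D * 2 ^ j"
    have V: "0 < V" using D by (simp add: V_def)
    define d where "d = a * \<rho> ^ j"
    have d: "0 < d" using a \<rho> by (simp add: d_def)
    have \<tau>S: "\<tau> (Suc j) = \<tau> j + d" by (simp add: \<tau>_def d_def algebra_simps)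
    have dd: "d\<^sup>2 = 2 * exp damp_total / \<kappa> * V powr (1 - q)"
    proof -
      have "\<rho> ^ j = (2 ^ j) powr ((1 - q) / 2)"
        unfolding \<rho>_def by (simp add: powr_powr mult.commute flip: powr_realpow)
      then have "d = sqrt (2 * exp damp_total / \<kappa>) * V powr ((1 - q) / 2)"
        using D by (simp add: d_def a_def V_def powr_mult)
      then have "d\<^sup>2 = (2 * exp damp_total / \<kappa>) * (V powr ((1 - q) / 2))\<^sup>2"
        using \<kappa> by (simp add: power_mult_distrib)
      also have "(V powr ((1 - q) / 2))\<^sup>2 = V powr (1 - q)"
        by (simp add: power2_eq_square flip: powr_add)
      finally show ?thesis .
    qed
    have U1r: "exp (- damp_total) * \<kappa> * V powr q * (r - \<tau> j) \<le> U1 r" if r: "r \<in> {\<tau> j..\<tau> (Suc j)}" for r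
    proof -
      have "exp (- damp_total) * integral {\<tau> j..r} (\<lambda>x. \<kappa> * V powr q) \<le> U1 r"
      proof (rule U1_lower)
        show "AE x in lborel. x \<in> {\<tau> j..r} \<longrightarrow> \<kappa> * V powr q \<le> U2 x + b x * U1 x"
          using N
        proof eventually_elim
          case (elim x)
          show ?case
          proof
            assume x: "x \<in> {\<tau> j..r}"
            then have xs: "x \<in> {s..s+L}" using \<tau>[of j] \<tau>[of "Suc j"] r by auto
            have "V \<le> U x"
              using Suc.IH U_mono[of "\<tau> j" x] x xs s \<tau>(1)[of j] by (auto simp: V_def)
            then have "\<kappa> * V powr q \<le> \<kappa> * U x powr q"
              using V q \<kappa> by (intro mult_left_mono powr_mono2) auto
            also have "\<dots> \<le> U2 x + b x * U1 x" using elim xs by auto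
            finally show "\<kappa> * V powr q \<le> U2 x + b x * U1 x" .
          qed
        qed
      qed (use r \<tau>[of j] \<tau>[of "Suc j"] s \<kappa> in auto)
      then show ?thesis using r by (simp add: mult_ac)
    qed
    have quad: "((\<lambda>r. exp (- damp_total) * \<kappa> * V powr q * (r - \<tau> j)) has_integral
        exp (- damp_total) * \<kappa> * V powr q * (d\<^sup>2 / 2)) {\<tau> j..\<tau> (Suc j)}"
    proof -
      have "((\<lambda>r. r - \<tau> j) has_integral ((\<tau> (Suc j) - \<tau> j)\<^sup>2 / 2 - (\<tau> j - \<tau> j)\<^sup>2 / 2)) {\<tau> j..\<tau> (Suc j)}"
        using d \<tau>S by (intro fundamental_theorem_of_calculus)
          (auto intro!: derivative_eq_intros simp flip: has_real_derivative_iff_has_vector_derivative)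
      then show ?thesis using \<tau>S by (intro has_integral_mult_right) simp
    qed
    have "exp (- damp_total) * \<kappa> * V powr q * (d\<^sup>2 / 2) \<le> U (\<tau> (Suc j)) - U (\<tau> j)"
      by (rule has_integral_le[OF quad ftcU]) (use U1r \<tau>[of j] \<tau>[of "Suc j"] s d \<tau>S in auto)
    moreover have "exp (- damp_total) * \<kappa> * V powr q * (d\<^sup>2 / 2) = V"
      using \<kappa> V unfolding dd by (simp add: exp_minus powr_diff field_simps)
    ultimately show ?case using Suc.IH by (simp add: V_def)
  qed
  obtain j where "U (s + L) / D < 2 ^ j"
    using real_arch_pow[of 2 "U (s + L) / D"] by auto
  then have "U (s + L) < D * 2 ^ j" using D by (simp add: field_simps)
  also have "\<dots> \<le> U (s + L)"
    using order_trans[OF step[of j] U_mono[of "\<tau> j" "s + L"]] \<tau>[of j] s by simp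
  finally show False by simp
qed

text \<open>\<open>doubling_time\<close> is applied on [L, 2L] for every L \<ge> t1 with 2L < T.
  There 1 + t \<le> 3L makes the coefficient constant, and U L \<ge> A L^\<alpha>; the outcome is
  L^\<theta> \<le> C A^(1-q). Letting L approach T/2 bounds \<open>T\<close>.\<close>

lemma kato_lifespan:
  fixes k q \<beta> \<alpha> A t1 :: real
  defines "\<theta> \<equiv> (q - 1) * \<alpha> - \<beta> + 2"
  assumes q: "1 < q" and k: "0 < k" and \<beta>: "0 \<le> \<beta>" and \<theta>: "0 < \<theta>" and t1: "1 \<le> t1" and A: "0 < A"
    and N: "AE t in lborel. t \<in> {0..<T} \<longrightarrow> k * (1 + t) powr (- \<beta>) * U t powr q \<le> U2 t + b t * U1 t"
    and lower: "\<And>t. t1 \<le> t \<Longrightarrow> t < T \<Longrightarrow> A * t powr \<alpha> \<le> U t"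
  shows "T \<le> max (2 * t1) (2 * ((2 * exp damp_total * 3 powr \<beta> / (k * (1 - 2 powr ((1 - q) / 2))\<^sup>2)) powr (1 / \<theta>)
      * A powr (- (q - 1) / \<theta>)))"
proof -
  define \<rho> where "\<rho> = (2::real) powr ((1 - q) / 2)"
  have \<rho>: "0 < \<rho>" "\<rho> < 1" using q by (auto simp: \<rho>_def powr_less_one)
  define C where "C = 2 * exp damp_total * 3 powr \<beta> / (k * (1 - \<rho>)\<^sup>2)"
  have C: "0 < C" using k \<rho> by (simp add: C_def)
  define X where "X = C powr (1 / \<theta>) * A powr (- (q - 1) / \<theta>)"
  have LX: "L \<le> X" if L: "t1 \<le> L" "2 * L < T" for L
  proof -
    have L0: "0 < L" using t1 L by simp
    define \<kappa> where "\<kappa> = k * (3 * L) powr (- \<beta>)"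
    have \<kappa>: "0 < \<kappa>" using k L0 by (simp add: \<kappa>_def)
    define D where "D = A * L powr \<alpha>"
    have D: "0 < D" using A L0 by (simp add: D_def)
    have "L \<le> sqrt (2 * exp damp_total / \<kappa>) * D powr ((1 - q) / 2) / (1 - 2 powr ((1 - q) / 2))"
    proof (rule doubling_time[where s = L])
      show "D \<le> U L" using lower[of L] L L0 by (simp add: D_def)
      show "AE t in lborel. t \<in> {L..L + L} \<longrightarrow> \<kappa> * U t powr q \<le> U2 t + b t * U1 t"
        using N
      proof eventually_elim
        case (elim t)
        show ?case
        proof
          assume t: "t \<in> {L..L + L}"
          have "(3 * L) powr (- \<beta>) \<le> (1 + t) powr (- \<beta>)"
            using t L0 t1 L \<beta> by (intro powr_mono2') auto
          then have "\<kappa> * U t powr q \<le> k * (1 + t) powr (- \<beta>) * U t powr q"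
            using k by (simp add: \<kappa>_def mult_right_mono)
          also have "\<dots> \<le> U2 t + b t * U1 t" using elim t L L0 by auto
          finally show "\<kappa> * U t powr q \<le> U2 t + b t * U1 t" .
        qed
      qed
    qed (use q \<kappa> D L L0 in auto)
    then have "L\<^sup>2 \<le> (sqrt (2 * exp damp_total / \<kappa>) * D powr ((1 - q) / 2) / (1 - \<rho>))\<^sup>2"
      using L0 by (intro power_mono) (auto simp: \<rho>_def)
    also have "\<dots> = (2 * exp damp_total / \<kappa>) * (D powr ((1 - q) / 2))\<^sup>2 / (1 - \<rho>)\<^sup>2"
      using \<kappa> by (simp add: power_divide power_mult_distrib)
    also have "(D powr ((1 - q) / 2))\<^sup>2 = D powr (1 - q)"
      by (simp add: power2_eq_square flip: powr_add)
    also have "D powr (1 - q) = A powr (1 - q) * L powr (\<alpha> * (1 - q))"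
      using A L0 by (simp add: D_def powr_mult powr_powr)
    also have "2 * exp damp_total / \<kappa> * (A powr (1 - q) * L powr (\<alpha> * (1 - q))) / (1 - \<rho>)\<^sup>2
        = C * A powr (1 - q) * (L powr \<beta> * L powr (\<alpha> * (1 - q)))"
      using k L0 by (simp add: \<kappa>_def C_def powr_mult powr_minus field_simps)
    also have "L powr \<beta> * L powr (\<alpha> * (1 - q)) = L powr (2 - \<theta>)"
      by (simp add: \<theta>_def algebra_simps flip: powr_add)
    finally have "L powr (\<theta> - 2) * L\<^sup>2 \<le> L powr (\<theta> - 2) * (C * A powr (1 - q) * L powr (2 - \<theta>))"
      by (rule mult_left_mono) simp
    moreover have "L\<^sup>2 = L powr 2" using L0 by (simp add: powr_numeral)
    moreover have "L powr (\<theta> - 2) * (C * A powr (1 - q) * L powr (2 - \<theta>)) = C * A powr (1 - q)"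
      using L0 powr_add[of L "\<theta> - 2" "2 - \<theta>"] by simp
    ultimately have "L powr \<theta> \<le> C * A powr (1 - q)"
      by (simp flip: powr_add)
    then have "(L powr \<theta>) powr (1 / \<theta>) \<le> (C * A powr (1 - q)) powr (1 / \<theta>)"
      using \<theta> by (intro powr_mono2) auto
    then show ?thesis
      using \<theta> L0 C A by (simp add: X_def powr_powr powr_mult)
  qed
  have "T \<le> max (2 * t1) (2 * X)"
  proof (rule ccontr)
    assume "\<not> ?thesis"
    then have T: "2 * t1 < T" "2 * X < T" by auto
    then have "max t1 X < T / 2" by simp
    then obtain L where "max t1 X < L" "L < T / 2" using dense by blast
    then show False using LX[of L] by simp
  qed
  then show ?thesis by (simp add: X_def C_def \<rho>_def)
qed

end

section \<open>Weighted integral estimates\<close>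

text \<open>Young's inequality after normalising both factors. Only the two power integrals are
  assumed finite: if the product is not integrable, its Bochner integral is 0. Vanishing norms,
  which cannot be normalised, are treated apart.\<close>

lemma holder_weighted:
  fixes f g w :: "'a \<Rightarrow> real"
  assumes p: "1 < p" and w: "\<And>x. 0 \<le> w x" and g: "\<And>x. 0 \<le> g x"
    and f_int: "integrable M (\<lambda>x. \<bar>f x\<bar> powr p * w x)"
    and g_int: "integrable M (\<lambda>x. g x powr (p / (p - 1)) * w x)"
  shows "\<bar>\<integral>x. f x * g x * w x \<partial>M\<bar> powr p \<le>
    (\<integral>x. \<bar>f x\<bar> powr p * w x \<partial>M) * (\<integral>x. g x powr (p / (p - 1)) * w x \<partial>M) powr (p - 1)"
proof (cases "integrable M (\<lambda>x. f x * g x * w x)")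
  case False
  then show ?thesis
    using p w by (simp add: not_integrable_integral_eq)
next
  case True
  define q where "q = p / (p - 1)"
  have q: "1 < q" "1 / p + 1 / q = 1" using p by (auto simp: q_def field_simps)
  define X where "X = (\<integral>x. \<bar>f x\<bar> powr p * w x \<partial>M)"
  define Z where "Z = (\<integral>x. g x powr q * w x \<partial>M)"
  have X: "0 \<le> X" and Z: "0 \<le> Z" using w by (auto simp: X_def Z_def)
  have zero: "(\<integral>x. f x * g x * w x \<partial>M) = 0" if "X = 0 \<or> Z = 0"
  proof -
    have "AE x in M. f x * g x * w x = 0"
      using that
    proof
      assume "X = 0"
      then have "AE x in M. \<bar>f x\<bar> powr p * w x = 0"
        using integral_nonneg_eq_0_iff_AE[OF f_int] w by (auto simp: X_def)
      then show ?thesis by eventually_elim auto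
    next
      assume "Z = 0"
      then have "AE x in M. g x powr q * w x = 0"
        using integral_nonneg_eq_0_iff_AE[OF g_int] w by (auto simp: Z_def q_def)
      then show ?thesis by eventually_elim auto
    qed
    then show ?thesis by (rule integral_eq_zero_AE)
  qed
  show ?thesis
  proof (cases "X = 0 \<or> Z = 0")
    case True
    then show ?thesis using zero w p by (simp add: X_def[symmetric] X)
  next
    case False
    then have X0: "0 < X" and Z0: "0 < Z" using X Z by auto
    define c where "c = X powr (1 / p) * Z powr (1 / q)"
    have c: "0 < c" using X0 Z0 by (simp add: c_def)
    have pt: "\<bar>f x * g x * w x\<bar> \<le> c * (\<bar>f x\<bar> powr p * w x / (p * X) + g x powr q * w x / (q * Z))" for x
    proof -
      have "(\<bar>f x\<bar> / X powr (1 / p)) * (g x / Z powr (1 / q)) \<le>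
          (\<bar>f x\<bar> / X powr (1 / p)) powr p / p + (g x / Z powr (1 / q)) powr q / q"
        using p q g by (intro Youngs_inequality) auto
      also have "(\<bar>f x\<bar> / X powr (1 / p)) powr p = \<bar>f x\<bar> powr p / X"
        using X0 p by (simp add: powr_divide powr_powr)
      also have "(g x / Z powr (1 / q)) powr q = g x powr q / Z"
        using Z0 q g by (simp add: powr_divide powr_powr)
      finally have "\<bar>f x\<bar> * g x \<le> c * (\<bar>f x\<bar> powr p / X / p + g x powr q / Z / q)"
        using X0 Z0 by (simp add: c_def field_simps)
      then have "\<bar>f x\<bar> * g x * w x \<le> c * (\<bar>f x\<bar> powr p / X / p + g x powr q / Z / q) * w x"
        by (rule mult_right_mono) (rule w)
      then show ?thesis
        using g w by (simp add: abs_mult field_simps)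
    qed
    have "\<bar>\<integral>x. f x * g x * w x \<partial>M\<bar> \<le> (\<integral>x. \<bar>f x * g x * w x\<bar> \<partial>M)"
      by (rule integral_abs_bound)
    also have "\<dots> \<le> (\<integral>x. c * (\<bar>f x\<bar> powr p * w x / (p * X) + g x powr q * w x / (q * Z)) \<partial>M)"
      using True f_int g_int pt by (intro integral_mono) (auto simp: q_def)
    also have "\<dots> = c * (X / (p * X) + Z / (q * Z))"
      using f_int g_int by (simp add: X_def Z_def q_def)
    also have "\<dots> = c" using X0 Z0 q p by (simp add: field_simps)
    finally have "\<bar>\<integral>x. f x * g x * w x \<partial>M\<bar> powr p \<le> c powr p"
      using p by (intro powr_mono2) auto
    also have "c powr p = X * Z powr (p - 1)"
      using X0 Z0 p by (simp add: c_def powr_mult powr_powr q_def)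
    finally show ?thesis by (simp add: X_def Z_def q_def)
  qed
qed

text \<open>Turns Hoelder's inequality into a lower bound for the nonlinear integral
  \<open>X\<close> once the weight integral \<open>J\<close> is controlled by
  \<open>E\<close>.\<close>

lemma holder_divide:
  fixes x X J E s :: real
  assumes "x \<le> X * J powr (s - 1)" "1 < s" "0 \<le> X" "0 \<le> J" "J \<le> E" "0 < E"
  shows "x * E powr (1 - s) \<le> X"
proof -
  have "X * J powr (s - 1) \<le> X * E powr (s - 1)"
    using assms by (intro mult_left_mono powr_mono2) auto
  with assms(1) have "x * E powr (1 - s) \<le> X * E powr (s - 1) * E powr (1 - s)"
    by (intro mult_right_mono) auto
  also have "\<dots> = X" using assms(6) by (simp add: mult.assoc flip: powr_add)
  finally show ?thesis .
qed

section \<open>Exponentially weighted integrals over balls, by unit shells\<close>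

lemma power_diff_le:
  fixes a b :: real
  assumes "0 \<le> b" "b \<le> a"
  shows "a ^ n - b ^ n \<le> real n * a ^ (n - 1) * (a - b)"
proof (induction n)
  case (Suc n)
  have "a ^ Suc n - b ^ Suc n = a * (a ^ n - b ^ n) + b ^ n * (a - b)"
    by (simp add: algebra_simps)
  also have "\<dots> \<le> a * (real n * a ^ (n - 1) * (a - b)) + a ^ n * (a - b)"
    using assms Suc by (intro add_mono mult_left_mono mult_right_mono power_mono) auto
  also have "\<dots> = real (Suc n) * a ^ (Suc n - 1) * (a - b)"
    by (cases n) (simp_all add: algebra_simps)
  finally show ?case .
qed simp

text \<open>A shell of unit width has one power of the radius less than the ball. For
  \<open>a < 1\<close> the inner ball has negative radius and is empty, and the whole ball is
  bounded by a constant.\<close>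

lemma shell_measure_le:
  fixes a \<rho> :: real
  assumes "0 \<le> a" "a \<le> \<rho>"
  shows "measure lborel (cball (0::real^'n::finite) a - cball 0 (a - 1)) \<le>
    unit_ball_vol (real CARD('n)) * real CARD('n) * (1 + \<rho>) ^ (CARD('n) - 1)"
proof -
  define V where "V = unit_ball_vol (real CARD('n))"
  have V: "0 < V" by (simp add: V_def)
  have n: "1 \<le> CARD('n)" by (simp add: Suc_leI)
  have p1: "1 \<le> (1 + \<rho>) ^ (CARD('n) - 1)" using assms by simp
  show ?thesis
  proof (cases "1 \<le> a")
    case True
    have "measure lborel (cball (0::real^'n) a - cball 0 (a - 1)) =
        measure lborel (cball (0::real^'n) a) - measure lborel (cball (0::real^'n) (a - 1))"
      using emeasure_compact_finite[OF compact_cball, of "0::real^'n" a]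
      by (intro measure_Diff) (auto simp: less_top)
    also have "\<dots> = V * (a ^ CARD('n) - (a - 1) ^ CARD('n))"
      using True by (simp add: content_cball V_def algebra_simps)
    also have "\<dots> \<le> V * (real CARD('n) * a ^ (CARD('n) - 1) * (a - (a - 1)))"
      using V True by (intro mult_left_mono power_diff_le) auto
    also have "\<dots> \<le> V * (real CARD('n) * (1 + \<rho>) ^ (CARD('n) - 1))"
      using V assms by (auto intro!: mult_left_mono power_mono)
    finally show ?thesis by (simp add: V_def mult.assoc)
  next
    case False
    then have "cball (0::real^'n) (a - 1) = {}" by auto
    then have "measure lborel (cball (0::real^'n) a - cball 0 (a - 1)) = V * a ^ CARD('n)"
      using assms by (simp add: content_cball V_def)
    also have "\<dots> \<le> V * 1"
      using V False assms by (intro mult_left_mono power_le_one) auto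
    also have "\<dots> \<le> V * (real CARD('n) * (1 + \<rho>) ^ (CARD('n) - 1))"
      using V n p1 mult_mono[of 1 "real CARD('n)" 1 "(1 + \<rho>) ^ (CARD('n) - 1)"]
      by (intro mult_left_mono) auto
    finally show ?thesis by (simp add: V_def mult.assoc)
  qed
qed

lemma integrable_indicator_cball:
  fixes f :: "'a::euclidean_space \<Rightarrow> real"
  assumes "continuous_on (cball 0 \<rho>) f"
  shows "integrable lborel (\<lambda>x. indicator (cball 0 \<rho>) x * f x)"
  using borel_integrable_compact[OF compact_cball assms] by simp

text \<open>The ball is cut into unit shells counted inward from the boundary, the k-th with weight
  at most exp(-c k). The geometric series leaves the size of a single shell, hence the power
  \<open>n - 1\<close>.\<close>

lemma exp_shell_integral:
  fixes c :: real
  assumes c: "0 < c"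
  shows "\<exists>C>0. \<forall>\<rho>\<ge>0. (\<integral>x. indicator (cball (0::real^'n::finite) \<rho>) x * exp (- c * (\<rho> - norm x)) \<partial>lborel)
    \<le> C * (1 + \<rho>) powr (real CARD('n) - 1)"
proof -
  define V where "V = unit_ball_vol (real CARD('n)) * real CARD('n)"
  have V: "0 < V" by (simp add: V_def)
  define q where "q = exp (- c)"
  have q: "0 < q" "q < 1" using c by (auto simp: q_def)
  show ?thesis
  proof (intro exI[of _ "V / (1 - q)"] conjI allI impI)
    show "0 < V / (1 - q)" using V q by simp
    fix \<rho> :: real assume \<rho>: "0 \<le> \<rho>"
    define N where "N = nat \<lfloor>\<rho>\<rfloor>"
    define S where "S k = cball (0::real^'n) (\<rho> - real k) - cball 0 (\<rho> - real k - 1)" for k :: nat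
    have Sm: "S k \<in> sets lborel" "emeasure lborel (S k) < \<infinity>" for k
    proof -
      show "S k \<in> sets lborel" by (simp add: S_def)
      have "emeasure lborel (S k) \<le> emeasure lborel (cball (0::real^'n) (\<rho> - real k))"
        by (intro emeasure_mono) (auto simp: S_def)
      also have "\<dots> < \<infinity>" by (rule emeasure_compact_finite) simp
      finally show "emeasure lborel (S k) < \<infinity>" .
    qed
    have int: "integrable lborel (\<lambda>x. q ^ k * indicator (S k) x :: real)" for k
      using Sm by (intro integrable_mult_right integrable_real_indicator) auto
    have "(\<integral>x. indicator (cball (0::real^'n) \<rho>) x * exp (- c * (\<rho> - norm x)) \<partial>lborel)
      \<le> (\<integral>x. (\<Sum>k\<le>N. q ^ k * indicator (S k) x) \<partial>lborel)"
    proof (rule integral_mono)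
      show "integrable lborel (\<lambda>x. indicator (cball (0::real^'n) \<rho>) x * exp (- c * (\<rho> - norm x)))"
        by (intro integrable_indicator_cball continuous_intros)
      show "integrable lborel (\<lambda>x. \<Sum>k\<le>N. q ^ k * indicator (S k) x :: real)"
        by (intro Bochner_Integration.integrable_sum int)
      fix x :: "real^'n"
      show "indicator (cball (0::real^'n) \<rho>) x * exp (- c * (\<rho> - norm x)) \<le> (\<Sum>k\<le>N. q ^ k * indicator (S k) x)"
      proof (cases "norm x \<le> \<rho>")
        case False
        then show ?thesis using q by (simp add: sum_nonneg)
      next
        case True
        define j where "j = nat \<lfloor>\<rho> - norm x\<rfloor>"
        have j: "real j \<le> \<rho> - norm x" "\<rho> - norm x < real j + 1"
          using True by (auto simp: j_def)
        have jN: "j \<le> N"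
          unfolding j_def N_def by (intro nat_mono floor_mono) simp
        have "x \<in> S j" using j by (auto simp: S_def)
        have "indicator (cball (0::real^'n) \<rho>) x * exp (- c * (\<rho> - norm x)) = exp (- c * (\<rho> - norm x))"
          using True by simp
        also have "\<dots> \<le> exp (- c * real j)" using j c by simp
        also have "\<dots> = q ^ j * indicator (S j) x"
          using \<open>x \<in> S j\<close> by (simp add: q_def mult.commute flip: exp_of_nat_mult)
        also have "\<dots> \<le> (\<Sum>k\<le>N. q ^ k * indicator (S k) x)"
          using jN q by (intro member_le_sum) auto
        finally show ?thesis .
      qed
    qed
    also have "\<dots> = (\<Sum>k\<le>N. q ^ k * measure lborel (S k))"
      using int Sm by (subst Bochner_Integration.integral_sum) auto
    also have "\<dots> \<le> (\<Sum>k\<le>N. q ^ k * (V * (1 + \<rho>) ^ (CARD('n) - 1)))"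
    proof (intro sum_mono mult_left_mono)
      fix k assume "k \<in> {..N}"
      then have "real k \<le> \<rho>" using \<rho> by (simp add: N_def le_nat_floor) linarith
      then show "measure lborel (S k) \<le> V * (1 + \<rho>) ^ (CARD('n) - 1)"
        unfolding S_def V_def by (intro shell_measure_le) auto
    qed (use q in auto)
    also have "\<dots> = (\<Sum>k\<le>N. q ^ k) * (V * (1 + \<rho>) ^ (CARD('n) - 1))"
      by (simp add: sum_distrib_right)
    also have "\<dots> \<le> 1 / (1 - q) * (V * (1 + \<rho>) ^ (CARD('n) - 1))"
    proof (rule mult_right_mono)
      have "(\<Sum>k\<le>N. q ^ k) = (1 - q ^ Suc N) / (1 - q)"
        using q by (simp add: sum_gp0)
      also have "\<dots> \<le> 1 / (1 - q)" using q by (intro divide_right_mono) auto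
      finally show "(\<Sum>k\<le>N. q ^ k) \<le> 1 / (1 - q)" .
    qed (use V \<rho> in auto)
    also have "(1 + \<rho>) ^ (CARD('n) - 1) = (1 + \<rho>) powr (real CARD('n) - 1)"
      using \<rho> by (subst powr_realpow[symmetric]) (auto simp: of_nat_diff Suc_leI)
    finally show "(\<integral>x. indicator (cball (0::real^'n) \<rho>) x * exp (- c * (\<rho> - norm x)) \<partial>lborel)
        \<le> V / (1 - q) * (1 + \<rho>) powr (real CARD('n) - 1)" by simp
  qed
qed

text \<open>If d \<le> 1 and d m \<le> c, then d (1 + s) \<le> 1 + d s \<le> exp(d s), and the m-th
  power gives the bound; the \<open>min\<close> is such a \<open>d\<close>.\<close>

lemma powr_le_exp:
  fixes c m s :: real
  assumes "0 < c" "0 \<le> m" "0 \<le> s"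
  shows "(1 + s) powr m \<le> (min 1 (c / (m + 1))) powr (- m) * exp (c * s)"
proof -
  define d where "d = min 1 (c / (m + 1))"
  have d: "0 < d" "d \<le> 1" "d * m \<le> c"
  proof -
    show "0 < d" "d \<le> 1" using assms by (auto simp: d_def)
    have "d * m \<le> c / (m + 1) * m" using assms by (intro mult_right_mono) (auto simp: d_def)
    also have "\<dots> \<le> c" using assms by (simp add: field_simps)
    finally show "d * m \<le> c" .
  qed
  have "d * (1 + s) \<le> 1 + d * s" using d by (simp add: algebra_simps)
  also have "\<dots> \<le> exp (d * s)" by simp
  finally have "(d * (1 + s)) powr m \<le> exp (d * s) powr m"
    using d assms by (intro powr_mono2) auto
  also have "\<dots> = exp (d * m * s)" by (simp add: exp_powr_real mult_ac)
  also have "\<dots> \<le> exp (c * s)" using d assms by (simp add: mult_right_mono)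
  finally have "d powr m * (1 + s) powr m \<le> exp (c * s)"
    using d assms by (simp add: powr_mult)
  then show ?thesis
    using d unfolding d_def[symmetric] by (simp add: powr_minus field_simps)
qed

text \<open>The power weight is replaced by its value at the boundary radius, for negative
  \<open>a\<close> by Peetre's inequality 1 + \<rho> \<le> (1 + r)(1 + \<rho> - r). Half of the
  exponential absorbs the polynomial loss in \<rho> - r.\<close>

lemma powr_exp_shell_integral:
  fixes a c :: real
  assumes c: "0 < c"
  shows "\<exists>C>0. \<forall>\<rho>\<ge>0. (\<integral>x. indicator (cball (0::real^'n::finite) \<rho>) x * ((1 + norm x) powr a * exp (- c * (\<rho> - norm x))) \<partial>lborel)
    \<le> C * (1 + \<rho>) powr (a + real CARD('n) - 1)"
proof -
  define B where "B = (min 1 (c / 2 / (\<bar>a\<bar> + 1))) powr (- \<bar>a\<bar>)"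
  have "0 < min 1 (c / 2 / (\<bar>a\<bar> + 1))" using c by simp
  then have B: "0 < B" unfolding B_def by (metis less_irrefl powr_gt_zero)
  obtain C where C: "C > 0" "\<And>\<rho>. 0 \<le> \<rho> \<Longrightarrow>
      (\<integral>x. indicator (cball (0::real^'n) \<rho>) x * exp (- (c / 2) * (\<rho> - norm x)) \<partial>lborel) \<le> C * (1 + \<rho>) powr (real CARD('n) - 1)"
    using exp_shell_integral[of "c / 2", where ?'n = 'n] c by auto
  show ?thesis
  proof (intro exI[of _ "B * C"] conjI allI impI)
    show "0 < B * C" using B C by simp
    fix \<rho> :: real assume \<rho>: "0 \<le> \<rho>"
    have pt: "(1 + r) powr a * exp (- c * (\<rho> - r)) \<le> B * (1 + \<rho>) powr a * exp (- (c / 2) * (\<rho> - r))"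
      if r: "0 \<le> r" "r \<le> \<rho>" for r
    proof -
      have "(1 + r) powr a \<le> (1 + \<rho>) powr a * (1 + (\<rho> - r)) powr \<bar>a\<bar>"
      proof (cases "0 \<le> a")
        case True
        have "(1 + r) powr a \<le> (1 + \<rho>) powr a * 1"
          using r True by (simp add: powr_mono2)
        also have "\<dots> \<le> (1 + \<rho>) powr a * (1 + (\<rho> - r)) powr \<bar>a\<bar>"
          using r by (intro mult_left_mono ge_one_powr_ge_zero) auto
        finally show ?thesis .
      next
        case False
        have "1 + \<rho> \<le> (1 + r) * (1 + (\<rho> - r))"
          using r mult_nonneg_nonneg[of r "\<rho> - r"] by (simp add: algebra_simps)
        then have "(1 + \<rho>) powr \<bar>a\<bar> \<le> ((1 + r) * (1 + (\<rho> - r))) powr \<bar>a\<bar>"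
          using \<rho> by (intro powr_mono2) auto
        also have "\<dots> = (1 + r) powr \<bar>a\<bar> * (1 + (\<rho> - r)) powr \<bar>a\<bar>"
          using r by (simp add: powr_mult)
        finally have "(1 + \<rho>) powr \<bar>a\<bar> \<le> (1 + r) powr \<bar>a\<bar> * (1 + (\<rho> - r)) powr \<bar>a\<bar>" .
        moreover have "(1 + r) powr a = 1 / (1 + r) powr \<bar>a\<bar>" "(1 + \<rho>) powr a = 1 / (1 + \<rho>) powr \<bar>a\<bar>"
          using False by (auto simp: powr_minus_divide[symmetric])
        moreover have "0 < (1 + r) powr \<bar>a\<bar>" "0 < (1 + \<rho>) powr \<bar>a\<bar>" using r by auto
        ultimately show ?thesis by (simp only:) (simp add: field_simps)
      qed
      also have "(1 + (\<rho> - r)) powr \<bar>a\<bar> \<le> B * exp (c / 2 * (\<rho> - r))"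
        unfolding B_def using powr_le_exp[of "c / 2" "\<bar>a\<bar>" "\<rho> - r"] c r by simp
      finally have "(1 + r) powr a \<le> (1 + \<rho>) powr a * (B * exp (c / 2 * (\<rho> - r)))"
        by (simp add: mult_left_mono)
      then have "(1 + r) powr a * exp (- c * (\<rho> - r)) \<le> (1 + \<rho>) powr a * (B * exp (c / 2 * (\<rho> - r))) * exp (- c * (\<rho> - r))"
        by (rule mult_right_mono) simp
      also have "\<dots> = B * (1 + \<rho>) powr a * (exp (c / 2 * (\<rho> - r)) * exp (- c * (\<rho> - r)))"
        by (simp only: mult_ac)
      also have "exp (c / 2 * (\<rho> - r)) * exp (- c * (\<rho> - r)) = exp (- (c / 2) * (\<rho> - r))"
        by (simp add: algebra_simps flip: exp_add)
      finally show ?thesis .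
    qed
    have "(\<integral>x. indicator (cball (0::real^'n) \<rho>) x * ((1 + norm x) powr a * exp (- c * (\<rho> - norm x))) \<partial>lborel)
       \<le> (\<integral>x. B * (1 + \<rho>) powr a * (indicator (cball (0::real^'n) \<rho>) x * exp (- (c / 2) * (\<rho> - norm x))) \<partial>lborel)"
    proof (rule integral_mono)
      have nz: "1 + norm x \<noteq> 0" for x :: "real^'n" using norm_ge_zero[of x] by linarith
      show "integrable lborel (\<lambda>x. indicator (cball (0::real^'n) \<rho>) x * ((1 + norm x) powr a * exp (- c * (\<rho> - norm x))))"
        using nz by (intro integrable_indicator_cball continuous_intros) auto
      show "integrable lborel (\<lambda>x. B * (1 + \<rho>) powr a * (indicator (cball (0::real^'n) \<rho>) x * exp (- (c / 2) * (\<rho> - norm x))))"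
        by (intro integrable_mult_right integrable_indicator_cball continuous_intros)
      show "indicator (cball (0::real^'n) \<rho>) x * ((1 + norm x) powr a * exp (- c * (\<rho> - norm x)))
        \<le> B * (1 + \<rho>) powr a * (indicator (cball (0::real^'n) \<rho>) x * exp (- (c / 2) * (\<rho> - norm x)))" for x
        using pt[of "norm x"] by (auto simp: indicator_def)
    qed
    also have "\<dots> = B * (1 + \<rho>) powr a * (\<integral>x. indicator (cball (0::real^'n) \<rho>) x * exp (- (c / 2) * (\<rho> - norm x)) \<partial>lborel)"
      by simp
    also have "\<dots> \<le> B * (1 + \<rho>) powr a * (C * (1 + \<rho>) powr (real CARD('n) - 1))"
      using C(2)[OF \<rho>] B by (intro mult_left_mono) auto
    also have "\<dots> = B * C * (1 + \<rho>) powr (a + real CARD('n) - 1)"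
      by (simp add: powr_add[symmetric] add_diff_eq)
    finally show "(\<integral>x. indicator (cball (0::real^'n) \<rho>) x * ((1 + norm x) powr a * exp (- c * (\<rho> - norm x))) \<partial>lborel)
      \<le> B * C * (1 + \<rho>) powr (a + real CARD('n) - 1)" .
  qed
qed

section \<open>Asymptotically Euclidean metrics\<close>

lemma jb_ge_1: "1 \<le> jb r"
  by (simp add: jb_def)

lemma jb_ge: "\<bar>r\<bar> \<le> jb r"
  unfolding jb_def by (intro real_le_rsqrt) simp

lemma abs_det_le:
  fixes A :: "real^'n^'n::finite"
  assumes "\<And>i j. \<bar>A $ i $ j\<bar> \<le> B"
  shows "\<bar>det A\<bar> \<le> (\<Sum>p | p permutes (UNIV::'n set). B ^ CARD('n))"
proof -
  have "\<bar>det A\<bar> \<le> (\<Sum>p | p permutes (UNIV::'n set). \<bar>of_int (sign p) * (\<Prod>i\<in>UNIV. A $ i $ p i)\<bar>)"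
    unfolding det_def by (rule sum_abs)
  also have "\<dots> \<le> (\<Sum>p | p permutes (UNIV::'n set). B ^ CARD('n))"
  proof (rule sum_mono)
    fix p
    have "\<bar>of_int (sign p) * (\<Prod>i\<in>UNIV. A $ i $ p i)\<bar> = (\<Prod>i\<in>UNIV. \<bar>A $ i $ p i\<bar>)"
      by (simp add: abs_mult abs_prod sign_def)
    also have "\<dots> \<le> (\<Prod>i\<in>(UNIV::'n set). B)"
      using assms by (intro prod_mono) auto
    finally show "\<bar>of_int (sign p) * (\<Prod>i\<in>UNIV. A $ i $ p i)\<bar> \<le> B ^ CARD('n)" by simp
  qed
  finally show ?thesis .
qed

locale asymp_euclidean_metric =
  fixes G :: "real^'n::finite \<Rightarrow> real^'n^'n" and K :: "real \<Rightarrow> real"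
  assumes AE_metric: "asymp_euclidean G K"
begin

lemma riem: "riem_metric G"
  using AE_metric by (simp add: asymp_euclidean_def)

text \<open>The radial coordinate of the metric g_1 in which both the light cone and the growth of
  the eigenfunction are expressed.\<close>

definition kap :: "real \<Rightarrow> real" where
  "kap r = integral {0..r} K"

lemma K_props:
  "\<exists>M\<ge>1. \<exists>r0\<ge>0. continuous_on {0..} K \<and> (\<forall>r\<ge>0. \<bar>K r\<bar> \<le> M) \<and> (\<forall>r\<ge>r0. 1 / 2 \<le> K r)"
proof -
  obtain \<rho> K1 C where \<rho>: "\<rho> > 0"
    and d: "\<And>r. 0 \<le> r \<Longrightarrow> (K has_real_derivative K1 r) (at r within {0..})"
    and b: "\<And>r. 0 \<le> r \<Longrightarrow> \<bar>K r - 1\<bar> \<le> C * jb r powr (- \<rho>)"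
    using AE_metric unfolding asymp_euclidean_def by blast
  have b': "\<bar>K r - 1\<bar> \<le> \<bar>C\<bar> * jb r powr (- \<rho>)" if "0 \<le> r" for r
    using b[OF that] by (smt (verit) mult_right_mono powr_ge_zero)
  \<comment> \<open>Large enough that \<open>\<bar>C\<bar> * r0 powr (- \<rho>) \<le> 1 / 2\<close>,
    so that \<open>K\<close> is at least 1/2 beyond it.\<close>
  define r0 where "r0 = (2 * \<bar>C\<bar> + 1) powr (1 / \<rho>)"
  have "continuous_on {0..} K" using d by (auto intro!: DERIV_continuous_on)
  moreover have "\<bar>K r\<bar> \<le> 1 + \<bar>C\<bar>" if "0 \<le> r" for r
    proof -
      have "jb r powr (- \<rho>) \<le> 1"
        using powr_mono[of "- \<rho>" 0 "jb r"] jb_ge_1[of r] \<rho> by simp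
      then have "\<bar>C\<bar> * jb r powr (- \<rho>) \<le> \<bar>C\<bar>" by (simp add: mult_left_le)
      then show ?thesis using b'[OF that] by linarith
    qed
  moreover have "1 / 2 \<le> K r" if "r0 \<le> r" for r
    proof -
      have r0: "0 < r0" by (simp add: r0_def add_pos_nonneg)
      then have "jb r powr (- \<rho>) \<le> r0 powr (- \<rho>)"
        using that jb_ge[of r] \<rho> by (intro powr_mono2') auto
      also have "r0 powr (- \<rho>) = 1 / (2 * \<bar>C\<bar> + 1)"
        using \<rho> by (simp add: r0_def powr_powr powr_minus_divide)
      finally have "\<bar>C\<bar> * jb r powr (- \<rho>) \<le> \<bar>C\<bar> * (1 / (2 * \<bar>C\<bar> + 1))"
        by (rule mult_left_mono) simp
      also have "\<dots> \<le> 1 / 2" by (simp add: field_simps)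
      finally show ?thesis using b'[of r] r0 that by linarith
    qed
  moreover have "1 \<le> 1 + \<bar>C\<bar>" "0 \<le> r0" by (simp_all add: r0_def)
  ultimately show ?thesis by blast
qed

text \<open>Far out the integrand is at least 1/2. On a fixed initial interval it may be negative,
  and what is lost there is the constant \<open>C\<close>.\<close>

lemma kap_props:
  "\<exists>M\<ge>1. \<exists>C\<ge>0. continuous_on {0..} kap \<and>
    (\<forall>r r'. 0 \<le> r \<longrightarrow> r \<le> r' \<longrightarrow> kap r' - kap r \<le> M * (r' - r)) \<and>
    (\<forall>r r'. 0 \<le> r \<longrightarrow> r \<le> r' \<longrightarrow> (r' - r) / 2 - C \<le> kap r' - kap r)"
proof -
  obtain M r0 where M: "M \<ge> 1" and r0: "r0 \<ge> 0" and c: "continuous_on {0..} K"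
    and bd: "\<And>r. 0 \<le> r \<Longrightarrow> \<bar>K r\<bar> \<le> M" and half: "\<And>r. r0 \<le> r \<Longrightarrow> 1 / 2 \<le> K r"
    using K_props by blast
  have Ki: "K integrable_on {r..r'}" if "0 \<le> r" for r r'
    using that by (intro integrable_continuous_interval continuous_on_subset[OF c]) auto
  have diff: "kap r' - kap r = integral {r..r'} K" if "0 \<le> r" "r \<le> r'" for r r'
    using Henstock_Kurzweil_Integration.integral_combine[of 0 r r' K] Ki[of 0 r'] that by (simp add: kap_def)
  have up: "\<bar>kap r' - kap r\<bar> \<le> M * (r' - r)" if r: "0 \<le> r" "r \<le> r'" for r r'
  proof -
    have "norm (integral {r..r'} K) \<le> integral {r..r'} (\<lambda>x. M)"
      using r bd by (intro integral_norm_bound_integral Ki) auto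
    then show ?thesis using diff[OF r] r by (simp add: mult.commute)
  qed
  have lo: "(r' - r) / 2 \<le> kap r' - kap r" if r: "r0 \<le> r" "r \<le> r'" for r r'
  proof -
    have "integral {r..r'} (\<lambda>x. 1 / 2) \<le> integral {r..r'} K"
      using r r0 half by (intro integral_le Ki) auto
    then show ?thesis using diff[of r r'] r r0 by simp
  qed
  have kap0: "kap 0 = 0" by (simp add: kap_def)
  have small: "\<bar>kap r - r / 2\<bar> \<le> (M + 1) * r0" if "0 \<le> r" "r \<le> r0" for r
  proof -
    have "\<bar>kap r - r / 2\<bar> \<le> M * r + r" using up[of 0 r] that kap0 by auto
    also have "\<dots> = (M + 1) * r" by (simp add: algebra_simps)
    also have "\<dots> \<le> (M + 1) * r0" using that M by (intro mult_left_mono) auto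
    finally show ?thesis .
  qed
  have low: "(r' - r) / 2 - 2 * ((M + 1) * r0) \<le> kap r' - kap r" if r: "0 \<le> r" "r \<le> r'" for r r'
  proof -
    have nn: "0 \<le> (M + 1) * r0" using M r0 by simp
    consider "r0 \<le> r" | "r' \<le> r0" | "r < r0" "r0 < r'" by linarith
    then show ?thesis
    proof cases
      case 1
      then show ?thesis using lo[of r r'] r nn by argo
    next
      case 2
      have "r \<le> r0" using 2 r by simp
      from small[OF r(1) this] small[of r'] 2 r show ?thesis by argo
    next
      case 3
      then show ?thesis using lo[of r0 r'] small[of r] small[of r0] r r0 by argo
    qed
  qed
  have "continuous_on {0..} kap"
    unfolding continuous_on_iff
  proof (intro ballI allI impI)
    fix x e :: real assume x: "x \<in> {0..}" and e: "0 < e"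
    show "\<exists>d>0. \<forall>y\<in>{0..}. dist y x < d \<longrightarrow> dist (kap y) (kap x) < e"
    proof (intro exI[of _ "e / M"] conjI ballI impI)
      show "0 < e / M" using e M by simp
      fix y :: real assume y: "y \<in> {0..}" "dist y x < e / M"
      have "\<bar>kap y - kap x\<bar> \<le> M * \<bar>y - x\<bar>"
        using up[of x y] up[of y x] x y by (cases "x \<le> y") (auto simp: abs_minus_commute)
      also have "\<dots> < e" using y M by (simp add: dist_real_def field_simps)
      finally show "dist (kap y) (kap x) < e" by (simp add: dist_real_def)
    qed
  qed
  moreover have "\<And>r r'. 0 \<le> r \<Longrightarrow> r \<le> r' \<Longrightarrow> kap r' - kap r \<le> M * (r' - r)"
    using up by (meson abs_le_D1)
  moreover have "0 \<le> 2 * ((M + 1) * r0)" using M r0 by simp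
  ultimately show ?thesis
    using M low by blast
qed

text \<open>The entries of \<open>G1\<close> are bounded because \<open>K\<close> is and |x_j x_k|
  \<le> |x|^2; the Leibniz formula then bounds the determinant. The origin is added by hand, as the
  metric estimates hold only away from it.\<close>

lemma vdens_bounded: "\<exists>V>0. \<forall>x. vdens G x \<le> V"
proof -
  obtain M where M: "M \<ge> 1" and bd: "\<And>r. 0 \<le> r \<Longrightarrow> \<bar>K r\<bar> \<le> M"
    using K_props by blast
  obtain \<rho> where \<rho>: "\<rho> > 0" and g: "\<And>j k. \<exists>C. \<forall>\<beta> x. length \<beta> \<le> 2 \<longrightarrow> x \<noteq> 0 \<longrightarrow>
       \<bar>pds \<beta> (\<lambda>y. G y $ j $ k - G1 K y $ j $ k) x\<bar> \<le> C * jb (norm x) powr (-\<rho> - 1 - real (length \<beta>))"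
    using AE_metric unfolding asymp_euclidean_def by blast
  have "\<exists>C. \<forall>x. x \<noteq> 0 \<longrightarrow> \<bar>G x $ j $ k - G1 K x $ j $ k\<bar> \<le> \<bar>C\<bar>" for j k
  proof -
    obtain C where C: "\<And>\<beta> x. length \<beta> \<le> 2 \<Longrightarrow> x \<noteq> 0 \<Longrightarrow>
       \<bar>pds \<beta> (\<lambda>y. G y $ j $ k - G1 K y $ j $ k) x\<bar> \<le> C * jb (norm x) powr (-\<rho> - 1 - real (length \<beta>))"
      using g[of j k] by blast
    have "\<bar>G x $ j $ k - G1 K x $ j $ k\<bar> \<le> \<bar>C\<bar>" if "x \<noteq> 0" for x
    proof -
      have "\<bar>G x $ j $ k - G1 K x $ j $ k\<bar> \<le> C * jb (norm x) powr (-\<rho> - 1)"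
        using C[of "[]" x] that by simp
      also have "\<dots> \<le> \<bar>C\<bar> * 1"
        using powr_mono[of "- \<rho> - 1" 0 "jb (norm x)"] jb_ge_1[of "norm x"] \<rho> by (intro mult_mono) auto
      finally show ?thesis by simp
    qed
    then show ?thesis by blast
  qed
  then obtain C where C: "\<And>j k x. x \<noteq> 0 \<Longrightarrow> \<bar>G x $ j $ k - G1 K x $ j $ k\<bar> \<le> \<bar>C j k\<bar>"
    by metis
  define B where "B = 1 + (M\<^sup>2 + 1) + (\<Sum>j\<in>UNIV. \<Sum>k\<in>UNIV. \<bar>C j k\<bar>)"
  have ent: "\<bar>G x $ j $ k\<bar> \<le> B" if x: "x \<noteq> 0" for x j k
  proof -
    have xx: "\<bar>x $ j * x $ k\<bar> \<le> (norm x)\<^sup>2"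
      unfolding abs_mult power2_eq_square by (intro mult_mono component_le_norm_cart) auto
    have "(K (norm x))\<^sup>2 \<le> M\<^sup>2"
      using bd[of "norm x"] M by (intro power2_le_iff_abs_le[THEN iffD2]) auto
    then have "\<bar>(K (norm x))\<^sup>2 - 1\<bar> \<le> M\<^sup>2 + 1"
      using zero_le_power2[of "K (norm x)"] by linarith
    then have "\<bar>((K (norm x))\<^sup>2 - 1) * (x $ j) * (x $ k) / (norm x)\<^sup>2\<bar> \<le> (M\<^sup>2 + 1) * (norm x)\<^sup>2 / (norm x)\<^sup>2"
      using xx unfolding abs_divide mult.assoc abs_mult[of "(K (norm x))\<^sup>2 - 1"] abs_power2
      by (intro divide_right_mono mult_mono) auto
    also have "\<dots> = M\<^sup>2 + 1" using x by simp
    finally have "\<bar>(if j = k then 1 else 0) + ((K (norm x))\<^sup>2 - 1) * (x $ j) * (x $ k) / (norm x)\<^sup>2\<bar> \<le> 1 + (M\<^sup>2 + 1)"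
      by (split if_split) linarith
    then have "\<bar>G1 K x $ j $ k\<bar> \<le> 1 + (M\<^sup>2 + 1)"
      unfolding G1_def by simp
    moreover have "\<bar>C j k\<bar> \<le> (\<Sum>k\<in>UNIV. \<bar>C j k\<bar>)" by (rule member_le_sum) auto
    moreover have "(\<Sum>k\<in>UNIV. \<bar>C j k\<bar>) \<le> (\<Sum>j\<in>UNIV. \<Sum>k\<in>UNIV. \<bar>C j k\<bar>)"
      by (rule member_le_sum) (auto simp: sum_nonneg)
    ultimately show ?thesis using C[OF x, of j k] unfolding B_def by linarith
  qed
  define D where "D = (\<Sum>p | p permutes (UNIV::'n set). B ^ CARD('n))"
  have "vdens G x \<le> max (vdens G 0) (sqrt D)" for x
  proof (cases "x = 0")
    case False
    have "\<bar>det (G x)\<bar> \<le> D" unfolding D_def by (rule abs_det_le[OF ent[OF False]])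
    then have "vdens G x \<le> sqrt D" unfolding vdens_def by (intro real_sqrt_le_mono) simp
    then show ?thesis by simp
  qed simp
  moreover have "0 < max (vdens G 0) (sqrt D)"
    using vdens_pos[OF riem, of 0] by simp
  ultimately show ?thesis by blast
qed

text \<open>\<open>\<rho> M\<close> is the radius beyond which the solution vanishes up to time \<open>M\<close>; \<open>kap\<close> need not be
  monotone near the origin.\<close>

lemma front_radius:
  "\<exists>\<rho> C. 1 \<le> C \<and> (\<forall>M::nat. 0 \<le> \<rho> M \<and> (\<forall>r t. \<rho> M \<le> r \<longrightarrow> t < real M \<longrightarrow> t + R1 < kap r) \<and>
     (\<forall>r. 0 \<le> r \<longrightarrow> r \<le> \<rho> M + 2 \<longrightarrow> kap r \<le> real M + C - (\<rho> M + 2 - r) / 2) \<and>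
     1 + (\<rho> M + 2) \<le> C * (1 + real M) \<and> 1 + real M \<le> C * (1 + (\<rho> M + 2)))"
proof -
  obtain M0 C where M0: "1 \<le> M0" and C: "0 \<le> C" and cont: "continuous_on {0..} kap"
    and up: "\<And>r r'. 0 \<le> r \<Longrightarrow> r \<le> r' \<Longrightarrow> kap r' - kap r \<le> M0 * (r' - r)"
    and lo: "\<And>r r'. 0 \<le> r \<Longrightarrow> r \<le> r' \<Longrightarrow> (r' - r) / 2 - C \<le> kap r' - kap r"
    using kap_props by blast
  have kap0: "kap 0 = 0" by (simp add: kap_def)
  \<comment> \<open>The slack \<open>C\<close> absorbs any later decrease of \<open>kap\<close>; the
    intermediate value theorem supplies the radius although \<open>kap\<close> need not be
    injective.\<close>
  have ex: "\<exists>r\<ge>0. kap r = real M + \<bar>R1\<bar> + C" for M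
  proof -
    define y where "y = real M + \<bar>R1\<bar> + C"
    have y: "0 \<le> y" using C by (simp add: y_def)
    have "y \<le> kap (2 * (y + C))" using lo[of 0 "2 * (y + C)"] y C kap0 by argo
    moreover have "continuous_on {0..2 * (y + C)} kap"
      by (rule continuous_on_subset[OF cont]) auto
    ultimately show ?thesis
      using IVT'[of kap 0 y "2 * (y + C)"] y C kap0 by (auto simp: y_def)
  qed
  then obtain \<rho> where \<rho>: "\<And>M. 0 \<le> \<rho> M" "\<And>M. kap (\<rho> M) = real M + \<bar>R1\<bar> + C" by metis
  define C' where "C' = \<bar>R1\<bar> + 4 * C + 2 * M0 + 2 * \<bar>R1\<bar> + 3"
  show ?thesis
  proof (intro exI[of _ \<rho>] exI[of _ C'] conjI allI impI)
    show "1 \<le> C'" using C M0 by (simp add: C'_def)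
    fix M :: nat
    show "0 \<le> \<rho> M" by (rule \<rho>)
    show "t + R1 < kap r" if "\<rho> M \<le> r" "t < real M" for r t
    proof -
      have "- C \<le> kap r - kap (\<rho> M)" using lo[of "\<rho> M" r] \<rho>(1)[of M] that by argo
      then show ?thesis using \<rho>(2)[of M] that by linarith
    qed
    show "kap r \<le> real M + C' - (\<rho> M + 2 - r) / 2" if "0 \<le> r" "r \<le> \<rho> M + 2" for r
    proof -
      have "(\<rho> M + 2 - r) / 2 - C \<le> kap (\<rho> M + 2) - kap r" using lo that by blast
      moreover have "kap (\<rho> M + 2) - kap (\<rho> M) \<le> M0 * 2" using up[of "\<rho> M" "\<rho> M + 2"] \<rho>(1) by simp
      moreover have "C' \<ge> \<bar>R1\<bar> + 2 * C + 2 * M0" using C by (simp add: C'_def)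
      ultimately show ?thesis using \<rho>(2)[of M] by argo
    qed
    have "\<rho> M / 2 - C \<le> real M + \<bar>R1\<bar> + C"
      using lo[of 0 "\<rho> M"] \<rho>[of M] kap0 by simp
    then have "1 + (\<rho> M + 2) \<le> C' + 2 * real M" using M0 by (simp add: C'_def)
    also have "\<dots> \<le> C' + C' * real M"
      using C M0 by (intro add_left_mono mult_right_mono) (auto simp: C'_def)
    finally show "1 + (\<rho> M + 2) \<le> C' * (1 + real M)" by (simp add: algebra_simps)
    have "real M \<le> M0 * \<rho> M"
      using up[of 0 "\<rho> M"] \<rho>[of M] kap0 C by simp
    also have "\<dots> \<le> C' * \<rho> M"
      using C M0 \<rho>(1) by (intro mult_right_mono) (auto simp: C'_def)
    finally show "1 + real M \<le> C' * (1 + (\<rho> M + 2))"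
      using C M0 by (simp add: algebra_simps) (simp add: C'_def)
  qed
qed

end

text \<open>Comparability is assumed in both directions because the sign of \<open>e\<close> is left
  open.\<close>

lemma powr_comparable:
  fixes x y C e :: real
  assumes "1 \<le> x" "1 \<le> y" "1 \<le> C" "x \<le> C * y" "y \<le> C * x"
  shows "x powr e \<le> C powr \<bar>e\<bar> * y powr e"
proof (cases "0 \<le> e")
  case True
  have "x powr e \<le> (C * y) powr e" using True assms by (intro powr_mono2) auto
  then show ?thesis using True assms by (simp add: powr_mult)
next
  case False
  have "(C * x) powr e \<le> y powr e" using False assms by (intro powr_mono2') auto
  then have "C powr e * x powr e \<le> y powr e" using assms by (simp add: powr_mult)
  then have "C powr \<bar>e\<bar> * (C powr e * x powr e) \<le> C powr \<bar>e\<bar> * y powr e"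
    by (rule mult_left_mono) simp
  moreover have "C powr \<bar>e\<bar> * C powr e = 1" using False assms by (simp flip: powr_add)
  ultimately show ?thesis by (simp add: mult.assoc[symmetric])
qed

section \<open>The eigenfunction and truncated volumes\<close>

lemma integrable_mult_compact_support:
  fixes f h :: "real^'n::finite \<Rightarrow> real"
  assumes f: "set_integrable lborel (cball 0 R) f" and h: "continuous_on UNIV h"
    and supp: "\<And>x. R < norm x \<Longrightarrow> h x = 0"
  shows "integrable lborel (\<lambda>x. f x * h x)"
proof -
  have "bounded (h ` cball 0 R)"
    by (intro compact_imp_bounded compact_continuous_image continuous_on_subset[OF h]) auto
  then obtain B where "\<forall>y\<in>h ` cball 0 R. norm y \<le> B"
    unfolding bounded_iff by blast
  then have B: "\<bar>h x\<bar> \<le> B" if "norm x \<le> R" for x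
    using that by simp
  have hm: "h \<in> borel_measurable lborel"
    using borel_measurable_continuous_onI[OF h] by simp
  have fi: "integrable lborel (\<lambda>x. indicator (cball 0 R) x * f x)"
    using f by (simp add: set_integrable_def)
  have "integrable lborel (\<lambda>x. (indicator (cball 0 R) x * f x) * h x)"
  proof (rule Bochner_Integration.integrable_bound)
    show "integrable lborel (\<lambda>x. \<bar>B\<bar> * (indicator (cball 0 R) x * f x))"
      using fi by simp
    show "(\<lambda>x. (indicator (cball 0 R) x * f x) * h x) \<in> borel_measurable lborel"
      using borel_measurable_integrable[OF fi] hm by (rule borel_measurable_times)
    show "AE x in lborel. norm ((indicator (cball 0 R) x * f x) * h x) \<le> norm (\<bar>B\<bar> * (indicator (cball 0 R) x * f x))"
    proof (rule AE_I2)
      fix x :: "real^'n"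
      show "norm ((indicator (cball 0 R) x * f x) * h x) \<le> norm (\<bar>B\<bar> * (indicator (cball 0 R) x * f x))"
      proof (cases "norm x \<le> R")
        case True
        then have "\<bar>f x\<bar> * \<bar>h x\<bar> \<le> \<bar>f x\<bar> * \<bar>B\<bar>"
          using B[OF True] by (intro mult_left_mono) auto
        then show ?thesis using True by (simp add: abs_mult mult.commute)
      qed simp
    qed
  qed
  moreover have "(\<lambda>x. (indicator (cball 0 R) x * f x) * h x) = (\<lambda>x. f x * h x)"
    using supp by (auto simp: fun_eq_iff indicator_def)
  ultimately show ?thesis by simp
qed

lemma integrable_continuous_compact_support:
  fixes h :: "real^'n::finite \<Rightarrow> real"
  assumes h: "continuous_on UNIV h" and supp: "\<And>x. R < norm x \<Longrightarrow> h x = 0"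
  shows "integrable lborel h"
proof -
  have "set_integrable lborel (cball (0::real^'n) R) (\<lambda>x. 1::real)"
    unfolding set_integrable_def using integrable_indicator_cball[of R "\<lambda>x::real^'n. 1::real"] by simp
  from integrable_mult_compact_support[OF this h supp] show ?thesis by simp
qed

lemma integral_pos_continuous:
  fixes h :: "real^'n::finite \<Rightarrow> real"
  assumes h: "continuous_on UNIV h" and supp: "\<And>x. R < norm x \<Longrightarrow> h x = 0"
    and nn: "\<And>x. 0 \<le> h x" and pos: "h x0 \<noteq> 0"
  shows "0 < (\<integral>x. h x \<partial>lborel)"
proof (rule ccontr)
  assume "\<not> 0 < (\<integral>x. h x \<partial>lborel)"
  then have "(\<integral>x. h x \<partial>lborel) = 0"
    using nn by (simp add: order_antisym integral_nonneg_AE)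
  then have ae: "AE x in lborel. h x = 0"
    using integral_nonneg_eq_0_iff_AE[OF integrable_continuous_compact_support[OF h supp]] nn by auto
  have op: "open {x. h x \<noteq> 0}"
    using h by (intro open_Collect_neq continuous_on_const)
  have "emeasure lborel {x. h x \<noteq> 0} = 0"
    using AE_iff_measurable[of "{x. h x \<noteq> 0}" lborel "\<lambda>x. h x = 0"] op ae by auto
  then have "negligible {x. h x \<noteq> 0}"
    using op by (simp add: negligible_iff_null_sets null_sets_completionI null_sets_def)
  then show False
    using open_not_negligible[OF op] pos by blast
qed

text \<open>Makes derivatives relative to [0, T) unique, also at the left endpoint; this identifies
  the derivatives obtained from different truncations.\<close>

lemma at_within_atLeastLessThan_neq_bot:
  fixes t T :: real
  assumes "t \<in> {0..<T}" shows "at t within {0..<T} \<noteq> bot"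
proof -
  have "t islimpt {t<..<T}" using assms by (intro islimpt_greaterThanLessThan1) auto
  then have "t islimpt {0..<T}" by (rule islimpt_subset) (use assms in auto)
  then show ?thesis by (simp add: trivial_limit_within)
qed

text \<open>Everything that is fixed before \<epsilon> and the solution, so constants built here are
  uniform. The assumptions on \<phi> come from \<open>hyp_H\<close> and the maximum principle is
  applied later; those on \<rho> and \<open>Cf\<close> come from
  \<open>front_radius\<close>.\<close>

locale blowup_setting = asymp_euclidean_metric G K + L1_damping b
  for G :: "real^'n::finite \<Rightarrow> real^'n^'n" and K b +
  fixes u0 u1 \<phi> :: "real^'n \<Rightarrow> real" and p q c1 c2 R0 R1 lam cphi Cf n :: real and \<rho> :: "nat \<Rightarrow> real"
  assumes n: "n = real CARD('n)" and p1: "1 < p" and q1: "1 < q" and c1: "0 \<le> c1" and c2: "0 \<le> c2"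
    and u0: "test_fun u0" "\<And>x. 0 \<le> u0 x" and u1: "test_fun u1" "\<And>x. 0 \<le> u1 x"
    and nontriv: "(\<exists>x. u0 x \<noteq> 0) \<or> (\<exists>x. u1 x \<noteq> 0)"
    and supp: "\<And>x. R0 < norm x \<Longrightarrow> u0 x = 0 \<and> u1 x = 0"
    and lam: "0 < lam" and cphi: "0 < cphi" and phi: "smooth_fun \<phi>" "\<And>x. 0 \<le> \<phi> x" "\<exists>x. \<phi> x \<noteq> 0"
    and phi_eq: "\<And>x. LB G \<phi> x = lam\<^sup>2 * \<phi> x"
    and phi_le: "\<And>x. \<phi> x \<le> cphi * jb (lam * norm x) powr (- (n - 1) / 2) * exp (lam * kap (norm x))"
    and Cf: "1 \<le> Cf" and \<rho>_nonneg: "\<And>M. 0 \<le> \<rho> M"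
    and front: "\<And>M r t. \<rho> M \<le> r \<Longrightarrow> t < real M \<Longrightarrow> t + R1 < kap r"
    and kap_front: "\<And>M r. 0 \<le> r \<Longrightarrow> r \<le> \<rho> M + 2 \<Longrightarrow> kap r \<le> real M + Cf - (\<rho> M + 2 - r) / 2"
    and \<rho>_comparable: "\<And>M. 1 + (\<rho> M + 2) \<le> Cf * (1 + real M)" "\<And>M. 1 + real M \<le> Cf * (1 + (\<rho> M + 2))"
begin

text \<open>The volume density cut off beyond the front at time \<open>M\<close>. A natural number
  as index leaves countably many truncations, whose null sets of times can be united.\<close>

definition vol :: "nat \<Rightarrow> real^'n \<Rightarrow> real" where
  "vol M x = cutoff (\<rho> M) x * vdens G x"

lemma phi_pos: "0 < \<phi> x"
  using strong_maximum_principle[OF riem phi(1,2) _ phi_eq] phi(3) by auto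

lemma continuous_phi: "continuous_on UNIV \<phi>"
  using phi(1) Ck_on_0 unfolding smooth_fun_def by blast

lemma continuous_vdens: "continuous_on UNIV (vdens G)"
  using Ck_on_vdens[OF riem, of 0] by (simp add: Ck_on_0)

lemma continuous_vol: "continuous_on UNIV (vol M)"
proof -
  have "continuous_on UNIV (cutoff (\<rho> M) :: real^'n \<Rightarrow> real)"
    using smooth_fun_cutoff Ck_on_0 unfolding smooth_fun_def by blast
  then show ?thesis
    unfolding vol_def[abs_def] by (intro continuous_intros continuous_vdens)
qed

lemma vol_nonneg: "0 \<le> vol M x"
  using vdens_pos[OF riem, of x] by (simp add: vol_def cutoff_nonneg)

lemma vol_eq_0: "\<rho> M + 2 < norm x \<Longrightarrow> vol M x = 0"
  by (simp add: vol_def cutoff_eq_0[OF \<rho>_nonneg])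

lemma integrable_vol:
  "continuous_on UNIV g \<Longrightarrow> integrable lborel (\<lambda>x. g x * vol M x)"
  by (rule integrable_continuous_compact_support[where R = "\<rho> M + 2"])
    (auto intro!: continuous_intros continuous_vol simp: vol_eq_0)

lemma continuous_phi_powr: "continuous_on UNIV (\<lambda>x. \<phi> x powr s)"
  using phi_pos by (intro continuous_intros continuous_phi) (metis less_irrefl)

lemma phi_powr_le:
  assumes "0 < s"
  shows "\<exists>C>0. \<forall>x. \<phi> x powr s \<le> C * ((1 + norm x) powr (- ((n - 1) * s / 2)) * exp (lam * s * kap (norm x)))"
proof -
  \<comment> \<open>Comes from min 1 lam (1 + r) \<le> 1 + lam r \<le> 2 jb (lam r).\<close>
  define m where "m = min 1 lam / 2"
  have m: "0 < m" using lam by (simp add: m_def)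
  define e where "e = (n - 1) / 2"
  have e: "0 \<le> e" by (simp add: e_def n Suc_leI)
  have jb: "m * (1 + r) \<le> jb (lam * r)" if "0 \<le> r" for r
  proof -
    have "min 1 lam * (1 + r) \<le> 1 + lam * r"
      using mult_right_mono[of "min 1 lam" lam r] that by (simp add: distrib_left)
    moreover have "1 + lam * r \<le> 2 * jb (lam * r)"
      using jb_ge_1[of "lam * r"] jb_ge[of "lam * r"] by linarith
    ultimately show ?thesis unfolding m_def by argo
  qed
  show ?thesis
  proof (intro exI[of _ "cphi powr s * m powr (- e * s)"] conjI allI)
    show "0 < cphi powr s * m powr (- e * s)" using cphi m by simp
    fix x :: "real^'n"
    have "jb (lam * norm x) powr (- e) \<le> (m * (1 + norm x)) powr (- e)"
      using jb[of "norm x"] m e by (intro powr_mono2' mult_pos_pos add_pos_nonneg) auto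
    then have "cphi * jb (lam * norm x) powr (- e) * exp (lam * kap (norm x)) \<le>
        cphi * (m * (1 + norm x)) powr (- e) * exp (lam * kap (norm x))"
      using cphi by (intro mult_right_mono mult_left_mono) auto
    moreover have "- (n - 1) / 2 = - e" unfolding e_def by (rule minus_divide_left[symmetric])
    ultimately have "\<phi> x \<le> cphi * (m * (1 + norm x)) powr (- e) * exp (lam * kap (norm x))"
      using phi_le[of x] by (simp only:)
    then have "\<phi> x powr s \<le> (cphi * (m * (1 + norm x)) powr (- e) * exp (lam * kap (norm x))) powr s"
      using phi(2) assms by (intro powr_mono2) auto
    also have "\<dots> = cphi powr s * m powr (- e * s) * ((1 + norm x) powr (- ((n - 1) * s / 2)) * exp (lam * s * kap (norm x)))"
    proof -
      have *: "- ((n - 1) * s / 2) = - e * s" by (simp add: e_def)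
      have "(cphi * (m * (1 + norm x)) powr (- e) * exp (lam * kap (norm x))) powr s
          = cphi powr s * ((m * (1 + norm x)) powr (- e)) powr s * exp (lam * kap (norm x)) powr s"
        using cphi by (simp add: powr_mult)
      also have "((m * (1 + norm x)) powr (- e)) powr s = m powr (- e * s) * (1 + norm x) powr (- e * s)"
        using m by (simp add: powr_mult powr_powr)
      also have "exp (lam * kap (norm x)) powr s = exp (lam * s * kap (norm x))"
        by (simp add: exp_powr_real mult.commute mult.left_commute)
      finally show ?thesis unfolding * by (simp only: mult.assoc)
    qed
    finally show "\<phi> x powr s \<le> cphi powr s * m powr (- e * s) * ((1 + norm x) powr (- ((n - 1) * s / 2)) * exp (lam * s * kap (norm x)))" .
  qed
qed

text \<open>An integer strictly above \<open>t\<close>, so that the cutoff is 1 on the support of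
  \<open>u t\<close>, and at most \<open>t + 1\<close>, so that bounds in the index become bounds in
  \<open>t\<close>.\<close>

definition ix :: "real \<Rightarrow> nat" where
  "ix t = nat \<lfloor>t\<rfloor> + 1"

lemma ix: assumes "0 \<le> t" shows "t < real (ix t)" "real (ix t) \<le> t + 1"
  using assms by (auto simp: ix_def) linarith+

lemma ix_powr:
  assumes "0 \<le> t" shows "(1 + real (ix t)) powr e \<le> 2 powr \<bar>e\<bar> * (1 + t) powr e"
  using ix[OF assms] assms by (intro powr_comparable) auto

text \<open>By \<open>kap_front\<close> the bound on \<phi> decays exponentially inward from the
  truncation radius, with peak of order exp(lam t). Up to constants only a boundary layer of bounded
  width counts: the power is -(n-1) s/2 from \<phi> plus n - 1 from the layer.\<close>

lemma phi_integral_le: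
  assumes s: "0 < s"
  shows "\<exists>C>0. \<forall>t\<ge>0. (\<integral>x. \<phi> x powr s * vol (ix t) x \<partial>lborel) \<le> C * (1 + t) powr ((n - 1) * (1 - s / 2)) * exp (lam * s * t)"
proof -
  obtain C1 where C1: "C1 > 0" "\<And>x. \<phi> x powr s \<le> C1 * ((1 + norm x) powr (- ((n - 1) * s / 2)) * exp (lam * s * kap (norm x)))"
    using phi_powr_le[OF s] by blast
  obtain V where V: "V > 0" "\<And>x. vdens G x \<le> V" using vdens_bounded by blast
  define a where "a = - ((n - 1) * s / 2)"
  define c where "c = lam * s / 2"
  have c: "0 < c" using lam s by (simp add: c_def)
  obtain C2 where C2: "C2 > 0" "\<And>r. 0 \<le> r \<Longrightarrow> (\<integral>x. indicator (cball (0::real^'n) r) x * ((1 + norm x) powr a * exp (- c * (r - norm x))) \<partial>lborel)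
      \<le> C2 * (1 + r) powr (a + n - 1)"
    using powr_exp_shell_integral[OF c, of a, where ?'n = 'n] unfolding n by blast
  define e where "e = (n - 1) * (1 - s / 2)"
  have ae: "a + n - 1 = e" by (simp add: a_def e_def algebra_simps)
  define C where "C = C1 * V * exp (lam * s * Cf) * C2 * Cf powr \<bar>e\<bar> * 2 powr \<bar>e\<bar> * exp (lam * s)"
  show ?thesis
  proof (intro exI[of _ C] conjI allI impI)
    show "0 < C" using C1 V C2 Cf by (simp add: C_def)
    fix t :: real assume t: "0 \<le> t"
    define M where "M = ix t"
    define r where "r = \<rho> M + 2"
    have r: "0 \<le> r" using \<rho>_nonneg[of M] by (simp add: r_def)
    have pt: "\<phi> x powr s * vol M x \<le> (C1 * V * exp (lam * s * (real M + Cf))) *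
        (indicator (cball (0::real^'n) r) x * ((1 + norm x) powr a * exp (- c * (r - norm x))))" for x
    proof (cases "norm x \<le> r")
      case False
      then show ?thesis by (simp add: vol_eq_0 r_def)
    next
      case True
      have "vol M x \<le> 1 * V"
        unfolding vol_def using V vdens_pos[OF riem, of x] by (intro mult_mono cutoff_le_1) auto
      have "lam * s * kap (norm x) \<le> lam * s * (real M + Cf - (r - norm x) / 2)"
        using kap_front[of "norm x" M] True lam s by (intro mult_left_mono) (auto simp: r_def)
      also have "\<dots> = lam * s * (real M + Cf) + - c * (r - norm x)"
        by (simp add: c_def field_simps)
      finally have ex: "exp (lam * s * kap (norm x)) \<le> exp (lam * s * (real M + Cf)) * exp (- c * (r - norm x))"
        by (simp flip: exp_add)
      have "\<phi> x powr s * vol M x \<le> (C1 * ((1 + norm x) powr a * exp (lam * s * kap (norm x)))) * V"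
        using C1 \<open>vol M x \<le> 1 * V\<close> vol_nonneg by (intro mult_mono) (auto simp: a_def)
      also have "\<dots> \<le> (C1 * ((1 + norm x) powr a * (exp (lam * s * (real M + Cf)) * exp (- c * (r - norm x))))) * V"
        using C1 V ex by (intro mult_right_mono mult_left_mono) auto
      finally show ?thesis using True by (simp add: mult_ac)
    qed
    have nz: "1 + norm x \<noteq> 0" for x :: "real^'n" using norm_ge_zero[of x] by linarith
    have "(\<integral>x. \<phi> x powr s * vol M x \<partial>lborel) \<le> (\<integral>x. (C1 * V * exp (lam * s * (real M + Cf))) *
        (indicator (cball (0::real^'n) r) x * ((1 + norm x) powr a * exp (- c * (r - norm x)))) \<partial>lborel)"
    proof (rule integral_mono[OF integrable_vol[OF continuous_phi_powr] _ pt])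
      show "integrable lborel (\<lambda>x. (C1 * V * exp (lam * s * (real M + Cf))) *
        (indicator (cball (0::real^'n) r) x * ((1 + norm x) powr a * exp (- c * (r - norm x)))))"
        using nz by (intro integrable_mult_right integrable_indicator_cball continuous_intros) auto
    qed
    also have "\<dots> = (C1 * V * exp (lam * s * (real M + Cf))) *
        (\<integral>x. indicator (cball (0::real^'n) r) x * ((1 + norm x) powr a * exp (- c * (r - norm x))) \<partial>lborel)"
      by (rule integral_mult_right_zero)
    also have "\<dots> \<le> (C1 * V * exp (lam * s * (real M + Cf))) * (C2 * (1 + r) powr e)"
      using C2(2)[OF r] C1 V unfolding ae by (intro mult_left_mono) auto
    also have "\<dots> \<le> (C1 * V * exp (lam * s * (t + 1 + Cf))) * (C2 * (Cf powr \<bar>e\<bar> * (2 powr \<bar>e\<bar> * (1 + t) powr e)))"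
    proof (intro mult_mono mult_left_mono)
      show "exp (lam * s * (real M + Cf)) \<le> exp (lam * s * (t + 1 + Cf))"
        using ix[OF t] lam s by (simp add: M_def)
      have "(1 + r) powr e \<le> Cf powr \<bar>e\<bar> * (1 + real M) powr e"
        using \<rho>_comparable[of M] Cf r by (intro powr_comparable) (auto simp: r_def)
      also have "\<dots> \<le> Cf powr \<bar>e\<bar> * (2 powr \<bar>e\<bar> * (1 + t) powr e)"
        using ix_powr[OF t] by (intro mult_left_mono) (auto simp: M_def)
      finally show "(1 + r) powr e \<le> Cf powr \<bar>e\<bar> * (2 powr \<bar>e\<bar> * (1 + t) powr e)" .
    qed (use C1 C2 V in auto)
    also have "\<dots> = C * (1 + t) powr e * exp (lam * s * t)"
      by (simp add: C_def algebra_simps exp_add)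
    finally show "(\<integral>x. \<phi> x powr s * vol (ix t) x \<partial>lborel) \<le> C * (1 + t) powr ((n - 1) * (1 - s / 2)) * exp (lam * s * t)"
      by (simp add: M_def e_def)
  qed
qed

lemma volume_le: "\<exists>C>0. \<forall>t\<ge>0. (\<integral>x. vol (ix t) x \<partial>lborel) \<le> C * (1 + t) powr n"
proof -
  obtain V where V: "V > 0" "\<And>x. vdens G x \<le> V" using vdens_bounded by blast
  define B where "B = unit_ball_vol n"
  have B: "0 < B" by (simp add: B_def n)
  show ?thesis
  proof (intro exI[of _ "V * B * Cf powr n * 2 powr n"] conjI allI impI)
    show "0 < V * B * Cf powr n * 2 powr n" using V B Cf by simp
    fix t :: real assume t: "0 \<le> t"
    define M where "M = ix t"
    define r where "r = \<rho> M + 2"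
    have r: "0 \<le> r" using \<rho>_nonneg[of M] by (simp add: r_def)
    have "(\<integral>x. 1 * vol M x \<partial>lborel) \<le> (\<integral>x. V * (indicator (cball (0::real^'n) r) x * 1) \<partial>lborel)"
    proof (rule integral_mono)
      show "integrable lborel (\<lambda>x. 1 * vol M x)" by (intro integrable_vol continuous_intros)
      show "integrable lborel (\<lambda>x. V * (indicator (cball (0::real^'n) r) x * 1))"
        by (intro integrable_mult_right integrable_indicator_cball continuous_intros)
      fix x :: "real^'n"
      have "vol M x \<le> 1 * V"
        unfolding vol_def using V vdens_pos[OF riem, of x] by (intro mult_mono cutoff_le_1) auto
      then show "1 * vol M x \<le> V * (indicator (cball (0::real^'n) r) x * 1)"
        by (cases "norm x \<le> r") (auto simp: vol_eq_0 r_def)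
    qed
    also have "\<dots> = V * (B * r ^ CARD('n))"
      using r by (simp add: content_cball B_def n)
    also have "\<dots> \<le> V * (B * (1 + r) powr n)"
    proof -
      have "r ^ CARD('n) \<le> (1 + r) ^ CARD('n)" using r by (intro power_mono) auto
      also have "\<dots> = (1 + r) powr n" using r by (simp add: powr_realpow n)
      finally show ?thesis using V B by (intro mult_left_mono) auto
    qed
    also have "(1 + r) powr n \<le> Cf powr \<bar>n\<bar> * (1 + real M) powr n"
      using \<rho>_comparable[of M] Cf r by (intro powr_comparable) (auto simp: r_def)
    also have "(1 + real M) powr n \<le> 2 powr \<bar>n\<bar> * (1 + t) powr n"
      using ix_powr[OF t] by (simp add: M_def)
    finally show "(\<integral>x. vol (ix t) x \<partial>lborel) \<le> V * B * Cf powr n * 2 powr n * (1 + t) powr n"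
      using V B by (simp add: M_def mult_left_mono mult.assoc n)
  qed
qed

end

section \<open>Pairings of a weak solution with test functions\<close>

locale weak_solution = blowup_setting G K b u0 u1 \<phi> p q c1 c2 R0 R1 lam cphi Cf n \<rho>
  for G :: "real^'n::finite \<Rightarrow> real^'n^'n" and K b u0 u1 \<phi> p q c1 c2 R0 R1 lam cphi Cf n \<rho> +
  fixes eps T :: real and u ut :: "real \<Rightarrow> real^'n \<Rightarrow> real"
  assumes eps: "0 < eps" and T: "0 < T" and ws: "weak_sol G b c1 c2 p q eps u0 u1 T u ut"
    and u_supp: "\<And>t x. t \<in> {0..<T} \<Longrightarrow> t + R1 < kap (norm x) \<Longrightarrow> u t x = 0"
begin

lemma u_outside: "t \<in> {0..<T} \<Longrightarrow> t < real M \<Longrightarrow> \<rho> M \<le> norm x \<Longrightarrow> u t x = 0"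
  using u_supp front by blast

definition pairing :: "(real^'n \<Rightarrow> real) \<Rightarrow> real \<Rightarrow> real" where
  "pairing g t = (\<integral>x. u t x * g x * vdens G x \<partial>lborel)"

text \<open>The test function \<open>g\<close> is truncated differently on each time interval \<open>{M - 1..<M}\<close>; the
  derivatives of the pairings obtained from different truncations agree where both make sense.\<close>

lemma pairing_equation:
  assumes g: "smooth_fun g" and eq: "\<And>x. LB G g x = \<mu> * g x"
  obtains U1 U2 where
    "\<And>t. t \<in> {0..<T} \<Longrightarrow> (pairing g has_real_derivative U1 t) (at t within {0..<T})"
    "\<And>t. t \<in> {0..<T} \<Longrightarrow> (U1 has_real_derivative U2 t) (at t within {0..<T})"
    "continuous_on {0..<T} U2"
    "pairing g 0 = eps * (\<integral>x. u0 x * g x * vdens G x \<partial>lborel)"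
    "U1 0 = eps * (\<integral>x. u1 x * g x * vdens G x \<partial>lborel)"
    "AE t in lborel. t \<in> {0..<T} \<longrightarrow> U1 t = (\<integral>x. ut t x * g x * vol (ix t) x \<partial>lborel) \<and>
      U2 t + b t * U1 t = \<mu> * pairing g t + c1 * (\<integral>x. \<bar>ut t x\<bar> powr p * g x * vol (ix t) x \<partial>lborel)
        + c2 * (\<integral>x. \<bar>u t x\<bar> powr q * g x * vol (ix t) x \<partial>lborel)"
proof -
  define \<psi> where "\<psi> M = (\<lambda>x. g x * cutoff (\<rho> M) x)" for M
  have test: "test_fun (\<psi> M)" for M
    unfolding \<psi>_def by (rule test_fun_mult_cutoff[OF g \<rho>_nonneg])
  define P where "P \<psi> U1 U2 \<longleftrightarrow>
           (\<forall>t\<in>{0..<T}.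
              ((\<lambda>s. \<integral>x. u s x * \<psi> x * vdens G x \<partial>lborel) has_real_derivative U1 t) (at t within {0..<T}) \<and>
              (U1 has_real_derivative U2 t) (at t within {0..<T})) \<and>
           continuous_on {0..<T} U2 \<and>
           continuous_on {0..<T} (\<lambda>t. \<integral>x. \<bar>u t x\<bar> powr q * \<psi> x * vdens G x \<partial>lborel) \<and>
           (AE t in lborel. t \<in> {0..<T} \<longrightarrow>
              U1 t = (\<integral>x. ut t x * \<psi> x * vdens G x \<partial>lborel)) \<and>
           (AE t in lborel. t \<in> {0..<T} \<longrightarrow>
              U2 t - (\<integral>x. u t x * LB G \<psi> x * vdens G x \<partial>lborel) + b t * U1 t
                = c1 * (\<integral>x. \<bar>ut t x\<bar> powr p * \<psi> x * vdens G x \<partial>lborel)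
                  + c2 * (\<integral>x. \<bar>u t x\<bar> powr q * \<psi> x * vdens G x \<partial>lborel)) \<and>
           (\<integral>x. u 0 x * \<psi> x * vdens G x \<partial>lborel) = eps * (\<integral>x. u0 x * \<psi> x * vdens G x \<partial>lborel) \<and>
           U1 0 = eps * (\<integral>x. u1 x * \<psi> x * vdens G x \<partial>lborel)" for \<psi> U1 U2
  have "\<forall>\<psi>. test_fun \<psi> \<longrightarrow> (\<exists>U1 U2. P \<psi> U1 U2)"
    using ws unfolding weak_sol_def P_def by (elim conjE)
  then have "\<forall>M. \<exists>U1 U2. P (\<psi> M) U1 U2"
    using test by blast
  then obtain V1 V2 where V: "\<And>M. P (\<psi> M) (V1 M) (V2 M)" by metis
  have d1: "\<And>M t. t \<in> {0..<T} \<Longrightarrow> ((\<lambda>s. \<integral>x. u s x * \<psi> M x * vdens G x \<partial>lborel) has_real_derivative V1 M t) (at t within {0..<T})"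
    and d2: "\<And>M t. t \<in> {0..<T} \<Longrightarrow> (V1 M has_real_derivative V2 M t) (at t within {0..<T})"
    and cV2: "\<And>M. continuous_on {0..<T} (V2 M)"
    and ae1: "\<And>M. AE t in lborel. t \<in> {0..<T} \<longrightarrow> V1 M t = (\<integral>x. ut t x * \<psi> M x * vdens G x \<partial>lborel)"
    and ae2: "\<And>M. AE t in lborel. t \<in> {0..<T} \<longrightarrow>
              V2 M t - (\<integral>x. u t x * LB G (\<psi> M) x * vdens G x \<partial>lborel) + b t * V1 M t
                = c1 * (\<integral>x. \<bar>ut t x\<bar> powr p * \<psi> M x * vdens G x \<partial>lborel)
                  + c2 * (\<integral>x. \<bar>u t x\<bar> powr q * \<psi> M x * vdens G x \<partial>lborel)"
    and i0: "\<And>M. (\<integral>x. u 0 x * \<psi> M x * vdens G x \<partial>lborel) = eps * (\<integral>x. u0 x * \<psi> M x * vdens G x \<partial>lborel)"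
    and i1: "\<And>M. V1 M 0 = eps * (\<integral>x. u1 x * \<psi> M x * vdens G x \<partial>lborel)"
    subgoal for M t using V[of M, unfolded P_def, THEN conjunct1] by blast
    subgoal for M t using V[of M, unfolded P_def, THEN conjunct1] by blast
    subgoal for M using V[of M, unfolded P_def, THEN conjunct2, THEN conjunct1] .
    subgoal for M using V[of M, unfolded P_def, THEN conjunct2, THEN conjunct2, THEN conjunct2, THEN conjunct1] .
    subgoal for M using V[of M, unfolded P_def, THEN conjunct2, THEN conjunct2, THEN conjunct2, THEN conjunct2, THEN conjunct1] .
    subgoal for M using V[of M, unfolded P_def, THEN conjunct2, THEN conjunct2, THEN conjunct2, THEN conjunct2, THEN conjunct2, THEN conjunct1] .
    subgoal for M using V[of M, unfolded P_def, THEN conjunct2, THEN conjunct2, THEN conjunct2, THEN conjunct2, THEN conjunct2, THEN conjunct2] .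
    done
  \<comment> \<open>Truncation causes no error here: \<open>u t\<close> vanishes wherever the cutoff
    differs from 1.\<close>
  have pair_eq: "(\<integral>x. u t x * \<psi> M x * vdens G x \<partial>lborel) = pairing g t" if "t \<in> {0..<T}" "t < real M" for t M
    unfolding pairing_def
  proof (rule Bochner_Integration.integral_cong[OF refl])
    fix x show "u t x * \<psi> M x * vdens G x = u t x * g x * vdens G x"
      using u_outside[OF that, of x] cutoff_eq_1[OF \<rho>_nonneg, of x M]
      by (cases "norm x \<le> \<rho> M") (auto simp: \<psi>_def)
  qed
  have LB_eq: "(\<integral>x. u t x * LB G (\<psi> M) x * vdens G x \<partial>lborel) = \<mu> * pairing g t"
    if "t \<in> {0..<T}" "t < real M" for t M
  proof -
    have "(\<integral>x. u t x * LB G (\<psi> M) x * vdens G x \<partial>lborel) = (\<integral>x. \<mu> * (u t x * g x * vdens G x) \<partial>lborel)"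
    proof (rule Bochner_Integration.integral_cong[OF refl])
      fix x show "u t x * LB G (\<psi> M) x * vdens G x = \<mu> * (u t x * g x * vdens G x)"
      proof (cases "norm x < \<rho> M")
        case False
        then show ?thesis using u_outside[OF that, of x] by simp
      next
        case True
        have "LB G (\<psi> M) x = LB G g x"
          by (rule LB_cong_open[OF riem open_ball, of _ 0 "\<rho> M"])
            (use True \<rho>_nonneg in \<open>auto simp: \<psi>_def cutoff_eq_1\<close>)
        then show ?thesis by (simp add: eq)
      qed
    qed
    then show ?thesis by (simp add: pairing_def)
  qed
  define U1 where "U1 t = V1 (ix t) t" for t
  define U2 where "U2 t = V2 (ix t) t" for t
  have dp: "(pairing g has_real_derivative V1 M t) (at t within {0..<T})" if t: "t \<in> {0..<T}" "t < real M" for t M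
  proof (rule has_field_derivative_transform_within[OF d1[OF t(1), of M], where d = "real M - t"])
    fix s assume "s \<in> {0..<T}" "dist s t < real M - t"
    then show "(\<integral>x. u s x * \<psi> M x * vdens G x \<partial>lborel) = pairing g s"
      by (intro pair_eq) (auto simp: dist_real_def)
  qed (use t in auto)
  have V1U1: "V1 M t = U1 t" if t: "t \<in> {0..<T}" "t < real M" for t M
    unfolding U1_def
    by (rule has_field_derivative_unique[OF dp[OF t] dp at_within_atLeastLessThan_neq_bot])
      (use t ix(1)[of t] in auto)
  have dU1: "(U1 has_real_derivative V2 M t) (at t within {0..<T})" if t: "t \<in> {0..<T}" "t < real M" for t M
  proof (rule has_field_derivative_transform_within[OF d2[OF t(1), of M], where d = "real M - t"])
    fix s assume "s \<in> {0..<T}" "dist s t < real M - t"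
    then show "V1 M s = U1 s"
      by (intro V1U1) (auto simp: dist_real_def)
  qed (use t in auto)
  have V2U2: "V2 M t = U2 t" if t: "t \<in> {0..<T}" "t < real M" for t M
    unfolding U2_def
    by (rule has_field_derivative_unique[OF dU1[OF t] dU1 at_within_atLeastLessThan_neq_bot])
      (use t ix(1)[of t] in auto)
  show thesis
  proof (rule that[of U1 U2])
    fix t assume t: "t \<in> {0..<T}"
    show "(pairing g has_real_derivative U1 t) (at t within {0..<T})"
      unfolding U1_def using t ix(1)[of t] by (intro dp) auto
    show "(U1 has_real_derivative U2 t) (at t within {0..<T})"
      unfolding U2_def using t ix(1)[of t] by (intro dU1) auto
  next
    show "continuous_on {0..<T} U2"
      unfolding continuous_on_eq_continuous_within
    proof
      fix t assume t: "t \<in> {0..<T}"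
      have "continuous (at t within {0..<T}) (V2 (ix t))"
        using cV2 t by (auto simp: continuous_on_eq_continuous_within)
      then show "continuous (at t within {0..<T}) U2"
      proof (rule continuous_transform_within[where \<delta> = "real (ix t) - t"])
        show "0 < real (ix t) - t" using ix(1)[of t] t by simp
        fix s assume "s \<in> {0..<T}" "dist s t < real (ix t) - t"
        then show "V2 (ix t) s = U2 s" by (intro V2U2) (auto simp: dist_real_def)
      qed (rule t)
    qed
  next
    \<comment> \<open>A truncation wide enough to contain the data: comparability of \<rho> M with
      \<open>M\<close> yields \<open>R0 \<le> \<rho> M\<close>.\<close>
    obtain M :: nat where M: "Cf * (1 + (R0 + 2)) < real M" "0 < M"
      using reals_Archimedean2[of "max 0 (Cf * (1 + (R0 + 2)))"] by auto
    have R: "R0 \<le> \<rho> M"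
    proof -
      have "Cf * (1 + (R0 + 2)) < Cf * (1 + (\<rho> M + 2))" using M(1) \<rho>_comparable(2)[of M] by linarith
      then show ?thesis using Cf by simp
    qed
    have cut: "v x * \<psi> M x * vdens G x = v x * g x * vdens G x" if "\<And>x. R0 < norm x \<Longrightarrow> v x = 0" for v :: "real^'n \<Rightarrow> real" and x
      using that[of x] cutoff_eq_1[OF \<rho>_nonneg, of x M] R by (cases "norm x \<le> R0") (auto simp: \<psi>_def)
    have z: "0 \<in> {0..<T}" "(0::real) < real M" using T M by auto
    show "pairing g 0 = eps * (\<integral>x. u0 x * g x * vdens G x \<partial>lborel)"
      using i0[of M] cut[of u0] supp unfolding pair_eq[OF z] by simp
    show "U1 0 = eps * (\<integral>x. u1 x * g x * vdens G x \<partial>lborel)"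
      using i1[of M] cut[of u1] supp unfolding V1U1[OF z] by simp
  next
    \<comment> \<open>The index \<open>ix t\<close> varies with \<open>t\<close>, so one null set
      has to serve all truncations.\<close>
    have "AE t in lborel. \<forall>M. t \<in> {0..<T} \<longrightarrow> V1 M t = (\<integral>x. ut t x * \<psi> M x * vdens G x \<partial>lborel)"
      unfolding AE_all_countable by (intro allI ae1)
    moreover have "AE t in lborel. \<forall>M. t \<in> {0..<T} \<longrightarrow>
              V2 M t - (\<integral>x. u t x * LB G (\<psi> M) x * vdens G x \<partial>lborel) + b t * V1 M t
                = c1 * (\<integral>x. \<bar>ut t x\<bar> powr p * \<psi> M x * vdens G x \<partial>lborel)
                  + c2 * (\<integral>x. \<bar>u t x\<bar> powr q * \<psi> M x * vdens G x \<partial>lborel)"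
      unfolding AE_all_countable by (intro allI ae2)
    ultimately show "AE t in lborel. t \<in> {0..<T} \<longrightarrow> U1 t = (\<integral>x. ut t x * g x * vol (ix t) x \<partial>lborel) \<and>
      U2 t + b t * U1 t = \<mu> * pairing g t + c1 * (\<integral>x. \<bar>ut t x\<bar> powr p * g x * vol (ix t) x \<partial>lborel)
        + c2 * (\<integral>x. \<bar>u t x\<bar> powr q * g x * vol (ix t) x \<partial>lborel)"
    proof eventually_elim
      case (elim t)
      show ?case
      proof
        assume t: "t \<in> {0..<T}"
        then have tM: "t < real (ix t)" using ix(1)[of t] by simp
        have reassoc: "w x * \<psi> (ix t) x * vdens G x = w x * g x * vol (ix t) x" for w :: "real^'n \<Rightarrow> real" and x
          by (simp add: \<psi>_def vol_def)
        have "V1 (ix t) t = (\<integral>x. ut t x * g x * vol (ix t) x \<partial>lborel)"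
          using elim(1)[rule_format, OF t, of "ix t"] reassoc[of "ut t"] by simp
        moreover have "V2 (ix t) t - \<mu> * pairing g t + b t * V1 (ix t) t
                = c1 * (\<integral>x. \<bar>ut t x\<bar> powr p * g x * vol (ix t) x \<partial>lborel)
                  + c2 * (\<integral>x. \<bar>u t x\<bar> powr q * g x * vol (ix t) x \<partial>lborel)"
          using elim(2)[rule_format, OF t, of "ix t"] LB_eq[OF t tM]
            reassoc[of "\<lambda>x. \<bar>ut t x\<bar> powr p"] reassoc[of "\<lambda>x. \<bar>u t x\<bar> powr q"] by simp
        ultimately show "U1 t = (\<integral>x. ut t x * g x * vol (ix t) x \<partial>lborel) \<and>
          U2 t + b t * U1 t = \<mu> * pairing g t + c1 * (\<integral>x. \<bar>ut t x\<bar> powr p * g x * vol (ix t) x \<partial>lborel)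
          + c2 * (\<integral>x. \<bar>u t x\<bar> powr q * g x * vol (ix t) x \<partial>lborel)"
          unfolding U1_def U2_def by argo
      qed
    qed
  qed
qed

text \<open>Fubini on boxes [0, T' k] times a ball, with T' k increasing to \<open>T\<close>.
  Countably many boxes give one null set of times, valid for every truncation and every continuous
  weight.\<close>

lemma ut_integrable:
  "AE t in lborel. t \<in> {0..<T} \<longrightarrow> (\<forall>M g. continuous_on UNIV g \<longrightarrow>
     integrable lborel (\<lambda>x. \<bar>ut t x\<bar> powr p * (g x * vol M x)))"
proof -
  define T' where "T' k = T - T / (real k + 1)" for k :: nat
  have T': "T' k \<in> {0..<T}" for k
    using T by (simp add: T'_def field_simps)
  have "AE t in lborel. integrable lborel (\<lambda>x. indicator ({0..T' k} \<times> cball (0::real^'n) (\<rho> M + 2)) (t, x) *\<^sub>R \<bar>ut t x\<bar> powr p)" for k M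
  proof -
    have "set_integrable (lborel \<Otimes>\<^sub>M lborel) ({0..T' k} \<times> cball (0::real^'n) (\<rho> M + 2)) (\<lambda>z. \<bar>ut (fst z) (snd z)\<bar> powr p)"
      using ws[unfolded weak_sol_def, THEN conjunct2, THEN conjunct1] T'[of k] compact_cball by blast
    then have "integrable (lborel \<Otimes>\<^sub>M lborel)
        (\<lambda>z. indicator ({0..T' k} \<times> cball (0::real^'n) (\<rho> M + 2)) z *\<^sub>R \<bar>ut (fst z) (snd z)\<bar> powr p)"
      by (simp add: set_integrable_def)
    from lborel_pair.AE_integrable_fst'[OF this] show ?thesis by simp
  qed
  then have "AE t in lborel. \<forall>k M. integrable lborel (\<lambda>x. indicator ({0..T' k} \<times> cball (0::real^'n) (\<rho> M + 2)) (t, x) *\<^sub>R \<bar>ut t x\<bar> powr p)"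
    unfolding AE_all_countable by blast
  then show ?thesis
  proof eventually_elim
    case (elim t)
    show ?case
    proof (intro impI allI)
      fix M and g :: "real^'n \<Rightarrow> real" assume t: "t \<in> {0..<T}" and g: "continuous_on UNIV g"
      obtain k :: nat where "T / (T - t) < real k" using reals_Archimedean2 by blast
      then have "t \<le> T' k"
        using t T by (simp add: T'_def field_simps)
      then have "indicator ({0..T' k} \<times> cball (0::real^'n) (\<rho> M + 2)) (t, x) = (indicator (cball (0::real^'n) (\<rho> M + 2)) x :: real)" for x
        using t by (auto simp: indicator_def)
      then have "set_integrable lborel (cball (0::real^'n) (\<rho> M + 2)) (\<lambda>x. \<bar>ut t x\<bar> powr p)"
        using elim[rule_format, of k M] by (simp add: set_integrable_def)
      then show "integrable lborel (\<lambda>x. \<bar>ut t x\<bar> powr p * (g x * vol M x))"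
        by (rule integrable_mult_compact_support)
          (auto intro!: continuous_intros g continuous_vol simp: vol_eq_0)
    qed
  qed
qed

lemma u_integrable:
  assumes "t \<in> {0..<T}" "continuous_on UNIV g"
  shows "integrable lborel (\<lambda>x. \<bar>u t x\<bar> powr q * (g x * vol M x))"
proof -
  have "set_integrable lborel (cball (0::real^'n) (\<rho> M + 2)) (\<lambda>x. \<bar>u t x\<bar> powr q)"
    using ws[unfolded weak_sol_def, THEN conjunct1] assms(1) compact_cball by blast
  then show ?thesis
    by (rule integrable_mult_compact_support)
      (auto intro!: continuous_intros assms(2) continuous_vol simp: vol_eq_0)
qed

lemma pairing_vol:
  assumes "t \<in> {0..<T}"
  shows "pairing g t = (\<integral>x. u t x * g x * vol (ix t) x \<partial>lborel)"
  unfolding pairing_def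
proof (rule Bochner_Integration.integral_cong[OF refl])
  have "t < real (ix t)" using ix(1)[of t] assms by simp
  then show "u t x * g x * vdens G x = u t x * g x * vol (ix t) x" for x
    using u_outside[OF assms, of "ix t" x] cutoff_eq_1[OF \<rho>_nonneg, of x "ix t"]
    by (cases "norm x \<le> \<rho> (ix t)") (auto simp: vol_def)
qed

end

section \<open>Constants chosen before the solution, and lower bounds for the nonlinear
  integrals\<close>

context blowup_setting
begin

text \<open>Selected from an existence statement that does not mention the solution; this is what
  makes the final constants independent of \<epsilon> and \<open>T\<close>.\<close>

definition phi_const :: "real \<Rightarrow> real" where
  "phi_const s = (SOME C. 0 < C \<and> (\<forall>t\<ge>0. (\<integral>x. \<phi> x powr s * vol (ix t) x \<partial>lborel) \<le>
     C * (1 + t) powr ((n - 1) * (1 - s / 2)) * exp (lam * s * t)))"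

definition vol_const :: real where
  "vol_const = (SOME C. 0 < C \<and> (\<forall>t\<ge>0. (\<integral>x. vol (ix t) x \<partial>lborel) \<le> C * (1 + t) powr n))"

definition late_time :: real where
  "late_time = (SOME t0. 0 \<le> t0 \<and> (\<forall>t\<ge>t0. late lam t))"

text \<open>The initial value of \<open>Y\<close> for the eigenfunction average, divided by
  \<epsilon>.\<close>

definition data_const :: real where
  "data_const = (\<integral>x. u1 x * \<phi> x * vdens G x \<partial>lborel) + lam * (\<integral>x. u0 x * \<phi> x * vdens G x \<partial>lborel)"

lemma phi_const:
  assumes "0 < s"
  shows "0 < phi_const s" "0 \<le> t \<Longrightarrow> (\<integral>x. \<phi> x powr s * vol (ix t) x \<partial>lborel) \<le>
     phi_const s * (1 + t) powr ((n - 1) * (1 - s / 2)) * exp (lam * s * t)"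
  using someI_ex[OF phi_integral_le[OF assms], folded phi_const_def] by auto

lemma vol_const:
  "0 < vol_const" "0 \<le> t \<Longrightarrow> (\<integral>x. vol (ix t) x \<partial>lborel) \<le> vol_const * (1 + t) powr n"
  using someI_ex[OF volume_le, folded vol_const_def] by auto

lemma late_time: "0 \<le> late_time" "late_time \<le> t \<Longrightarrow> late lam t"
  using someI_ex[OF eventually_late[OF lam], folded late_time_def] by auto

lemma data_nonneg:
  assumes "\<And>x. 0 \<le> g x"
  shows "0 \<le> (\<integral>x. u0 x * g x * vdens G x \<partial>lborel)" "0 \<le> (\<integral>x. u1 x * g x * vdens G x \<partial>lborel)"
  using u0(2) u1(2) assms vdens_pos[OF riem] by (auto intro!: integral_nonneg_AE simp: less_imp_le)

lemma data_pos:
  assumes g: "continuous_on UNIV g" "\<And>x. 0 < g x"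
  shows "\<exists>x. u0 x \<noteq> 0 \<Longrightarrow> 0 < (\<integral>x. u0 x * g x * vdens G x \<partial>lborel)"
    and "\<exists>x. u1 x \<noteq> 0 \<Longrightarrow> 0 < (\<integral>x. u1 x * g x * vdens G x \<partial>lborel)"
proof -
  have *: "0 < (\<integral>x. v x * g x * vdens G x \<partial>lborel)"
    if v: "test_fun v" "\<And>x. 0 \<le> v x" "\<And>x. R0 < norm x \<Longrightarrow> v x = 0" "\<exists>x. v x \<noteq> 0" for v
  proof -
    obtain x0 where x0: "v x0 \<noteq> 0" using v(4) by blast
    have cv: "continuous_on UNIV v"
      using v(1) Ck_on_0 unfolding test_fun_def smooth_fun_def by blast
    show ?thesis
    proof (rule integral_pos_continuous[where R = R0 and ?x0.0 = x0])
      show "continuous_on UNIV (\<lambda>x. v x * g x * vdens G x)"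
        by (intro continuous_intros cv g continuous_vdens)
      show "v x0 * g x0 * vdens G x0 \<noteq> 0"
        using x0 g(2)[of x0] vdens_pos[OF riem, of x0] by simp
      show "0 \<le> v x * g x * vdens G x" for x
        using v(2)[of x] g(2)[of x] vdens_pos[OF riem, of x] by simp
    qed (use v(3) in simp)
  qed
  show "\<exists>x. u0 x \<noteq> 0 \<Longrightarrow> 0 < (\<integral>x. u0 x * g x * vdens G x \<partial>lborel)"
    using u0 supp by (intro *) auto
  show "\<exists>x. u1 x \<noteq> 0 \<Longrightarrow> 0 < (\<integral>x. u1 x * g x * vdens G x \<partial>lborel)"
    using u1 supp by (intro *) auto
qed

lemma data_const_pos: "0 < data_const"
proof -
  have "0 \<le> (\<integral>x. u0 x * \<phi> x * vdens G x \<partial>lborel)" "0 \<le> (\<integral>x. u1 x * \<phi> x * vdens G x \<partial>lborel)"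
    using data_nonneg[OF phi(2)] by auto
  moreover have "0 < (\<integral>x. u0 x * \<phi> x * vdens G x \<partial>lborel) \<or> 0 < (\<integral>x. u1 x * \<phi> x * vdens G x \<partial>lborel)"
    using data_pos[OF continuous_phi phi_pos] nontriv by blast
  ultimately show ?thesis
    unfolding data_const_def using lam by (auto intro: add_pos_nonneg add_nonneg_pos)
qed

text \<open>Hoelder's inequality with the dual exponent s' = s/(s-1) on \<phi>. Since s' (1 - s) =
  -s, the power (1 - s'/2)(1 - s) becomes 1 - s/2 and the exponential becomes exp(-lam s t).\<close>

lemma phi_holder:
  assumes s: "1 < s" and t: "0 \<le> t" and f: "integrable lborel (\<lambda>x. \<bar>f x\<bar> powr s * vol (ix t) x)"
  shows "\<bar>\<integral>x. f x * \<phi> x * vol (ix t) x \<partial>lborel\<bar> powr s *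
      (phi_const (s / (s - 1)) powr (1 - s) * (1 + t) powr (- ((n - 1) * (s / 2 - 1))) * exp (- lam * s * t))
    \<le> (\<integral>x. \<bar>f x\<bar> powr s * vol (ix t) x \<partial>lborel)"
proof -
  define s' where "s' = s / (s - 1)"
  have s': "0 < s'" using s by (simp add: s'_def)
  define J where "J = (\<integral>x. \<phi> x powr s' * vol (ix t) x \<partial>lborel)"
  define X where "X = (\<integral>x. \<bar>f x\<bar> powr s * vol (ix t) x \<partial>lborel)"
  have X: "0 \<le> X" unfolding X_def using vol_nonneg by (auto intro!: integral_nonneg_AE)
  have J: "0 \<le> J" unfolding J_def using vol_nonneg by (auto intro!: integral_nonneg_AE)
  define E where "E = phi_const s' * (1 + t) powr ((n - 1) * (1 - s' / 2)) * exp (lam * s' * t)"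
  have E: "0 < E" using phi_const(1)[OF s'] t by (simp add: E_def)
  have "\<bar>\<integral>x. f x * \<phi> x * vol (ix t) x \<partial>lborel\<bar> powr s \<le> X * J powr (s - 1)"
    unfolding X_def J_def s'_def
    by (rule holder_weighted[OF s vol_nonneg phi(2) f]) (intro integrable_vol continuous_phi_powr)
  then have "\<bar>\<integral>x. f x * \<phi> x * vol (ix t) x \<partial>lborel\<bar> powr s * E powr (1 - s) \<le> X"
    using holder_divide[OF _ s X J _ E] phi_const(2)[OF s' t] by (simp add: J_def E_def)
  also have "E powr (1 - s) = phi_const s' powr (1 - s) * (1 + t) powr (- ((n - 1) * (s / 2 - 1))) * exp (- lam * s * t)"
  proof -
    have e1: "(n - 1) * (1 - s' / 2) * (1 - s) = - ((n - 1) * (s / 2 - 1))"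
      using s by (simp add: s'_def field_simps)
    have e2: "lam * s' * t * (1 - s) = - lam * s * t"
      using s by (simp add: s'_def field_simps)
    have "E powr (1 - s) = phi_const s' powr (1 - s) * ((1 + t) powr ((n - 1) * (1 - s' / 2))) powr (1 - s) * exp (lam * s' * t) powr (1 - s)"
      using phi_const(1)[OF s'] t unfolding E_def by (simp add: powr_mult)
    then show ?thesis by (simp only: powr_powr exp_powr_real e1 e2)
  qed
  finally show ?thesis by (simp only: X_def s'_def)
qed

text \<open>An average of size \<epsilon> exp(lam t), raised to the power \<open>s\<close>, exactly
  offsets the exponential in \<open>phi_holder\<close> and leaves a pure power of
  \<open>t\<close>.\<close>

lemma phi_source:
  fixes s t d eps :: real
  defines "a \<equiv> - ((n - 1) * (s / 2 - 1))"
  assumes s: "1 < s" and t: "1 \<le> t" and f: "integrable lborel (\<lambda>x. \<bar>f x\<bar> powr s * vol (ix t) x)"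
    and d: "0 < d" "0 < eps" "d * eps * exp (lam * t) \<le> \<bar>\<integral>x. f x * \<phi> x * vol (ix t) x \<partial>lborel\<bar>"
  shows "d powr s * phi_const (s / (s - 1)) powr (1 - s) * 2 powr (- \<bar>a\<bar>) * eps powr s * t powr a
    \<le> (\<integral>x. \<bar>f x\<bar> powr s * vol (ix t) x \<partial>lborel)"
proof -
  define X where "X = (\<integral>x. \<bar>f x\<bar> powr s * vol (ix t) x \<partial>lborel)"
  define P where "P = phi_const (s / (s - 1)) powr (1 - s)"
  define I where "I = \<bar>\<integral>x. f x * \<phi> x * vol (ix t) x \<partial>lborel\<bar>"
  have P: "0 \<le> P" by (simp add: P_def)
  have le: "I powr s * (P * (1 + t) powr a * exp (- lam * s * t)) \<le> X"
    unfolding X_def P_def a_def I_def using t by (intro phi_holder[OF s _ f]) simp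
  have "(d * eps) powr s * exp (lam * s * t) = (d * eps * exp (lam * t)) powr s"
    using d by (simp add: powr_mult exp_powr_real mult_ac)
  also have "\<dots> \<le> I powr s"
    using d s by (intro powr_mono2) (auto simp: I_def)
  finally have "((d * eps) powr s * exp (lam * s * t)) * (P * (1 + t) powr a * exp (- lam * s * t)) \<le> X"
    using P by (intro order_trans[OF mult_right_mono le]) auto
  moreover have "((d * eps) powr s * exp (lam * s * t)) * (P * (1 + t) powr a * exp (- lam * s * t))
     = d powr s * P * eps powr s * (1 + t) powr a * (exp (lam * s * t) * exp (- lam * s * t))"
    using d by (simp add: powr_mult)
  moreover have "exp (lam * s * t) * exp (- lam * s * t) = 1" by (simp flip: exp_add)
  ultimately have le2: "d powr s * P * eps powr s * (1 + t) powr a \<le> X" by (metis mult.right_neutral)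
  have "t powr a \<le> 2 powr \<bar>a\<bar> * (1 + t) powr a"
    using t by (intro powr_comparable) auto
  then have "2 powr (- \<bar>a\<bar>) * t powr a \<le> (1 + t) powr a"
    by (simp add: powr_minus field_simps)
  then have "d powr s * P * eps powr s * (2 powr (- \<bar>a\<bar>) * t powr a) \<le> d powr s * P * eps powr s * (1 + t) powr a"
    using P by (intro mult_left_mono) auto
  with le2 show ?thesis
    unfolding X_def[symmetric] P_def[symmetric] by (simp add: mult_ac)
qed

end

text \<open>\<open>weak_sol\<close> asserts only the existence of derivatives of the pairings.
  Naming them as parameters lets the theory of the differential inequality be instantiated twice,
  for \<phi> and for 1.\<close>

locale weak_solution_ode = weak_solution G K b u0 u1 \<phi> p q c1 c2 R0 R1 lam cphi Cf n \<rho> eps T u ut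
  for G :: "real^'n::finite \<Rightarrow> real^'n^'n" and K b u0 u1 \<phi> p q c1 c2 R0 R1 lam cphi Cf n \<rho> eps T u ut +
  fixes U1 U2 F1 F2 :: "real \<Rightarrow> real"
  assumes U_d1: "\<And>t. t \<in> {0..<T} \<Longrightarrow> (pairing \<phi> has_real_derivative U1 t) (at t within {0..<T})"
    and U_d2: "\<And>t. t \<in> {0..<T} \<Longrightarrow> (U1 has_real_derivative U2 t) (at t within {0..<T})"
    and U_c: "continuous_on {0..<T} U2"
    and U_0: "pairing \<phi> 0 = eps * (\<integral>x. u0 x * \<phi> x * vdens G x \<partial>lborel)"
    and U_1: "U1 0 = eps * (\<integral>x. u1 x * \<phi> x * vdens G x \<partial>lborel)"
    and U_eq: "AE t in lborel. t \<in> {0..<T} \<longrightarrow> U1 t = (\<integral>x. ut t x * \<phi> x * vol (ix t) x \<partial>lborel) \<and>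
      U2 t + b t * U1 t = lam\<^sup>2 * pairing \<phi> t + c1 * (\<integral>x. \<bar>ut t x\<bar> powr p * \<phi> x * vol (ix t) x \<partial>lborel)
        + c2 * (\<integral>x. \<bar>u t x\<bar> powr q * \<phi> x * vol (ix t) x \<partial>lborel)"
    and F_d1: "\<And>t. t \<in> {0..<T} \<Longrightarrow> (pairing (\<lambda>_. 1) has_real_derivative F1 t) (at t within {0..<T})"
    and F_d2: "\<And>t. t \<in> {0..<T} \<Longrightarrow> (F1 has_real_derivative F2 t) (at t within {0..<T})"
    and F_c: "continuous_on {0..<T} F2"
    and F_0: "pairing (\<lambda>_. 1) 0 = eps * (\<integral>x. u0 x * 1 * vdens G x \<partial>lborel)"
    and F_1: "F1 0 = eps * (\<integral>x. u1 x * 1 * vdens G x \<partial>lborel)"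
    and F_eq: "AE t in lborel. t \<in> {0..<T} \<longrightarrow> F1 t = (\<integral>x. ut t x * 1 * vol (ix t) x \<partial>lborel) \<and>
      F2 t + b t * F1 t = 0 * pairing (\<lambda>_. 1) t + c1 * (\<integral>x. \<bar>ut t x\<bar> powr p * 1 * vol (ix t) x \<partial>lborel)
        + c2 * (\<integral>x. \<bar>u t x\<bar> powr q * 1 * vol (ix t) x \<partial>lborel)"
begin

abbreviation "F \<equiv> pairing (\<lambda>_. 1)"

lemma nonlinear_nonneg:
  assumes "\<And>x. 0 \<le> g x"
  shows "0 \<le> (\<integral>x. \<bar>ut t x\<bar> powr p * g x * vol M x \<partial>lborel)" "0 \<le> (\<integral>x. \<bar>u t x\<bar> powr q * g x * vol M x \<partial>lborel)"
  using assms vol_nonneg by (auto intro!: integral_nonneg_AE)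

sublocale U: damped_ode b lam T "pairing \<phi>" U1 U2
proof
  show "0 \<le> lam" using lam by simp
  show "0 < T" by (rule T)
  show "0 \<le> pairing \<phi> 0" "0 \<le> U1 0" using U_0 U_1 data_nonneg[OF phi(2)] eps by auto
  show "0 < pairing \<phi> 0 \<or> 0 < U1 0"
    unfolding U_0 U_1 using data_pos[OF continuous_phi phi_pos] nontriv eps by (meson mult_pos_pos)
  show "AE t in lborel. t \<in> {0..<T} \<longrightarrow> lam\<^sup>2 * pairing \<phi> t \<le> U2 t + b t * U1 t"
    using U_eq
  proof eventually_elim
    case (elim t)
    show ?case
    proof
      assume t: "t \<in> {0..<T}"
      have "0 \<le> c1 * (\<integral>x. \<bar>ut t x\<bar> powr p * \<phi> x * vol (ix t) x \<partial>lborel)"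
        "0 \<le> c2 * (\<integral>x. \<bar>u t x\<bar> powr q * \<phi> x * vol (ix t) x \<partial>lborel)"
        using c1 c2 nonlinear_nonneg[OF phi(2)] by (auto intro!: mult_nonneg_nonneg)
      then show "lam\<^sup>2 * pairing \<phi> t \<le> U2 t + b t * U1 t"
        using elim[THEN mp, OF t, THEN conjunct2] by linarith
    qed
  qed
qed (use U_d1 U_d2 U_c in auto)

sublocale F: damped_ode0 b T F F1 F2
proof unfold_locales
  show "0 < T" by (rule T)
  show "0 \<le> F 0" "0 \<le> F1 0" using F_0 F_1 data_nonneg[of "\<lambda>_. 1"] eps by auto
  show "0 < F 0 \<or> 0 < F1 0"
    unfolding F_0 F_1 using data_pos[of "\<lambda>_. 1", OF continuous_on_const zero_less_one] nontriv eps
    by (meson mult_pos_pos)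
  show "AE t in lborel. t \<in> {0..<T} \<longrightarrow> 0\<^sup>2 * F t \<le> F2 t + b t * F1 t"
    using F_eq
  proof eventually_elim
    case (elim t)
    show ?case
    proof
      assume t: "t \<in> {0..<T}"
      have "0 \<le> c1 * (\<integral>x. \<bar>ut t x\<bar> powr p * 1 * vol (ix t) x \<partial>lborel)"
        "0 \<le> c2 * (\<integral>x. \<bar>u t x\<bar> powr q * 1 * vol (ix t) x \<partial>lborel)"
        using c1 c2 nonlinear_nonneg[of "\<lambda>_. 1"] by (auto intro!: mult_nonneg_nonneg)
      then show "0\<^sup>2 * F t \<le> F2 t + b t * F1 t"
        using elim[THEN mp, OF t, THEN conjunct2] by simp
    qed
  qed
qed (use F_d1 F_d2 F_c in auto)

lemma data_eps: "U1 0 + lam * pairing \<phi> 0 = eps * data_const"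
  by (simp add: U_0 U_1 data_const_def algebra_simps)

lemma U1_late:
  assumes t: "t \<in> {0..<T}" "late_time \<le> t"
  shows "data_const * exp (- damp_total) / 4 * eps * exp (lam * t) \<le> U1 t"
proof -
  have "eps * data_const \<le> U.Y t" using U.Y_ge[OF t(1)] data_eps by simp
  also have "\<dots> \<le> exp damp_total * exp (- lam * t) * (U1 t + lam * pairing \<phi> t)" by (rule U.Y_bounds(2)[OF t(1)])
  also have "\<dots> \<le> exp damp_total * exp (- lam * t) * (4 * U1 t)"
    using U.late_U1[OF t(1) late_time(2)[OF t(2)]] by (intro mult_left_mono) auto
  finally show ?thesis by (simp add: exp_minus field_simps)
qed

text \<open>\<open>U1_late\<close> integrated over the last unit of time, which accounts for
  \<open>late_time + 1\<close> and \<open>exp (- lam)\<close>.\<close>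

lemma U_late:
  assumes t: "t \<in> {0..<T}" "late_time + 1 \<le> t"
  shows "data_const * exp (- damp_total) / 4 * exp (- lam) * eps * exp (lam * t) \<le> pairing \<phi> t"
proof -
  define c where "c = data_const * exp (- damp_total) / 4"
  have c: "0 < c" using data_const_pos by (simp add: c_def)
  have "c * eps * exp (lam * (t - 1)) * (t - (t - 1)) \<le> pairing \<phi> t - pairing \<phi> (t - 1)"
  proof (rule U.U_diff_lower)
    fix r assume r: "r \<in> {t - 1..t}"
    have "c * eps * exp (lam * (t - 1)) \<le> c * eps * exp (lam * r)"
      using r lam c eps by (intro mult_left_mono) auto
    also have "\<dots> \<le> U1 r" unfolding c_def using r t late_time(1) by (intro U1_late) auto
    finally show "c * eps * exp (lam * (t - 1)) \<le> U1 r" .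
  qed (use t late_time(1) in auto)
  moreover have "0 \<le> pairing \<phi> (t - 1)" using t late_time(1) by (intro U.U_nonneg) auto
  moreover have "exp (lam * (t - 1)) = exp (- lam) * exp (lam * t)"
    by (simp add: algebra_simps flip: exp_add)
  ultimately show ?thesis by (simp add: c_def mult_ac)
qed

text \<open>Here Hoelder's inequality uses the weight \<phi> dvol and the function 1, so only the
  mass of \<phi> enters. Its bound (1+t)^((n-1)/2) exp(lam t), raised to 1 - p, is the
  coefficient.\<close>

lemma glassey_ineq:
  assumes "0 < c1"
  shows "AE t in lborel. t \<in> {0..<T} \<longrightarrow>
    lam\<^sup>2 * pairing \<phi> t + c1 * phi_const 1 powr (1 - p) * (1 + t) powr (- ((n - 1) * (p - 1) / 2)) *
      exp (- lam * (p - 1) * t) * U1 t powr p \<le> U2 t + b t * U1 t"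
  using U_eq ut_integrable
proof eventually_elim
  case (elim t)
  show ?case
  proof
    assume t: "t \<in> {0..<T}"
    then have t0: "0 \<le> t" by simp
    define X where "X = (\<integral>x. \<bar>ut t x\<bar> powr p * (\<phi> x * vol (ix t) x) \<partial>lborel)"
    define J where "J = (\<integral>x. \<phi> x * vol (ix t) x \<partial>lborel)"
    have phi1: "\<phi> x powr 1 = \<phi> x" for x using phi_pos[of x] by simp
    have wn: "0 \<le> \<phi> x * vol (ix t) x" for x using phi(2) vol_nonneg by simp
    have X: "0 \<le> X" and J: "0 \<le> J"
      unfolding X_def J_def using wn by (auto intro!: integral_nonneg_AE)
    define E where "E = phi_const 1 * (1 + t) powr ((n - 1) / 2) * exp (lam * t)"
    have E: "0 < E" using phi_const(1)[of 1] t by (simp add: E_def)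
    have "J \<le> E"
      using phi_const(2)[of 1 t] t0 unfolding phi1 J_def E_def by simp
    have "\<bar>\<integral>x. ut t x * 1 * (\<phi> x * vol (ix t) x) \<partial>lborel\<bar> powr p \<le>
        X * (\<integral>x. 1 powr (p / (p - 1)) * (\<phi> x * vol (ix t) x) \<partial>lborel) powr (p - 1)"
      unfolding X_def
    proof (rule holder_weighted[OF p1 wn])
      show "integrable lborel (\<lambda>x. \<bar>ut t x\<bar> powr p * (\<phi> x * vol (ix t) x))"
        using elim(2) t continuous_phi by blast
      show "integrable lborel (\<lambda>x. 1 powr (p / (p - 1)) * (\<phi> x * vol (ix t) x))"
        using integrable_vol[OF continuous_phi] by simp
    qed simp
    also have "(\<integral>x. 1 powr (p / (p - 1)) * (\<phi> x * vol (ix t) x) \<partial>lborel) = J" by (simp add: J_def)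
    also have "(\<integral>x. ut t x * 1 * (\<phi> x * vol (ix t) x) \<partial>lborel) = U1 t"
      using elim(1) t by (simp add: mult.assoc)
    finally have "U1 t powr p \<le> X * J powr (p - 1)" using U.U1_nonneg[OF t] by simp
    from holder_divide[OF this p1 X J \<open>J \<le> E\<close> E]
    have le: "E powr (1 - p) * U1 t powr p \<le> X" by (simp add: mult.commute)
    have "E powr (1 - p) = phi_const 1 powr (1 - p) * (1 + t) powr (- ((n - 1) * (p - 1) / 2)) * exp (- lam * (p - 1) * t)"
    proof -
      have e1: "(n - 1) / 2 * (1 - p) = - ((n - 1) * (p - 1) / 2)" by (simp add: field_simps)
      have e2: "lam * t * (1 - p) = - lam * (p - 1) * t" by (simp add: algebra_simps)
      have "E powr (1 - p) = phi_const 1 powr (1 - p) * ((1 + t) powr ((n - 1) / 2)) powr (1 - p) * exp (lam * t) powr (1 - p)"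
        using phi_const(1)[of 1] unfolding E_def by (simp add: powr_mult)
      then show ?thesis by (simp only: powr_powr exp_powr_real e1 e2)
    qed
    then have "c1 * phi_const 1 powr (1 - p) * (1 + t) powr (- ((n - 1) * (p - 1) / 2)) *
      exp (- lam * (p - 1) * t) * U1 t powr p = c1 * (E powr (1 - p) * U1 t powr p)"
      by (simp only: mult.assoc)
    also have "\<dots> \<le> c1 * X" using le assms by simp
    also have "\<dots> \<le> c1 * X + c2 * (\<integral>x. \<bar>u t x\<bar> powr q * \<phi> x * vol (ix t) x \<partial>lborel)"
      using c2 nonlinear_nonneg(2)[OF phi(2)] by simp
    also have "X = (\<integral>x. \<bar>ut t x\<bar> powr p * \<phi> x * vol (ix t) x \<partial>lborel)"
      by (simp only: X_def mult.assoc)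
    finally show "lam\<^sup>2 * pairing \<phi> t + c1 * phi_const 1 powr (1 - p) * (1 + t) powr (- ((n - 1) * (p - 1) / 2)) *
      exp (- lam * (p - 1) * t) * U1 t powr p \<le> U2 t + b t * U1 t"
      using elim(1)[THEN mp, OF t, THEN conjunct2] by linarith
  qed
qed

text \<open>Hoelder's inequality against the volume of the truncated cone, at most of order (1+t)^n;
  its power 1 - q is the coefficient.\<close>

lemma kato_ineq:
  assumes "0 < c2"
  shows "AE t in lborel. t \<in> {0..<T} \<longrightarrow>
    c2 * vol_const powr (1 - q) * (1 + t) powr (- (n * (q - 1))) * F t powr q \<le> F2 t + b t * F1 t"
  using F_eq
proof eventually_elim
  case (elim t)
  show ?case
  proof
    assume t: "t \<in> {0..<T}"
    then have t0: "0 \<le> t" by simp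
    define X where "X = (\<integral>x. \<bar>u t x\<bar> powr q * vol (ix t) x \<partial>lborel)"
    define J where "J = (\<integral>x. vol (ix t) x \<partial>lborel)"
    have X: "0 \<le> X" and J: "0 \<le> J"
      unfolding X_def J_def using vol_nonneg by (auto intro!: integral_nonneg_AE)
    define E where "E = vol_const * (1 + t) powr n"
    have E: "0 < E" using vol_const(1) t by (simp add: E_def)
    have "J \<le> E" using vol_const(2)[OF t0] by (simp add: J_def E_def)
    have "\<bar>\<integral>x. u t x * 1 * vol (ix t) x \<partial>lborel\<bar> powr q \<le>
        X * (\<integral>x. 1 powr (q / (q - 1)) * vol (ix t) x \<partial>lborel) powr (q - 1)"
      unfolding X_def
    proof (rule holder_weighted[OF q1 vol_nonneg])
      show "integrable lborel (\<lambda>x. \<bar>u t x\<bar> powr q * vol (ix t) x)"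
        using u_integrable[OF t, of "\<lambda>_. 1"] by simp
      show "integrable lborel (\<lambda>x. 1 powr (q / (q - 1)) * vol (ix t) x)"
        using integrable_vol[of "\<lambda>_. 1"] by simp
    qed simp
    also have "(\<integral>x. 1 powr (q / (q - 1)) * vol (ix t) x \<partial>lborel) = J" by (simp add: J_def)
    also have "(\<integral>x. u t x * 1 * vol (ix t) x \<partial>lborel) = F t"
      by (rule pairing_vol[OF t, symmetric])
    finally have "F t powr q \<le> X * J powr (q - 1)" using F.U_nonneg[OF t] by simp
    from holder_divide[OF this q1 X J \<open>J \<le> E\<close> E]
    have le: "E powr (1 - q) * F t powr q \<le> X" by (simp add: mult.commute)
    have "E powr (1 - q) = vol_const powr (1 - q) * (1 + t) powr (- (n * (q - 1)))"
    proof -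
      have e1: "n * (1 - q) = - (n * (q - 1))" by (simp add: algebra_simps)
      have "E powr (1 - q) = vol_const powr (1 - q) * ((1 + t) powr n) powr (1 - q)"
        using vol_const(1) unfolding E_def by (simp add: powr_mult)
      then show ?thesis by (simp only: powr_powr e1)
    qed
    then have "c2 * vol_const powr (1 - q) * (1 + t) powr (- (n * (q - 1))) * F t powr q = c2 * (E powr (1 - q) * F t powr q)"
      by (simp only: mult.assoc)
    also have "\<dots> \<le> c2 * X" using le assms by simp
    also have "\<dots> \<le> c1 * (\<integral>x. \<bar>ut t x\<bar> powr p * 1 * vol (ix t) x \<partial>lborel) + c2 * X"
      using c1 nonlinear_nonneg(1)[of "\<lambda>_. 1"] by simp
    finally show "c2 * vol_const powr (1 - q) * (1 + t) powr (- (n * (q - 1))) * F t powr q \<le> F2 t + b t * F1 t"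
      using elim[THEN mp, OF t, THEN conjunct2] by (simp add: X_def)
  qed
qed

text \<open>This couples the averages: \<open>U1_late\<close> bounds the pairing of u_t with \<phi>
  from below, and \<open>phi_source\<close> transfers the bound to the unweighted integral in the
  equation for \<open>F\<close>.\<close>

lemma source_from_ut:
  assumes "0 < c1"
  defines "a \<equiv> - ((n - 1) * (p / 2 - 1))"
  shows "AE t in lborel. t \<in> {0..<T} \<and> max 1 late_time \<le> t \<longrightarrow>
    c1 * (data_const * exp (- damp_total) / 4) powr p * phi_const (p / (p - 1)) powr (1 - p) * 2 powr (- \<bar>a\<bar>)
      * eps powr p * t powr a \<le> F2 t + b t * F1 t"
  using F_eq U_eq ut_integrable
proof eventually_elim
  case (elim t)
  show ?case
  proof
    assume "t \<in> {0..<T} \<and> max 1 late_time \<le> t"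
    then have t: "t \<in> {0..<T}" and t1: "1 \<le> t" "late_time \<le> t" by auto
    define d where "d = data_const * exp (- damp_total) / 4"
    have d: "0 < d" using data_const_pos by (simp add: d_def)
    define X where "X = (\<integral>x. \<bar>ut t x\<bar> powr p * vol (ix t) x \<partial>lborel)"
    have int: "integrable lborel (\<lambda>x. \<bar>ut t x\<bar> powr p * vol (ix t) x)"
    proof -
      have "integrable lborel (\<lambda>x. \<bar>ut t x\<bar> powr p * (1 * vol (ix t) x))"
        by (rule elim(3)[THEN mp, OF t, THEN spec[of _ "ix t"], THEN spec[of _ "\<lambda>_. 1"],
              THEN mp, OF continuous_on_const])
      then show ?thesis by simp
    qed
    have "d * eps * exp (lam * t) \<le> \<bar>\<integral>x. ut t x * \<phi> x * vol (ix t) x \<partial>lborel\<bar>"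
      using U1_late[OF t t1(2)] elim(2) t unfolding d_def[symmetric] by simp
    from phi_source[OF p1 t1(1) int d eps this]
    have "c1 * (d powr p * phi_const (p / (p - 1)) powr (1 - p) * 2 powr (- \<bar>a\<bar>) * eps powr p * t powr a) \<le> c1 * X"
      unfolding X_def a_def using c1 by (rule mult_left_mono)
    also have "\<dots> \<le> c1 * X + c2 * (\<integral>x. \<bar>u t x\<bar> powr q * 1 * vol (ix t) x \<partial>lborel)"
      using c2 nonlinear_nonneg(2)[of "\<lambda>_. 1"] by simp
    finally show "c1 * (data_const * exp (- damp_total) / 4) powr p * phi_const (p / (p - 1)) powr (1 - p) * 2 powr (- \<bar>a\<bar>)
      * eps powr p * t powr a \<le> F2 t + b t * F1 t"
      using elim(1)[THEN mp, OF t, THEN conjunct2] unfolding d_def[symmetric]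
      by (simp add: X_def mult_ac)
  qed
qed

lemma source_from_u:
  assumes "0 < c2"
  defines "a \<equiv> - ((n - 1) * (q / 2 - 1))"
  shows "AE t in lborel. t \<in> {0..<T} \<and> late_time + 1 \<le> t \<longrightarrow>
    c2 * (data_const * exp (- damp_total) / 4 * exp (- lam)) powr q * phi_const (q / (q - 1)) powr (1 - q) * 2 powr (- \<bar>a\<bar>)
      * eps powr q * t powr a \<le> F2 t + b t * F1 t"
  using F_eq
proof eventually_elim
  case (elim t)
  show ?case
  proof
    assume "t \<in> {0..<T} \<and> late_time + 1 \<le> t"
    then have t: "t \<in> {0..<T}" and t1: "1 \<le> t" "late_time + 1 \<le> t" using late_time(1) by auto
    define d where "d = data_const * exp (- damp_total) / 4 * exp (- lam)"
    have d: "0 < d" using data_const_pos by (simp add: d_def)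
    define X where "X = (\<integral>x. \<bar>u t x\<bar> powr q * vol (ix t) x \<partial>lborel)"
    have int: "integrable lborel (\<lambda>x. \<bar>u t x\<bar> powr q * vol (ix t) x)"
      using u_integrable[OF t, of "\<lambda>_. 1"] by simp
    have "d * eps * exp (lam * t) \<le> \<bar>\<integral>x. u t x * \<phi> x * vol (ix t) x \<partial>lborel\<bar>"
      using U_late[OF t t1(2)] pairing_vol[OF t, of \<phi>] unfolding d_def[symmetric] by simp
    from phi_source[OF q1 t1(1) int d eps this]
    have "c2 * (d powr q * phi_const (q / (q - 1)) powr (1 - q) * 2 powr (- \<bar>a\<bar>) * eps powr q * t powr a) \<le> c2 * X"
      unfolding X_def a_def using c2 by (rule mult_left_mono)
    also have "\<dots> \<le> c1 * (\<integral>x. \<bar>ut t x\<bar> powr p * 1 * vol (ix t) x \<partial>lborel) + c2 * X"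
      using c1 nonlinear_nonneg(1)[of "\<lambda>_. 1"] by simp
    finally show "c2 * (data_const * exp (- damp_total) / 4 * exp (- lam)) powr q * phi_const (q / (q - 1)) powr (1 - q) * 2 powr (- \<bar>a\<bar>)
      * eps powr q * t powr a \<le> F2 t + b t * F1 t"
      using elim(1)[THEN mp, OF t, THEN conjunct2] unfolding d_def[symmetric]
      by (simp add: X_def mult_ac)
  qed
qed

end

section \<open>Lifespan bounds\<close>

text \<open>For \<open>eps < 1\<close> and \<open>e \<le> 0\<close> the power is at least 1, so an
  alternative bound by a fixed time is absorbed into the constant.\<close>

lemma max_le_const_mult_powr:
  fixes X Y T eps e :: real
  assumes "T \<le> max X (Y * eps powr e)" "0 < eps" "eps < 1" "e \<le> 0" "0 \<le> X" "0 \<le> Y"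
  shows "T \<le> (X + Y + 1) * eps powr e"
proof -
  have "1 \<le> eps powr e"
    using powr_mono2'[of "- e" 0 eps] powr_mono'[of e 0 eps] assms by simp
  then have "X \<le> X * eps powr e" using assms(5) mult_left_mono[of 1 "eps powr e" X] by simp
  moreover have "0 \<le> X * eps powr e" "0 \<le> Y * eps powr e" "0 \<le> eps powr e" using assms by auto
  ultimately have "T \<le> X * eps powr e + Y * eps powr e + eps powr e" using assms(1) by linarith
  then show ?thesis by (simp add: distrib_right)
qed

lemma integral_powr_shift:
  fixes s t \<gamma> :: real
  assumes "0 \<le> s" "s \<le> t" "\<gamma> \<noteq> 1"
  shows "integral {s..t} (\<lambda>r. (1 + r) powr (- \<gamma>)) = ((1 + t) powr (1 - \<gamma>) - (1 + s) powr (1 - \<gamma>)) / (1 - \<gamma>)"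
proof -
  have "((\<lambda>r. (1 + r) powr (- \<gamma>)) has_integral (1 + t) powr (1 - \<gamma>) / (1 - \<gamma>) - (1 + s) powr (1 - \<gamma>) / (1 - \<gamma>)) {s..t}"
  proof (rule fundamental_theorem_of_calculus[OF assms(2)])
    fix r assume "r \<in> {s..t}"
    then have r: "0 < 1 + r" using assms by auto
    have "((\<lambda>r. 1 + r) has_real_derivative 1) (at r within {s..t})"
      by (auto intro!: derivative_eq_intros)
    from DERIV_cdivide[OF DERIV_chain2[OF has_real_derivative_powr[OF r, of "1 - \<gamma>"] this], of "1 - \<gamma>"]
    show "((\<lambda>r. (1 + r) powr (1 - \<gamma>) / (1 - \<gamma>)) has_vector_derivative (1 + r) powr (- \<gamma>)) (at r within {s..t})"
      using assms(3) by (simp flip: has_real_derivative_iff_has_vector_derivative)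
  qed
  then show ?thesis by (simp add: integral_unique diff_divide_distrib)
qed

lemma integral_inverse_shift:
  fixes s t :: real
  assumes "0 \<le> s" "s \<le> t"
  shows "integral {s..t} (\<lambda>r. (1 + r) powr (- 1)) = ln (1 + t) - ln (1 + s)"
proof -
  have "((\<lambda>r. (1 + r) powr (- 1)) has_integral ln (1 + t) - ln (1 + s)) {s..t}"
  proof (rule fundamental_theorem_of_calculus[OF assms(2)])
    fix r assume "r \<in> {s..t}"
    then have r: "0 < 1 + r" using assms by auto
    have "((\<lambda>r. ln (1 + r)) has_real_derivative (1 + r) powr (- 1)) (at r within {s..t})"
      using r by (auto intro!: derivative_eq_intros simp: powr_minus field_simps)
    then show "((\<lambda>r. ln (1 + r)) has_vector_derivative (1 + r) powr (- 1)) (at r within {s..t})"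
      by (simp flip: has_real_derivative_iff_has_vector_derivative)
  qed
  then show ?thesis by (rule integral_unique)
qed

context weak_solution
begin

lemma weak_solution_ode_exists:
  "\<exists>U1 U2 F1 F2. weak_solution_ode G K b u0 u1 \<phi> p q c1 c2 R0 R1 lam cphi Cf n \<rho> eps T u ut U1 U2 F1 F2"
proof -
  have s1: "smooth_fun (\<lambda>_::real^'n. 1::real)"
    by (simp add: smooth_fun_def Ck_on_const)
  have e1: "LB G (\<lambda>_::real^'n. 1::real) x = 0 * 1" for x
  proof -
    have "pd j (\<lambda>_::real^'n. c) = (\<lambda>_. 0)" for j and c :: real
      by (simp add: pd_def fun_eq_iff)
    then show ?thesis by (simp add: LB_def)
  qed
  show ?thesis
  proof (rule pairing_equation[OF phi(1) phi_eq], rule pairing_equation[OF s1 e1])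
    fix U1 U2 F1 F2
    assume *: "\<And>t. t \<in> {0..<T} \<Longrightarrow> (pairing \<phi> has_real_derivative U1 t) (at t within {0..<T})"
      "\<And>t. t \<in> {0..<T} \<Longrightarrow> (U1 has_real_derivative U2 t) (at t within {0..<T})"
      "continuous_on {0..<T} U2"
      "pairing \<phi> 0 = eps * (\<integral>x. u0 x * \<phi> x * vdens G x \<partial>lborel)"
      "U1 0 = eps * (\<integral>x. u1 x * \<phi> x * vdens G x \<partial>lborel)"
      "AE t in lborel. t \<in> {0..<T} \<longrightarrow> U1 t = (\<integral>x. ut t x * \<phi> x * vol (ix t) x \<partial>lborel) \<and>
        U2 t + b t * U1 t = lam\<^sup>2 * pairing \<phi> t + c1 * (\<integral>x. \<bar>ut t x\<bar> powr p * \<phi> x * vol (ix t) x \<partial>lborel)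
          + c2 * (\<integral>x. \<bar>u t x\<bar> powr q * \<phi> x * vol (ix t) x \<partial>lborel)"
      "\<And>t. t \<in> {0..<T} \<Longrightarrow> (pairing (\<lambda>_. 1) has_real_derivative F1 t) (at t within {0..<T})"
      "\<And>t. t \<in> {0..<T} \<Longrightarrow> (F1 has_real_derivative F2 t) (at t within {0..<T})"
      "continuous_on {0..<T} F2"
      "pairing (\<lambda>_. 1) 0 = eps * (\<integral>x. u0 x * 1 * vdens G x \<partial>lborel)"
      "F1 0 = eps * (\<integral>x. u1 x * 1 * vdens G x \<partial>lborel)"
      "AE t in lborel. t \<in> {0..<T} \<longrightarrow> F1 t = (\<integral>x. ut t x * 1 * vol (ix t) x \<partial>lborel) \<and>
        F2 t + b t * F1 t = 0 * pairing (\<lambda>_. 1) t + c1 * (\<integral>x. \<bar>ut t x\<bar> powr p * 1 * vol (ix t) x \<partial>lborel)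
          + c2 * (\<integral>x. \<bar>u t x\<bar> powr q * 1 * vol (ix t) x \<partial>lborel)"
    have "weak_solution_ode G K b u0 u1 \<phi> p q c1 c2 R0 R1 lam cphi Cf n \<rho> eps T u ut U1 U2 F1 F2"
      by unfold_locales (fact *)+
    then show ?thesis by blast
  qed
qed

end

section \<open>The lifespan bounds with constants uniform in the solution\<close>

context blowup_setting
begin

abbreviation "sol \<equiv> weak_solution_ode G K b u0 u1 \<phi> p q c1 c2 R0 R1 lam cphi Cf n \<rho>"

definition kato_const :: "real \<Rightarrow> real" where
  "kato_const \<theta> = (2 * exp damp_total * 3 powr (n * (q - 1)) / (c2 * vol_const powr (1 - q) * (1 - 2 powr ((1 - q) / 2))\<^sup>2)) powr (1 / \<theta>)"

lemma n_pos: "0 < n" by (simp add: n)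

lemma sol_kato:
  assumes s: "sol eps T u ut U1 U2 F1 F2" and c2': "0 < c2" and t1: "1 \<le> t1" and A: "0 < A"
    and \<theta>: "\<theta> = (q - 1) * \<alpha> - n * (q - 1) + 2" "0 < \<theta>"
    and lower: "\<And>t. t1 \<le> t \<Longrightarrow> t < T \<Longrightarrow> A * t powr \<alpha> \<le> weak_solution.pairing G u (\<lambda>_. 1) t"
  shows "T \<le> max (2 * t1) (2 * (kato_const \<theta> * A powr (- (q - 1) / \<theta>)))"
proof -
  interpret weak_solution_ode G K b u0 u1 \<phi> p q c1 c2 R0 R1 lam cphi Cf n \<rho> eps T u ut U1 U2 F1 F2 by (rule s)
  show ?thesis
    unfolding \<theta>(1) kato_const_def
    by (rule F.kato_lifespan[OF q1 _ _ _ t1 A kato_ineq[OF c2'] lower])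
      (use vol_const(1) c2' q1 n_pos \<theta> in auto)
qed

text \<open>A source of size \<epsilon>^m t^a makes \<open>F\<close> at least of size \<epsilon>^m
  t^(a+2) from time 4 t0 on, so Kato's bound applies with \<alpha> = a + 2 and A proportional to
  \<epsilon>^m. Twice the starting time gives the term \<open>8 * t0\<close>.\<close>

lemma sol_power_source:
  assumes c2': "0 < c2" and k: "0 < k" and t0: "1 \<le> t0" and m: "0 < m"
    and \<theta>: "\<theta> = (q - 1) * (a + 2) - n * (q - 1) + 2" "0 < \<theta>"
    and src: "\<And>eps T u ut U1 U2 F1 F2. sol eps T u ut U1 U2 F1 F2 \<Longrightarrow>
      AE t in lborel. t \<in> {0..<T} \<and> t0 \<le> t \<longrightarrow> k * eps powr m * t powr a \<le> F2 t + b t * F1 t"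
  shows "\<exists>C>0. \<forall>eps T u ut U1 U2 F1 F2. sol eps T u ut U1 U2 F1 F2 \<longrightarrow> eps < 1 \<longrightarrow>
    T \<le> C * eps powr (m * (- (q - 1) / \<theta>))"
proof -
  define c where "c = exp (- damp_total) * 2 powr (- \<bar>a\<bar>) * 2 powr (- \<bar>a + 1\<bar>) / 4"
  have c: "0 < c" by (simp add: c_def)
  define Y where "Y = 2 * (kato_const \<theta> * (c * k) powr (- (q - 1) / \<theta>))"
  have Y: "0 \<le> Y" by (simp add: Y_def kato_const_def)
  show ?thesis
  proof (intro exI[of _ "8 * t0 + Y + 1"] conjI allI impI)
    show "0 < 8 * t0 + Y + 1" using t0 Y by simp
    fix eps T u ut U1 U2 F1 F2
    assume s: "sol eps T u ut U1 U2 F1 F2" and e1: "eps < 1"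
    interpret weak_solution_ode G K b u0 u1 \<phi> p q c1 c2 R0 R1 lam cphi Cf n \<rho> eps T u ut U1 U2 F1 F2 by (rule s)
    have "T \<le> max (2 * (4 * t0)) (2 * (kato_const \<theta> * (c * (k * eps powr m)) powr (- (q - 1) / \<theta>)))"
    proof (rule sol_kato[OF s c2' _ _ \<theta>])
      fix t assume t: "4 * t0 \<le> t" "t < T"
      show "c * (k * eps powr m) * t powr (a + 2) \<le> F t"
        unfolding c_def using F.U_power_lower[OF _ _ src[OF s] t] t0 k by simp
    qed (use t0 c k eps in auto)
    also have "(c * (k * eps powr m)) powr (- (q - 1) / \<theta>) = (c * k) powr (- (q - 1) / \<theta>) * eps powr (m * (- (q - 1) / \<theta>))"
      using c k eps by (simp add: powr_mult powr_powr)
    also have "2 * (kato_const \<theta> * ((c * k) powr (- (q - 1) / \<theta>) * eps powr (m * (- (q - 1) / \<theta>)))) = Y * eps powr (m * (- (q - 1) / \<theta>))"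
      by (simp add: Y_def)
    finally have "T \<le> max (8 * t0) (Y * eps powr (m * (- (q - 1) / \<theta>)))" by simp
    then show "T \<le> (8 * t0 + Y + 1) * eps powr (m * (- (q - 1) / \<theta>))"
      by (rule max_le_const_mult_powr)
        (use eps e1 t0 Y m q1 \<theta>(2) in \<open>auto intro!: mult_nonneg_nonpos divide_nonpos_pos\<close>)
  qed
qed

text \<open>Here m = p, and 2 \<theta> is the denominator of the exponent; the third assumption is
  its positivity.\<close>

lemma lifespan_mixed:
  assumes "0 < c1" "0 < c2" "(q - 1) * ((n - 1) * p - 2) < 4"
  shows "\<exists>C>0. \<forall>eps T u ut U1 U2 F1 F2. sol eps T u ut U1 U2 F1 F2 \<longrightarrow> eps < 1 \<longrightarrow>
    T \<le> C * eps powr (- (2 * p * (q - 1)) / (2 * q + 2 - (n - 1) * p * (q - 1)))"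
proof -
  define a where "a = - ((n - 1) * (p / 2 - 1))"
  define \<theta> where "\<theta> = (q - 1) * (a + 2) - n * (q - 1) + 2"
  have th: "2 * \<theta> = 2 * q + 2 - (n - 1) * p * (q - 1)"
    by (simp add: \<theta>_def a_def field_simps)
  have "0 < 2 * \<theta>" unfolding th using assms(3) by (simp add: algebra_simps)
  then have \<theta>: "0 < \<theta>" by simp
  have ex: "p * (- (q - 1) / \<theta>) = - (2 * p * (q - 1)) / (2 * q + 2 - (n - 1) * p * (q - 1))"
    unfolding th[symmetric] using \<theta> by (simp add: field_simps)
  have "\<exists>C>0. \<forall>eps T u ut U1 U2 F1 F2. sol eps T u ut U1 U2 F1 F2 \<longrightarrow> eps < 1 \<longrightarrow>
    T \<le> C * eps powr (p * (- (q - 1) / \<theta>))"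
  proof (rule sol_power_source[OF assms(2) _ _ _ \<theta>_def \<theta>])
    fix eps T u ut U1 U2 F1 F2
    assume s: "sol eps T u ut U1 U2 F1 F2"
    interpret weak_solution_ode G K b u0 u1 \<phi> p q c1 c2 R0 R1 lam cphi Cf n \<rho> eps T u ut U1 U2 F1 F2 by (rule s)
    show "AE t in lborel. t \<in> {0..<T} \<and> max 1 late_time \<le> t \<longrightarrow>
      c1 * (data_const * exp (- damp_total) / 4) powr p * phi_const (p / (p - 1)) powr (1 - p) * 2 powr (- \<bar>a\<bar>)
      * eps powr p * t powr a \<le> F2 t + b t * F1 t"
      unfolding a_def by (rule source_from_ut[OF assms(1)])
  next
    show "0 < c1 * (data_const * exp (- damp_total) / 4) powr p * phi_const (p / (p - 1)) powr (1 - p) * 2 powr (- \<bar>a\<bar>)"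
      using assms(1) data_const_pos phi_const(1)[of "p / (p - 1)"] p1 by simp
  qed (use p1 in auto)
  then show ?thesis unfolding ex .
qed

text \<open>Here m = q, and the Strauss polynomial equals -2 \<theta>.\<close>

lemma lifespan_strauss:
  assumes "0 < c2" "(n - 1) * q\<^sup>2 - (n + 1) * q - 2 < 0"
  shows "\<exists>C>0. \<forall>eps T u ut U1 U2 F1 F2. sol eps T u ut U1 U2 F1 F2 \<longrightarrow> eps < 1 \<longrightarrow>
    T \<le> C * eps powr ((2 * q * (q - 1)) / ((n - 1) * q\<^sup>2 - (n + 1) * q - 2))"
proof -
  define a where "a = - ((n - 1) * (q / 2 - 1))"
  define \<theta> where "\<theta> = (q - 1) * (a + 2) - n * (q - 1) + 2"
  have th: "(n - 1) * q\<^sup>2 - (n + 1) * q - 2 = - (2 * \<theta>)"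
    by (simp add: \<theta>_def a_def field_simps power2_eq_square)
  have \<theta>: "0 < \<theta>" using assms(2) unfolding th by simp
  have ex: "q * (- (q - 1) / \<theta>) = (2 * q * (q - 1)) / ((n - 1) * q\<^sup>2 - (n + 1) * q - 2)"
    unfolding th using \<theta> by (simp add: field_simps)
  have "\<exists>C>0. \<forall>eps T u ut U1 U2 F1 F2. sol eps T u ut U1 U2 F1 F2 \<longrightarrow> eps < 1 \<longrightarrow>
    T \<le> C * eps powr (q * (- (q - 1) / \<theta>))"
  proof (rule sol_power_source[OF assms(1) _ _ _ \<theta>_def \<theta>])
    fix eps T u ut U1 U2 F1 F2
    assume s: "sol eps T u ut U1 U2 F1 F2"
    interpret weak_solution_ode G K b u0 u1 \<phi> p q c1 c2 R0 R1 lam cphi Cf n \<rho> eps T u ut U1 U2 F1 F2 by (rule s)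
    show "AE t in lborel. t \<in> {0..<T} \<and> late_time + 1 \<le> t \<longrightarrow>
      c2 * (data_const * exp (- damp_total) / 4 * exp (- lam)) powr q * phi_const (q / (q - 1)) powr (1 - q) * 2 powr (- \<bar>a\<bar>)
      * eps powr q * t powr a \<le> F2 t + b t * F1 t"
      unfolding a_def by (rule source_from_u[OF assms(1)])
  next
    show "0 < c2 * (data_const * exp (- damp_total) / 4 * exp (- lam)) powr q * phi_const (q / (q - 1)) powr (1 - q) * 2 powr (- \<bar>a\<bar>)"
      using assms(1) data_const_pos phi_const(1)[of "q / (q - 1)"] q1 by simp
  qed (use q1 late_time(1) in auto)
  then show ?thesis unfolding ex .
qed

text \<open>The linear growth F \<ge> k \<epsilon> t caused by a nonzero \<open>u1\<close> replaces
  the source; \<alpha> = 1 and n = 2 give \<theta> = 3 - q.\<close>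

lemma lifespan_2d:
  assumes "0 < c2" "n = 2" "q < 2" "\<exists>x. u1 x \<noteq> 0"
  shows "\<exists>C>0. \<forall>eps T u ut U1 U2 F1 F2. sol eps T u ut U1 U2 F1 F2 \<longrightarrow> eps < 1 \<longrightarrow>
    T \<le> C * eps powr (- (q - 1) / (3 - q))"
proof -
  define k where "k = exp (- damp_total) * (\<integral>x. u1 x * 1 * vdens G x \<partial>lborel)"
  have k: "0 < k"
    unfolding k_def using data_pos(2)[of "\<lambda>_. 1", OF continuous_on_const zero_less_one assms(4)]
    by (intro mult_pos_pos) auto
  have \<theta>: "3 - q = (q - 1) * 1 - n * (q - 1) + 2" "0 < 3 - q"
    using assms by (auto simp: algebra_simps)
  define Y where "Y = 2 * (kato_const (3 - q) * k powr (- (q - 1) / (3 - q)))"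
  have Y: "0 \<le> Y" by (simp add: Y_def kato_const_def)
  show ?thesis
  proof (intro exI[of _ "2 + Y + 1"] conjI allI impI)
    show "0 < 2 + Y + 1" using Y by simp
    fix eps T u ut U1 U2 F1 F2
    assume s: "sol eps T u ut U1 U2 F1 F2" and e1: "eps < 1"
    interpret weak_solution_ode G K b u0 u1 \<phi> p q c1 c2 R0 R1 lam cphi Cf n \<rho> eps T u ut U1 U2 F1 F2 by (rule s)
    have "T \<le> max (2 * 1) (2 * (kato_const (3 - q) * (k * eps) powr (- (q - 1) / (3 - q))))"
    proof (rule sol_kato[OF s assms(1) _ _ \<theta>])
      fix t :: real assume t: "1 \<le> t" "t < T"
      show "k * eps * t powr 1 \<le> F t"
        using F.U_linear_lower[of t] t F_1 by (simp add: k_def mult_ac)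
    qed (use k eps in auto)
    also have "(k * eps) powr (- (q - 1) / (3 - q)) = k powr (- (q - 1) / (3 - q)) * eps powr (- (q - 1) / (3 - q))"
      using k eps by (simp add: powr_mult)
    also have "2 * (kato_const (3 - q) * (k powr (- (q - 1) / (3 - q)) * eps powr (- (q - 1) / (3 - q)))) = Y * eps powr (- (q - 1) / (3 - q))"
      by (simp add: Y_def)
    finally have "T \<le> max 2 (Y * eps powr (- (q - 1) / (3 - q)))" by simp
    then show "T \<le> (2 + Y + 1) * eps powr (- (q - 1) / (3 - q))"
      by (rule max_le_const_mult_powr)
        (use eps e1 Y q1 assms(3) in \<open>auto intro!: divide_nonpos_pos\<close>)
  qed
qed

definition glassey_const :: real where
  "glassey_const = (p - 1) * (c1 * phi_const 1 powr (1 - p) * (4 * exp damp_total) powr (- p))"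

lemma glassey_const_pos: "0 < c1 \<Longrightarrow> 0 < glassey_const"
  using p1 phi_const(1)[of 1] by (simp add: glassey_const_def)

lemma sol_glassey:
  assumes s: "sol eps T u ut U1 U2 F1 F2" and c1': "0 < c1" and t: "late_time \<le> t" "t < T"
  shows "integral {late_time..t} (\<lambda>r. (1 + r) powr (- ((n - 1) * (p - 1) / 2))) \<le>
    data_const powr (1 - p) / glassey_const * eps powr (1 - p)"
proof -
  interpret weak_solution_ode G K b u0 u1 \<phi> p q c1 c2 R0 R1 lam cphi Cf n \<rho> eps T u ut U1 U2 F1 F2 by (rule s)
  have "(p - 1) * (c1 * phi_const 1 powr (1 - p) * (4 * exp damp_total) powr (- p) *
      integral {late_time..t} (\<lambda>r. (1 + r) powr (- ((n - 1) * (p - 1) / 2)))) \<le> (eps * data_const) powr (1 - p)"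
    by (rule U.glassey_bound[OF p1 _ late_time _ _ glassey_ineq[OF c1'] t])
      (use c1' phi_const(1)[of 1] eps data_const_pos data_eps in auto)
  moreover have "(eps * data_const) powr (1 - p) = data_const powr (1 - p) * eps powr (1 - p)"
    using eps data_const_pos by (simp add: powr_mult)
  ultimately have "glassey_const * integral {late_time..t} (\<lambda>r. (1 + r) powr (- ((n - 1) * (p - 1) / 2))) \<le>
      data_const powr (1 - p) * eps powr (1 - p)"
    by (simp add: glassey_const_def mult.assoc)
  then show ?thesis
    using glassey_const_pos[OF c1'] by (simp add: field_simps)
qed

text \<open>The integral of the weight grows like t^(1-\<gamma>) but is at most of order
  \<epsilon>^(1-p); taking the root yields the exponent (1-p)/(1-\<gamma>).\<close>

lemma lifespan_glassey_subcritical: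
  assumes c1': "0 < c1" and sub: "(n - 1) * (p - 1) < 2"
  shows "\<exists>C>0. \<forall>eps T u ut U1 U2 F1 F2. sol eps T u ut U1 U2 F1 F2 \<longrightarrow> eps < 1 \<longrightarrow>
    T \<le> C * eps powr (- (2 * (p - 1)) / (2 - (n - 1) * (p - 1)))"
proof -
  define \<gamma> where "\<gamma> = (n - 1) * (p - 1) / 2"
  have \<gamma>: "\<gamma> < 1" using sub by (simp add: \<gamma>_def)
  define H where "H = (1 + late_time) powr (1 - \<gamma>) + (1 - \<gamma>) * (data_const powr (1 - p) / glassey_const)"
  have H: "0 < H"
    unfolding H_def using late_time(1) \<gamma> glassey_const_pos[OF c1']
    by (intro add_pos_nonneg) (auto intro!: mult_nonneg_nonneg divide_nonneg_pos)
  define Y where "Y = H powr (1 / (1 - \<gamma>))"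
  have Y: "0 \<le> Y" by (simp add: Y_def)
  have ex: "(1 - p) * (1 / (1 - \<gamma>)) = - (2 * (p - 1)) / (2 - (n - 1) * (p - 1))"
  proof -
    have *: "2 - (n - 1) * (p - 1) = 2 * (1 - \<gamma>)" by (simp add: \<gamma>_def)
    show ?thesis unfolding * using \<gamma> by (simp add: field_simps)
  qed
  have neg: "(1 - p) * (1 / (1 - \<gamma>)) \<le> 0"
    using p1 \<gamma> by (intro mult_nonpos_nonneg) auto
  show ?thesis
  proof (intro exI[of _ "late_time + Y + 1"] conjI allI impI)
    show "0 < late_time + Y + 1" using Y late_time(1) by simp
    fix eps T u ut U1 U2 F1 F2
    assume s: "sol eps T u ut U1 U2 F1 F2" and e1: "eps < 1"
    interpret weak_solution_ode G K b u0 u1 \<phi> p q c1 c2 R0 R1 lam cphi Cf n \<rho> eps T u ut U1 U2 F1 F2 by (rule s)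
    have ge1: "1 \<le> eps powr (1 - p)"
      using powr_mono'[of "1 - p" 0 eps] eps e1 p1 by simp
    have bound: "t \<le> Y * eps powr ((1 - p) * (1 / (1 - \<gamma>)))" if t: "late_time \<le> t" "t < T" for t
    proof -
      have "((1 + t) powr (1 - \<gamma>) - (1 + late_time) powr (1 - \<gamma>)) / (1 - \<gamma>) \<le>
          data_const powr (1 - p) / glassey_const * eps powr (1 - p)"
        using sol_glassey[OF s c1' t] integral_powr_shift[OF late_time(1) t(1), of \<gamma>] \<gamma> by (simp add: \<gamma>_def)
      then have "(1 + t) powr (1 - \<gamma>) \<le> (1 + late_time) powr (1 - \<gamma>) * 1 +
          (1 - \<gamma>) * (data_const powr (1 - p) / glassey_const * eps powr (1 - p))"
        using \<gamma> by (simp add: pos_divide_le_eq mult.commute)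
      also have "\<dots> \<le> (1 + late_time) powr (1 - \<gamma>) * eps powr (1 - p) +
          (1 - \<gamma>) * (data_const powr (1 - p) / glassey_const * eps powr (1 - p))"
        using ge1 by (intro add_right_mono mult_left_mono) auto
      also have "\<dots> = H * eps powr (1 - p)" by (simp add: H_def algebra_simps)
      finally have "((1 + t) powr (1 - \<gamma>)) powr (1 / (1 - \<gamma>)) \<le> (H * eps powr (1 - p)) powr (1 / (1 - \<gamma>))"
        using \<gamma> by (intro powr_mono2) auto
      moreover have "((1 + t) powr (1 - \<gamma>)) powr (1 / (1 - \<gamma>)) = 1 + t"
        using \<gamma> t late_time(1) by (simp add: powr_powr)
      moreover have "(H * eps powr (1 - p)) powr (1 / (1 - \<gamma>)) = Y * eps powr ((1 - p) * (1 / (1 - \<gamma>)))"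
        using H eps by (simp add: powr_mult powr_powr Y_def)
      ultimately show ?thesis by simp
    qed
    have "T \<le> max late_time (Y * eps powr ((1 - p) * (1 / (1 - \<gamma>))))"
    proof (cases "T \<le> late_time")
      case False
      \<comment> \<open>The estimate holds for every time between \<open>late_time\<close> and
        \<open>T\<close>; density passes it on to \<open>T\<close>.\<close>
      then have "T \<le> Y * eps powr ((1 - p) * (1 / (1 - \<gamma>)))"
        by (intro dense_le_bounded[of late_time T] bound) auto
      then show ?thesis by simp
    qed simp
    then have "T \<le> (late_time + Y + 1) * eps powr ((1 - p) * (1 / (1 - \<gamma>)))"
      by (rule max_le_const_mult_powr) (use eps e1 neg late_time(1) Y in auto)
    then show "T \<le> (late_time + Y + 1) * eps powr (- (2 * (p - 1)) / (2 - (n - 1) * (p - 1)))"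
      unfolding ex .
  qed
qed

text \<open>The weight is now exactly 1/(1+r), so it is the logarithm of time that is bounded by a
  multiple of \<epsilon>^(1-p). As this power is at least 1, the constant
  \<open>ln (1 + late_time)\<close> is absorbed.\<close>

lemma lifespan_glassey_critical:
  assumes c1': "0 < c1" and crit: "(n - 1) * (p - 1) = 2"
  shows "\<exists>C>0. \<forall>eps T u ut U1 U2 F1 F2. sol eps T u ut U1 U2 F1 F2 \<longrightarrow> eps < 1 \<longrightarrow>
    T \<le> exp (C * eps powr (- (p - 1)))"
proof -
  define H where "H = ln (1 + late_time) + data_const powr (1 - p) / glassey_const + 1"
  have H: "0 < H"
    unfolding H_def using late_time(1) glassey_const_pos[OF c1']
    by (intro add_nonneg_pos add_nonneg_nonneg) auto
  show ?thesis
  proof (intro exI[of _ H] conjI allI impI H)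
    fix eps T u ut U1 U2 F1 F2
    assume s: "sol eps T u ut U1 U2 F1 F2" and e1: "eps < 1"
    interpret weak_solution_ode G K b u0 u1 \<phi> p q c1 c2 R0 R1 lam cphi Cf n \<rho> eps T u ut U1 U2 F1 F2 by (rule s)
    define E where "E = eps powr (1 - p)"
    have ge1: "1 \<le> E"
      using powr_mono'[of "1 - p" 0 eps] eps e1 p1 by (simp add: E_def)
    define d where "d = data_const powr (1 - p) / glassey_const"
    have d: "0 \<le> d" using glassey_const_pos[OF c1'] by (simp add: d_def)
    have l0: "0 \<le> ln (1 + late_time)" using late_time(1) by simp
    have HE: "ln (1 + late_time) + d * E \<le> H * E"
    proof -
      have "ln (1 + late_time) * 1 \<le> ln (1 + late_time) * E" using l0 ge1 by (rule mult_left_mono[rotated])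
      then show ?thesis using ge1 by (simp add: H_def d_def[symmetric] algebra_simps)
    qed
    have bound: "t \<le> exp (H * E)" if t: "late_time \<le> t" "t < T" for t
    proof -
      have "ln (1 + t) - ln (1 + late_time) \<le> d * E"
        using sol_glassey[OF s c1' t] integral_inverse_shift[OF late_time(1) t(1)]
        by (simp add: crit d_def E_def)
      then have "ln (1 + t) \<le> H * E" using HE by linarith
      then have "exp (ln (1 + t)) \<le> exp (H * E)" by simp
      then show ?thesis using t late_time(1) by simp
    qed
    have "late_time \<le> exp (H * E)"
    proof -
      have "0 \<le> d * E" using d ge1 by simp
      then have "ln (1 + late_time) \<le> H * E" using HE by linarith
      then have "exp (ln (1 + late_time)) \<le> exp (H * E)" by simp
      then show ?thesis using late_time(1) by simp
    qed
    have "T \<le> exp (H * E)"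
    proof (cases "T \<le> late_time")
      case True
      then show ?thesis using \<open>late_time \<le> exp (H * E)\<close> by simp
    next
      case False
      then show ?thesis by (intro dense_le_bounded[of late_time T] bound) auto
    qed
    then show "T \<le> exp (H * eps powr (- (p - 1)))" by (simp add: E_def)
  qed
qed

end

text \<open>\<open>p_S n\<close> is the larger root of the polynomial, and the smaller one is
  negative because D > n + 1. Completing the square turns lying between the roots into |2(n-1)q -
  (n+1)| < D.\<close>

lemma strauss_exponent_imp:
  fixes n q :: real
  assumes "1 < n" "1 < q" "q < p_S n"
  shows "(n - 1) * q\<^sup>2 - (n + 1) * q - 2 < 0"
proof -
  define D where "D = sqrt ((n + 1)\<^sup>2 + 8 * (n - 1))"
  have D2: "D\<^sup>2 = (n + 1)\<^sup>2 + 8 * (n - 1)" unfolding D_def using assms by (intro real_sqrt_pow2) simp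
  have "n + 1 < D" unfolding D_def using assms by (intro real_less_rsqrt) simp
  have "2 * (n - 1) * q < n + 1 + D"
    using assms(3) unfolding p_S_def D_def[symmetric] using assms(1) by (simp add: field_simps)
  moreover have "n + 1 - D < 2 * (n - 1) * q"
    using \<open>n + 1 < D\<close> assms by (smt (verit) mult_pos_pos)
  ultimately have "\<bar>2 * (n - 1) * q - (n + 1)\<bar> < D" by linarith
  then have "(2 * (n - 1) * q - (n + 1))\<^sup>2 < D\<^sup>2"
    using abs_le_square_iff[of D "2 * (n - 1) * q - (n + 1)"] \<open>n + 1 < D\<close> assms(1) by (simp add: not_le[symmetric])
  then have "4 * (n - 1) * ((n - 1) * q\<^sup>2 - (n + 1) * q - 2) < 0"
    unfolding D2 by (simp add: power2_eq_square algebra_simps)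
  then show ?thesis using assms(1) by (simp add: mult_less_0_iff)
qed

theorem theorem1p1:
  fixes G :: "real^'n::finite \<Rightarrow> real^'n^'n"
    and K b :: "real \<Rightarrow> real"
    and u0 u1 :: "real^'n \<Rightarrow> real"
    and p q c1 c2 R0 R1 :: real
  assumes n2: "CARD('n) \<ge> 2"
    and p1: "p > 1" and q1: "q > 1" and c1: "c1 \<ge> 0" and c2: "c2 \<ge> 0"
    and b: "set_integrable lborel {0..} b"
    and AE: "asymp_euclidean G K"
    and H: "hyp_H G K"
    and u0: "test_fun u0" and u1: "test_fun u1"
    and u0pos: "\<forall>x. 0 \<le> u0 x" and u1pos: "\<forall>x. 0 \<le> u1 x"
    and nontriv: "(\<exists>x. u0 x \<noteq> 0) \<or> (\<exists>x. u1 x \<noteq> 0)"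
    and R0: "R0 > 0" and supp: "\<forall>x. R0 < norm x \<longrightarrow> u0 x = 0 \<and> u1 x = 0"
    and R1: "R1 \<ge> integral {0..R0} K"
  shows "\<exists>\<epsilon>0>0. \<exists>C0>0. \<forall>\<epsilon> T (u :: real \<Rightarrow> real^'n \<Rightarrow> real) ut.
     0 < \<epsilon> \<and> \<epsilon> < \<epsilon>0 \<and> 0 < T \<and>
     weak_sol G b c1 c2 p q \<epsilon> u0 u1 T u ut \<and>
     (\<forall>t\<in>{0..<T}. \<forall>x. t + R1 < integral {0..norm x} K \<longrightarrow> u t x = 0)
     \<longrightarrow>
     (let n = real CARD('n) in
       (c1 > 0 \<and> 1 < p \<and> p < p_G n \<longrightarrow>
          T \<le> C0 * \<epsilon> powr (- (2 * (p - 1)) / (2 - (n - 1) * (p - 1)))) \<and>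
       (c1 > 0 \<and> p = p_G n \<longrightarrow> T \<le> exp (C0 * \<epsilon> powr (- (p - 1)))) \<and>
       (c1 * c2 > 0 \<and> (q - 1) * ((n - 1) * p - 2) < 4 \<longrightarrow>
          T \<le> C0 * \<epsilon> powr (- (2 * p * (q - 1)) / (2 * q + 2 - (n - 1) * p * (q - 1)))) \<and>
       (c2 > 0 \<and> 1 < q \<and> q < p_S n \<longrightarrow>
          T \<le> C0 * \<epsilon> powr ((2 * q * (q - 1)) / ((n - 1) * q\<^sup>2 - (n + 1) * q - 2))) \<and>
       (c2 > 0 \<and> CARD('n) = 2 \<and> 1 < q \<and> q < 2 \<and> (\<exists>x. u1 x \<noteq> 0) \<longrightarrow>
          T \<le> C0 * \<epsilon> powr (- (q - 1) / (3 - q))))"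
proof -
  interpret M: asymp_euclidean_metric G K using AE by unfold_locales
  define n where "n = real CARD('n)"
  have n: "1 < n" using n2 by (simp add: n_def)
  obtain lam cphi \<phi> where phi: "0 < lam" "0 < cphi" "smooth_fun \<phi>" "\<And>x. 0 \<le> \<phi> x" "\<exists>x. \<phi> x \<noteq> 0"
    "\<And>x. LB G \<phi> x = lam\<^sup>2 * \<phi> x"
    "\<And>x. \<phi> x \<le> cphi * jb (lam * norm x) powr (- (n - 1) / 2) * exp (lam * M.kap (norm x))"
    using H unfolding hyp_H_def M.kap_def n_def by blast
  obtain \<rho> Cf where front: "1 \<le> Cf" "\<And>M. 0 \<le> \<rho> M"
    "\<And>M r t. \<rho> M \<le> r \<Longrightarrow> t < real M \<Longrightarrow> t + R1 < M.kap r"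
    "\<And>M r. 0 \<le> r \<Longrightarrow> r \<le> \<rho> M + 2 \<Longrightarrow> M.kap r \<le> real M + Cf - (\<rho> M + 2 - r) / 2"
    "\<And>M. 1 + (\<rho> M + 2) \<le> Cf * (1 + real M)" "\<And>M. 1 + real M \<le> Cf * (1 + (\<rho> M + 2))"
    using M.front_radius[of R1] by blast
  interpret S: blowup_setting G K b u0 u1 \<phi> p q c1 c2 R0 R1 lam cphi Cf n \<rho>
    by unfold_locales (use b p1 q1 c1 c2 u0 u1 u0pos u1pos nontriv supp phi front n_def in blast)+
  \<comment> \<open>Each constant is obtained under an implication, with 1 as witness when the case
    hypothesis fails, so that a single sum can serve all cases.\<close>
  have "\<exists>C>0. 0 < c1 \<and> p < p_G n \<longrightarrow> (\<forall>eps T u ut U1 U2 F1 F2. S.sol eps T u ut U1 U2 F1 F2 \<longrightarrow> eps < 1 \<longrightarrow>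
    T \<le> C * eps powr (- (2 * (p - 1)) / (2 - (n - 1) * (p - 1))))"
  proof (cases "0 < c1 \<and> p < p_G n")
    case True
    then have "(n - 1) * (p - 1) < 2" using n by (simp add: p_G_def field_simps)
    with True show ?thesis using S.lifespan_glassey_subcritical by blast
  qed (use zero_less_one in blast)
  then obtain C1 where C1: "0 < C1" "\<And>eps T u ut U1 U2 F1 F2. 0 < c1 \<Longrightarrow> p < p_G n \<Longrightarrow> S.sol eps T u ut U1 U2 F1 F2 \<Longrightarrow> eps < 1 \<Longrightarrow>
    T \<le> C1 * eps powr (- (2 * (p - 1)) / (2 - (n - 1) * (p - 1)))" by blast
  have "\<exists>C>0. 0 < c1 \<and> p = p_G n \<longrightarrow> (\<forall>eps T u ut U1 U2 F1 F2. S.sol eps T u ut U1 U2 F1 F2 \<longrightarrow> eps < 1 \<longrightarrow>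
    T \<le> exp (C * eps powr (- (p - 1))))"
  proof (cases "0 < c1 \<and> p = p_G n")
    case True
    then have "(n - 1) * (p - 1) = 2" using n by (simp add: p_G_def field_simps)
    with True show ?thesis using S.lifespan_glassey_critical by blast
  qed (use zero_less_one in blast)
  then obtain C2 where C2: "0 < C2" "\<And>eps T u ut U1 U2 F1 F2. 0 < c1 \<Longrightarrow> p = p_G n \<Longrightarrow> S.sol eps T u ut U1 U2 F1 F2 \<Longrightarrow> eps < 1 \<Longrightarrow>
    T \<le> exp (C2 * eps powr (- (p - 1)))" by blast
  have "\<exists>C>0. 0 < c1 * c2 \<and> (q - 1) * ((n - 1) * p - 2) < 4 \<longrightarrow> (\<forall>eps T u ut U1 U2 F1 F2. S.sol eps T u ut U1 U2 F1 F2 \<longrightarrow> eps < 1 \<longrightarrow>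
    T \<le> C * eps powr (- (2 * p * (q - 1)) / (2 * q + 2 - (n - 1) * p * (q - 1))))"
  proof (cases "0 < c1 * c2 \<and> (q - 1) * ((n - 1) * p - 2) < 4")
    case True
    then have "0 < c1" "0 < c2" using c1 c2 by (auto simp: zero_less_mult_iff)
    with True show ?thesis using S.lifespan_mixed by blast
  qed (use zero_less_one in blast)
  then obtain C3 where C3: "0 < C3" "\<And>eps T u ut U1 U2 F1 F2. 0 < c1 * c2 \<Longrightarrow> (q - 1) * ((n - 1) * p - 2) < 4 \<Longrightarrow> S.sol eps T u ut U1 U2 F1 F2 \<Longrightarrow> eps < 1 \<Longrightarrow>
    T \<le> C3 * eps powr (- (2 * p * (q - 1)) / (2 * q + 2 - (n - 1) * p * (q - 1)))" by blast
  have "\<exists>C>0. 0 < c2 \<and> q < p_S n \<longrightarrow> (\<forall>eps T u ut U1 U2 F1 F2. S.sol eps T u ut U1 U2 F1 F2 \<longrightarrow> eps < 1 \<longrightarrow>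
    T \<le> C * eps powr ((2 * q * (q - 1)) / ((n - 1) * q\<^sup>2 - (n + 1) * q - 2)))"
  proof (cases "0 < c2 \<and> q < p_S n")
    case True
    then show ?thesis using S.lifespan_strauss strauss_exponent_imp[OF n q1] by blast
  qed (use zero_less_one in blast)
  then obtain C4 where C4: "0 < C4" "\<And>eps T u ut U1 U2 F1 F2. 0 < c2 \<Longrightarrow> q < p_S n \<Longrightarrow> S.sol eps T u ut U1 U2 F1 F2 \<Longrightarrow> eps < 1 \<Longrightarrow>
    T \<le> C4 * eps powr ((2 * q * (q - 1)) / ((n - 1) * q\<^sup>2 - (n + 1) * q - 2))" by blast
  have "\<exists>C>0. 0 < c2 \<and> n = 2 \<and> q < 2 \<and> (\<exists>x. u1 x \<noteq> 0) \<longrightarrow> (\<forall>eps T u ut U1 U2 F1 F2. S.sol eps T u ut U1 U2 F1 F2 \<longrightarrow> eps < 1 \<longrightarrow>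
    T \<le> C * eps powr (- (q - 1) / (3 - q)))"
  proof (cases "0 < c2 \<and> n = 2 \<and> q < 2 \<and> (\<exists>x. u1 x \<noteq> 0)")
    case True
    then show ?thesis using S.lifespan_2d by blast
  qed (use zero_less_one in blast)
  then obtain C5 where C5: "0 < C5" "\<And>eps T u ut U1 U2 F1 F2. 0 < c2 \<Longrightarrow> n = 2 \<Longrightarrow> q < 2 \<Longrightarrow> \<exists>x. u1 x \<noteq> 0 \<Longrightarrow> S.sol eps T u ut U1 U2 F1 F2 \<Longrightarrow> eps < 1 \<Longrightarrow>
    T \<le> C5 * eps powr (- (q - 1) / (3 - q))" by blast
  define C0 where "C0 = C1 + C2 + C3 + C4 + C5"
  have C0: "0 < C0" "C1 \<le> C0" "C2 \<le> C0" "C3 \<le> C0" "C4 \<le> C0" "C5 \<le> C0"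
    using C1(1) C2(1) C3(1) C4(1) C5(1) by (simp_all add: C0_def)
  have up: "T \<le> C0 * x" if "T \<le> C * x" "C \<le> C0" "0 \<le> x" for T C x
    using that by (meson mult_right_mono order_trans)
  show ?thesis
  \<comment> \<open>The threshold 1 is enough: smallness of \<epsilon> serves only to make its
    nonpositive powers at least 1.\<close>
  proof (rule exI[of _ "1::real"], rule conjI[OF zero_less_one], rule exI[of _ C0], rule conjI[OF C0(1)],
      intro allI impI)
    fix \<epsilon> T and u ut :: "real \<Rightarrow> real^'n \<Rightarrow> real"
    assume a: "0 < \<epsilon> \<and> \<epsilon> < 1 \<and> 0 < T \<and> weak_sol G b c1 c2 p q \<epsilon> u0 u1 T u ut \<and>
      (\<forall>t\<in>{0..<T}. \<forall>x. t + R1 < integral {0..norm x} K \<longrightarrow> u t x = 0)"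
    interpret W: weak_solution G K b u0 u1 \<phi> p q c1 c2 R0 R1 lam cphi Cf n \<rho> \<epsilon> T u ut
      by unfold_locales (use a in \<open>auto simp: M.kap_def\<close>)
    obtain U1 U2 F1 F2 where s: "S.sol \<epsilon> T u ut U1 U2 F1 F2"
      using W.weak_solution_ode_exists by blast
    have e: "\<epsilon> < 1" using a by simp
    show "let n = real CARD('n) in
       (c1 > 0 \<and> 1 < p \<and> p < p_G n \<longrightarrow>
          T \<le> C0 * \<epsilon> powr (- (2 * (p - 1)) / (2 - (n - 1) * (p - 1)))) \<and>
       (c1 > 0 \<and> p = p_G n \<longrightarrow> T \<le> exp (C0 * \<epsilon> powr (- (p - 1)))) \<and>
       (c1 * c2 > 0 \<and> (q - 1) * ((n - 1) * p - 2) < 4 \<longrightarrow>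
          T \<le> C0 * \<epsilon> powr (- (2 * p * (q - 1)) / (2 * q + 2 - (n - 1) * p * (q - 1)))) \<and>
       (c2 > 0 \<and> 1 < q \<and> q < p_S n \<longrightarrow>
          T \<le> C0 * \<epsilon> powr ((2 * q * (q - 1)) / ((n - 1) * q\<^sup>2 - (n + 1) * q - 2))) \<and>
       (c2 > 0 \<and> CARD('n) = 2 \<and> 1 < q \<and> q < 2 \<and> (\<exists>x. u1 x \<noteq> 0) \<longrightarrow>
          T \<le> C0 * \<epsilon> powr (- (q - 1) / (3 - q)))"
      unfolding Let_def n_def[symmetric]
    proof (intro conjI impI)
      assume "c1 > 0 \<and> 1 < p \<and> p < p_G n"
      then show "T \<le> C0 * \<epsilon> powr (- (2 * (p - 1)) / (2 - (n - 1) * (p - 1)))"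
        using C1(2)[OF _ _ s e] C0(2) by (intro up[of T C1]) auto
    next
      assume "c1 > 0 \<and> p = p_G n"
      then have "T \<le> exp (C2 * \<epsilon> powr (- (p - 1)))" using C2(2)[OF _ _ s e] by blast
      also have "\<dots> \<le> exp (C0 * \<epsilon> powr (- (p - 1)))" using C0(3) by (simp add: mult_right_mono)
      finally show "T \<le> exp (C0 * \<epsilon> powr (- (p - 1)))" .
    next
      assume "c1 * c2 > 0 \<and> (q - 1) * ((n - 1) * p - 2) < 4"
      then show "T \<le> C0 * \<epsilon> powr (- (2 * p * (q - 1)) / (2 * q + 2 - (n - 1) * p * (q - 1)))"
        using C3(2)[OF _ _ s e] C0(4) by (intro up[of T C3]) auto
    next
      assume "c2 > 0 \<and> 1 < q \<and> q < p_S n"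
      then show "T \<le> C0 * \<epsilon> powr ((2 * q * (q - 1)) / ((n - 1) * q\<^sup>2 - (n + 1) * q - 2))"
        using C4(2)[OF _ _ s e] C0(5) by (intro up[of T C4]) auto
    next
      assume "c2 > 0 \<and> CARD('n) = 2 \<and> 1 < q \<and> q < 2 \<and> (\<exists>x. u1 x \<noteq> 0)"
      then show "T \<le> C0 * \<epsilon> powr (- (q - 1) / (3 - q))"
        using C5(2)[OF _ _ _ _ s e] C0(6) by (intro up[of T C5]) (auto simp: n_def)
    qed
  qed
qed

end
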